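(* Assume that the maximizer $\mathcal{T}^*$ of the capacity ratio $\rho_{\mathcal{T}}=p_{\mathcal{T}}/\mu_{\mathcal{T}}$ over all non-empty $\mathcal{T}\subseteq\mathcal{S}$ is unique, and let $\lambda^*=\frac{\mu_{\mathcal{T}^*}}{Np_{\mathcal{T}^*}}$. Then, for both the c.o.c. and the c.o.s. mechanisms, $$\left(1-\frac{\lambda}{\lambda^*}\right)\bigl((Q_S)_{S\in\mathcal{T}^*},(Q_S)_{S\in\mathcal{S}\setminus\mathcal{T}^*}\bigr)\ \xrightarrow{d}\ \left(\mathrm{Exp}(1)\left(\frac{p_S}{p_{\mathcal{T}^*}}\right)_{S\in\mathcal{T}^*},\,(0)_{S\in\mathcal{S}\setminus\mathcal{T}^*}\right)\qquad\text{as }\lambda\uparrow\lambda^*,$$ where $\mathrm{Exp}(1)$ denotes one single unit-mean exponential random variable.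
   Context: System. There are $N$ parallel servers with speeds $\mu_1,\dots,\mu_N>0$. The set of job types $\mathcal{S}$ is a non-empty collection of non-empty subsets of $\{1,\dots,N\}$, and $(p_S)_{S\in\mathcal{S}}$ are fixed with $p_S>0$, $\sum_{S\in\mathcal{S}}p_S=1$. Every server belongs to at least one $S\in\mathcal{S}$. For $\lambda>0$, type-$S$ jobs arrive as independent Poisson processes of rate $N\lambda p_S$. Each arriving type-$S$ job is replicated to all servers in $S$; each server works First-Come First-Served, and a replica run on server $n$ takes an exponential time with rate $\mu_n$ (unit-mean exponential size, speed $\mu_n$). Cancel-on-completion (c.o.c.): replica sizes are independent; as soon as the first replica of a job finishes service, its remaining replicas are discarded. Cancel-on-start (c.o.s.): as soon as the first replica of a job starts service, its remaining replicas are discarded (replica sizes need not be independent); a server that becomes available takes the longest waiting compatible job, and an arriving job that finds several compatible idle servers is assigned to the one that has been idle longest (ALIS rule). Notation. For $\mathcal{T}\subseteq\mathcal{S}$, $p_{\mathcal{T}}=\sum_{S\in\mathcal{T}}p_S$ and $\mu_{\mathcal{T}}=\sum_{n\in\bigcup_{S\in\mathcal{T}}S}\mu_n$. For $c_1,\dots,c_i\in\mathcal{S}$, $\mu(c_1,\dots,c_i)=\sum_{n\in c_1\cup\dots\cup c_i}\mu_n$. $\mathcal{T}^*$ is called the critical subset and $\lambda^*$ the critical (normalized) arrival rate. Stability (known). Under either mechanism the system is stable iff $N\lambda p_{\mathcal{T}}<\mu_{\mathcal{T}}$ for all non-empty $\mathcal{T}\subseteq\mathcal{S}$, i.e. iff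 $\lambda<\lambda^*$. Stationary distributions (known). c.o.c.: the state $(c_1,\dots,c_M)$ lists the types of all jobs present in order of arrival (oldest first), and $\pi_{\text{c.o.c.}}(c_1,\dots,c_M)=C\prod_{i=1}^M\frac{N\lambda p_{c_i}}{\mu(c_1,\dots,c_i)}$. c.o.s.: the state $(c_1,\dots,c_{M};u_1,\dots,u_L)$ lists the types of all waiting jobs in order of arrival and the idle servers in order of idleness (longest idle first), where no waiting job is compatible with an idle server, and $\pi_{\text{c.o.s.}}(\boldsymbol c,\boldsymbol u)=C'\prod_{i=1}^{M}\frac{N\lambda p_{c_i}}{\mu(c_1,\dots,c_i)}\prod_{l=1}^L\frac{\mu_{u_l}}{\lambda_{\mathcal{C}(u_1,\dots,u_l)}}$ with $\lambda_{\mathcal{C}(u_1,\dots,u_l)}=N\lambda\sum_{S\in\mathcal{S}:\,S\cap\{u_1,\dots,u_l\}\ne\emptyset}p_S$. Here $C,C'$ are normalization constants. $(Q_S)_{S\in\mathcal{S}}$ is a random vector with the stationary distribution of the total number of jobs of each type in the system (including those in service); it depends on $\lambda$. $\xrightarrow{d}$ denotes convergence in distribution. *)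

theory Defs
  imports "HOL-Probability.Probability"
begin

text \<open>
  Servers are the elements of a finite type \<^typ>\<open>'n\<close>, so the number of servers is
  \<^term>\<open>CARD('n)\<close>. A job type is the set of its compatible servers.
\<close>

definition p_of :: "('n set \<Rightarrow> real) \<Rightarrow> 'n set set \<Rightarrow> real" where
  "p_of p T = (\<Sum>S\<in>T. p S)"

definition mu_of :: "('n \<Rightarrow> real) \<Rightarrow> 'n set set \<Rightarrow> real" where
  "mu_of \<mu> T = (\<Sum>n\<in>\<Union>T. \<mu> n)"

definition capacity_ratio :: "('n \<Rightarrow> real) \<Rightarrow> ('n set \<Rightarrow> real) \<Rightarrow> 'n set set \<Rightarrow> real" where
  "capacity_ratio \<mu> p T = p_of p T / mu_of \<mu> T"


text \<open>
  Global balance equations of the continuous-time Markov chain on \<open>E\<close> with transition rate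
  \<open>q x y\<close> from \<open>x\<close> to \<open>y \<noteq> x\<close>. In both chains below the total rate out of a state is bounded,
  so the chain does not explode and the probability solutions of these equations are exactly
  its stationary distributions.
\<close>

definition stationary_distribution :: "'s set \<Rightarrow> ('s \<Rightarrow> 's \<Rightarrow> real) \<Rightarrow> 's pmf \<Rightarrow> bool" where
  "stationary_distribution E q \<pi> \<longleftrightarrow>
     set_pmf \<pi> \<subseteq> E \<and>
     (\<forall>x\<in>E. pmf \<pi> x * (\<Sum>\<^sub>\<infinity>y\<in>E - {x}. q x y) = (\<Sum>\<^sub>\<infinity>y\<in>E - {x}. pmf \<pi> y * q y x))"

text \<open>
  Both systems are driven by the same events: a type-\<open>S\<close> arrival (rate \<open>N \<lambda> p\<^sub>S\<close>)
  and a completion at server \<open>n\<close> (rate \<open>\<mu>\<^sub>n\<close>). A completion at a server that is not working leaves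
  the state unchanged, and hence plays no role in the balance equations.
\<close>

definition event_rate ::
  "('n::finite set \<Rightarrow> 's \<Rightarrow> 's) \<Rightarrow> ('n \<Rightarrow> 's \<Rightarrow> 's) \<Rightarrow>
   'n set set \<Rightarrow> ('n \<Rightarrow> real) \<Rightarrow> ('n set \<Rightarrow> real) \<Rightarrow> real \<Rightarrow> 's \<Rightarrow> 's \<Rightarrow> real" where
  "event_rate arr dep \<S> \<mu> p l x y =
     (\<Sum>S | S \<in> \<S> \<and> arr S x = y. real CARD('n) * l * p S) +
     (\<Sum>n | dep n x = y. \<mu> n)"


subsection \<open>Cancel-on-completion\<close>

text \<open>
  The state lists the types of all jobs present, oldest first. Under First-Come First-Served each
  server runs its replica of the oldest compatible job, and the first replica to finish removes
  the whole job. That job is the first one of its type in the list, so \<^const>\<open>remove1\<close> removes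
  the right entry.
\<close>

type_synonym 'n coc_state = "'n set list"

definition coc_states :: "'n set set \<Rightarrow> 'n coc_state set" where
  "coc_states \<S> = lists \<S>"

definition coc_arrive :: "'n set \<Rightarrow> 'n coc_state \<Rightarrow> 'n coc_state" where
  "coc_arrive S c = c @ [S]"

definition coc_complete :: "'n \<Rightarrow> 'n coc_state \<Rightarrow> 'n coc_state" where
  "coc_complete n c = (case find (\<lambda>S. n \<in> S) c of None \<Rightarrow> c | Some S \<Rightarrow> remove1 S c)"

definition coc_rate ::
  "'n::finite set set \<Rightarrow> ('n \<Rightarrow> real) \<Rightarrow> ('n set \<Rightarrow> real) \<Rightarrow> real \<Rightarrow> 'n coc_state \<Rightarrow> 'n coc_state \<Rightarrow> real" where
  "coc_rate = event_rate coc_arrive coc_complete"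

definition coc_jobs :: "'n::finite coc_state \<Rightarrow> real ^ ('n set)" where
  "coc_jobs c = (\<chi> S. real (count_list c S))"


subsection \<open>Cancel-on-start\<close>

text \<open>
  A state \<open>(c, u, s)\<close> consists of the types \<open>c\<close> of the waiting jobs (oldest first), the idle
  servers \<open>u\<close> (longest idle first), and the type \<open>s n\<close> of the job in service at server \<open>n\<close>
  (\<^const>\<open>None\<close> if \<open>n\<close> is idle). The evolution of \<open>(c, u)\<close> does not depend on \<open>s\<close>; the
  component \<open>s\<close> is recorded because \<open>(c, u)\<close> does not determine the types of the jobs in service,
  which are part of the job counts.
\<close>

type_synonym 'n cos_state = "'n set list \<times> 'n list \<times> ('n \<Rightarrow> 'n set option)"

definition cos_states :: "'n set set \<Rightarrow> 'n cos_state set" where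
  "cos_states \<S> = {(c, u, s).
     c \<in> lists \<S> \<and> distinct u \<and> set u = {n. s n = None} \<and>
     (\<forall>n S. s n = Some S \<longrightarrow> S \<in> \<S> \<and> n \<in> S) \<and>
     (\<forall>S\<in>set c. S \<inter> set u = {})}"

definition cos_arrive :: "'n set \<Rightarrow> 'n cos_state \<Rightarrow> 'n cos_state" where
  "cos_arrive S = (\<lambda>(c, u, s).
     case find (\<lambda>n. n \<in> S) u of
       None \<Rightarrow> (c @ [S], u, s)
     | Some n \<Rightarrow> (c, remove1 n u, s(n := Some S)))"

definition cos_complete :: "'n \<Rightarrow> 'n cos_state \<Rightarrow> 'n cos_state" where
  "cos_complete n = (\<lambda>(c, u, s).
     if s n = None then (c, u, s)
     else case find (\<lambda>S. n \<in> S) c of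
       None \<Rightarrow> (c, u @ [n], s(n := None))
     | Some S \<Rightarrow> (remove1 S c, u, s(n := Some S)))"

definition cos_rate ::
  "'n::finite set set \<Rightarrow> ('n \<Rightarrow> real) \<Rightarrow> ('n set \<Rightarrow> real) \<Rightarrow> real \<Rightarrow> 'n cos_state \<Rightarrow> 'n cos_state \<Rightarrow> real" where
  "cos_rate = event_rate cos_arrive cos_complete"

definition cos_jobs :: "'n::finite cos_state \<Rightarrow> real ^ ('n set)" where
  "cos_jobs = (\<lambda>(c, u, s). \<chi> S. real (count_list c S + card {n. s n = Some S}))"


subsection \<open>Convergence in distribution\<close>

text \<open>
  The library's \<^const>\<open>weak_conv_m\<close> covers only sequences of measures on the real line.
\<close>

definition converges_in_distribution ::
  "('i \<Rightarrow> 'a::metric_space measure) \<Rightarrow> 'a measure \<Rightarrow> 'i filter \<Rightarrow> bool" where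
  "converges_in_distribution M L F \<longleftrightarrow>
     (\<forall>f :: 'a \<Rightarrow> real. continuous_on UNIV f \<longrightarrow> bounded (range f) \<longrightarrow>
        ((\<lambda>i. \<integral>x. f x \<partial>M i) \<longlongrightarrow> (\<integral>x. f x \<partial>L)) F)"

text \<open>
  Law of the vector with components \<open>Exp(1) p\<^sub>S / p\<^sub>T\<close> for \<open>S \<in> T\<close> and \<open>0\<close> for all other \<open>S\<close>,
  with one exponential variable shared by all components. Vectors are indexed by all subsets
  of the server set; for subsets that are not job types, the components of \<^const>\<open>coc_jobs\<close> and
  \<^const>\<open>cos_jobs\<close> vanish on the state spaces, and so do those of the limit.
\<close>

definition limit_law :: "('n::finite set \<Rightarrow> real) \<Rightarrow> 'n set set \<Rightarrow> (real ^ ('n set)) measure" where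
  "limit_law p T =
     distr (density lborel (exponential_density 1)) borel
       (\<lambda>e. \<chi> S. if S \<in> T then e * (p S / p_of p T) else 0)"

end

theory Submission
  imports Defs "HOL-Real_Asymp.Real_Asymp"
begin

text \<open>
  The balance equations have a unique probability solution, which is the product form known for
  order-independent queues. Summing it over the states whose jobs have exactly the types \<open>T\<close>, and splitting off
  the last job, expresses the generating function \<open>G T\<close> by those of the sets \<open>T - {S}\<close>, with the denominator
  \<open>\<mu>\<^sub>T - (\<Sum>S\<in>T. N \<lambda> p\<^sub>S z\<^sub>S)\<close>. For \<open>z\<^sub>S = exp (- \<epsilon> \<theta>\<^sub>S)\<close> with \<open>\<epsilon> = 1 - \<lambda> / \<lambda>\<^sup>*\<close>,
  only the denominator of the critical set vanishes in the limit, like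
  \<open>\<epsilon> (1 + (\<Sum>S\<in>T\<^sup>*. \<theta>\<^sub>S p\<^sub>S / p\<^sub>T\<^sub>*))\<close> up to a constant. Hence the Laplace transform of the scaled queue
  lengths converges to that of the claimed limit, and the convergence in distribution follows by a
  Stone-Weierstrass argument.
\<close>

section \<open>Invariant distributions\<close>

text \<open>The hypotheses provide only some solution of the balance equations, so the product form
  is derived here, including summability of its weights. Balance of the weights splits into two
  local identities, one for appending at the end of a list and one for removing the first compatible
  entry. In the cancel-on-start system the same pair serves the list of idle servers, with arrivals
  in the role of the servers.

  The generating functions are never computed explicitly. Multiplied by \<epsilon>, each of them
  tends to a constant independent of \<theta>, divided by one factor common to all sets: the pole
  arises at the critical set, larger sets inherit it linearly through the recursion, and the
  remaining sets stay bounded. The unknown constants therefore cancel between a transform and its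
  normalization. Uniqueness of the maximizer is what excludes a second vanishing
  denominator.\<close>

lemma has_sum_finite_sum:
  fixes f :: "'i \<Rightarrow> 'a \<Rightarrow> real"
  assumes "\<And>i. i \<in> I \<Longrightarrow> (f i has_sum s i) A"
  shows "((\<lambda>x. \<Sum>i\<in>I. f i x) has_sum (\<Sum>i\<in>I. s i)) A"
  using assms by (induction I rule: infinite_finite_induct) (auto intro!: has_sum_add)

lemma has_sum_minus:
  fixes f g :: "'a \<Rightarrow> real"
  assumes "(f has_sum a) A" "(g has_sum b) A"
  shows "((\<lambda>x. f x - g x) has_sum (a - b)) A"
  using has_sum_add[OF assms(1) has_sum_uminusI[OF assms(2)]] by simp

lemma pmf_has_sum: "(pmf \<pi> has_sum measure (measure_pmf \<pi>) A) A"
proof -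
  have "pmf \<pi> summable_on A"
    using pmf_abs_summable[of \<pi> A] abs_summable_equivalent[of "pmf \<pi>" A] abs_summable_summable by blast
  moreover have "measure (measure_pmf \<pi>) A = infsum (pmf \<pi>) A"
    using measure_pmf_conv_infsetsum infsetsum_infsum[OF pmf_abs_summable] by metis
  ultimately show ?thesis by simp
qed

lemma expectation_eq_infsum:
  fixes f :: "'a \<Rightarrow> real"
  assumes "\<And>x. x \<in> set_pmf \<pi> \<Longrightarrow> \<bar>f x\<bar> \<le> B"
  shows "measure_pmf.expectation \<pi> f = infsum (\<lambda>x. pmf \<pi> x * f x) UNIV"
proof -
  have "integrable (measure_pmf \<pi>) f"
    using assms by (intro measure_pmf.integrable_const_bound[where B = B]) (auto simp: AE_measure_pmf_iff)
  hence "Infinite_Set_Sum.abs_summable_on (\<lambda>x. pmf \<pi> x * f x) UNIV"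
    by (simp add: Infinite_Set_Sum.abs_summable_on_def measure_pmf_eq_density integrable_density)
  thus ?thesis
    by (simp add: pmf_expectation_eq_infsetsum infsetsum_infsum)
qed

lemma pmf_from_has_sum:
  fixes w :: "'a \<Rightarrow> real"
  assumes "\<And>x. x \<in> V \<Longrightarrow> w x \<ge> 0" "(w has_sum Z) V" "Z > 0"
  obtains \<nu> where "\<And>x. pmf \<nu> x = (if x \<in> V then w x / Z else 0)"
proof -
  define f where "f = (\<lambda>x. if x \<in> V then w x / Z else 0)"
  have nn: "f x \<ge> 0" for x using assms by (auto simp: f_def)
  have "((\<lambda>x. w x / Z) has_sum (Z/Z)) V"
    using assms(2) by (intro has_sum_divide_const)
  hence hs: "(f has_sum 1) UNIV"
    using assms(3) by (subst has_sum_cong_neutral[where T = V and g = "\<lambda>x. w x / Z"]) (auto simp: f_def)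
  have ab: "Infinite_Set_Sum.abs_summable_on f UNIV"
    using has_sum_imp_summable[OF hs] abs_summable_equivalent[of f UNIV]
    by (metis summable_on_iff_abs_summable_on_real)
  have "(\<integral>\<^sup>+x. ennreal (f x) \<partial>count_space UNIV) = ennreal (infsetsum f UNIV)"
    by (rule nn_integral_conv_infsetsum[OF ab]) (use nn in auto)
  also have "infsetsum f UNIV = 1"
    using infsetsum_infsum[OF ab] hs by (simp add: infsumI)
  finally have "pmf (embed_pmf f) x = f x" for x using pmf_embed_pmf[of f x] nn by simp
  thus ?thesis using that[of "embed_pmf f"] by (simp add: f_def)
qed

text \<open>Up to the factor \<open>sum r I\<close> this is invariance under the uniformized chain,
  which applies \<open>act e\<close> with probability \<open>r e / sum r I\<close>. Balance is
  stated for sets because it is evaluated below at the set where one distribution exceeds another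
  and at preimages under a projection.\<close>

definition invariant_pmf :: "'e set \<Rightarrow> ('e \<Rightarrow> real) \<Rightarrow> ('e \<Rightarrow> 's \<Rightarrow> 's) \<Rightarrow> 's pmf \<Rightarrow> bool" where
  "invariant_pmf I r act \<pi> \<longleftrightarrow>
     (\<forall>A. measure (measure_pmf \<pi>) A * sum r I = (\<Sum>e\<in>I. r e * measure (measure_pmf \<pi>) (act e -` A)))"

lemma vimage_measure_has_sum:
  "((\<lambda>x. measure (measure_pmf \<pi>) (f -` {x})) has_sum measure (measure_pmf \<pi>) (f -` A)) A"
  using pmf_has_sum[of "map_pmf f \<pi>" A] by (simp add: pmf_map[abs_def])

lemma invariant_pmf_pointwise:
  assumes "\<And>x. pmf \<pi> x * sum r I = (\<Sum>e\<in>I. r e * measure (measure_pmf \<pi>) (act e -` {x}))"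
  shows "invariant_pmf I r act \<pi>"
  unfolding invariant_pmf_def
proof
  fix A
  have "((\<lambda>x. \<Sum>e\<in>I. r e * measure (measure_pmf \<pi>) (act e -` {x})) has_sum
     (\<Sum>e\<in>I. r e * measure (measure_pmf \<pi>) (act e -` A))) A"
    by (intro has_sum_finite_sum has_sum_cmult_right vimage_measure_has_sum)
  moreover have "((\<lambda>x. pmf \<pi> x * sum r I) has_sum (measure (measure_pmf \<pi>) A * sum r I)) A"
    by (intro has_sum_cmult_left pmf_has_sum)
  ultimately show "measure (measure_pmf \<pi>) A * sum r I = (\<Sum>e\<in>I. r e * measure (measure_pmf \<pi>) (act e -` A))"
    using assms has_sum_unique by simp
qed

text \<open>Lumping: if the event maps descend along \<open>\<phi>\<close>, so does invariance.
  Compatibility is asked on the support only, as it may fail at states that violate the constraints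
  of the model.\<close>

lemma invariant_pmf_map:
  assumes inv: "invariant_pmf I r act \<pi>"
    and "\<And>e x. e \<in> I \<Longrightarrow> x \<in> set_pmf \<pi> \<Longrightarrow> \<phi> (act e x) = act' e (\<phi> x)"
  shows "invariant_pmf I r act' (map_pmf \<phi> \<pi>)"
  unfolding invariant_pmf_def measure_map_pmf
proof
  fix A
  have "measure (measure_pmf \<pi>) (\<phi> -` act' e -` A) = measure (measure_pmf \<pi>) (act e -` \<phi> -` A)" if "e \<in> I" for e
    using assms(2)[OF that] by (intro measure_pmf.finite_measure_eq_AE) (auto simp: AE_measure_pmf_iff)
  with inv show "measure (measure_pmf \<pi>) (\<phi> -` A) * sum r I =
      (\<Sum>e\<in>I. r e * measure (measure_pmf \<pi>) (\<phi> -` act' e -` A))"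
    by (simp add: invariant_pmf_def)
qed

text \<open>
  The difference of two invariant distributions has maximal mass on the set where it is positive, and the
  balance equation expresses this mass as a weighted mean of the masses of the preimages of the set under the
  events; hence each preimage carries the maximal mass too and contains the set.
\<close>

lemma invariant_pmf_excess_closed:
  assumes fin: "finite I" and r: "\<And>e. e \<in> I \<Longrightarrow> r e > 0"
    and inv: "invariant_pmf I r act \<pi>\<^sub>1" "invariant_pmf I r act \<pi>\<^sub>2"
    and x: "pmf \<pi>\<^sub>2 x < pmf \<pi>\<^sub>1 x" and e: "e \<in> I"
  shows "pmf \<pi>\<^sub>2 (act e x) < pmf \<pi>\<^sub>1 (act e x)"
proof -
  define A where "A = {x. pmf \<pi>\<^sub>2 x < pmf \<pi>\<^sub>1 x}"
  define d where "d = (\<lambda>x. pmf \<pi>\<^sub>1 x - pmf \<pi>\<^sub>2 x)"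
  define D where "D = (\<lambda>B. measure (measure_pmf \<pi>\<^sub>1) B - measure (measure_pmf \<pi>\<^sub>2) B)"
  have d_sum: "(d has_sum D B) B" for B
    unfolding d_def D_def by (intro has_sum_minus pmf_has_sum)
  \<comment> \<open>\<open>A\<close> contains exactly the points where the summand \<open>d\<close>
    is positive, so no set has a larger total.\<close>
  have D_le: "D B \<le> D A" for B
    by (rule has_sum_mono_neutral[OF d_sum d_sum]) (auto simp: A_def d_def)
  have bal: "D A * sum r I = (\<Sum>f\<in>I. r f * D (act f -` A))"
    using inv unfolding invariant_pmf_def D_def by (simp add: algebra_simps sum_subtractf)
  have eq: "D (act e -` A) = D A"
  proof (rule ccontr)
    assume "\<not> ?thesis"
    hence "D (act e -` A) < D A" using D_le[of "act e -` A"] by simp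
    hence "(\<Sum>f\<in>I. r f * D (act f -` A)) < (\<Sum>f\<in>I. r f * D A)"
      using e r D_le by (intro sum_strict_mono_ex1 fin) (auto intro!: mult_left_mono less_imp_le mult_strict_left_mono)
    thus False using bal by (simp add: sum_distrib_left mult.commute)
  qed
  show ?thesis
  proof (rule ccontr)
    assume "\<not> ?thesis"
    hence nin: "x \<notin> act e -` A" by (simp add: A_def)
    \<comment> \<open>Adding the missing point \<open>x\<close>, where \<open>d\<close> is positive,
      to a set of maximal total would exceed the maximum.\<close>
    have "(d has_sum (d x + D (act e -` A))) (insert x (act e -` A))"
      using has_sum_insert[OF nin d_sum] .
    hence "D (insert x (act e -` A)) = d x + D (act e -` A)"
      using d_sum has_sum_unique by blast
    moreover have "d x > 0" using x by (simp add: d_def)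
    ultimately show False using eq D_le[of "insert x (act e -` A)"] by simp
  qed
qed

text \<open>Two different distributions exceed each other somewhere, since both have mass 1. Each of
  the two excess sets is closed under all events, so both contain \<open>x\<^sub>0\<close>, which is
  absurd. One state reachable from everywhere thus replaces irreducibility.\<close>

lemma invariant_pmf_unique:
  assumes fin: "finite I" and r: "\<And>e. e \<in> I \<Longrightarrow> r e > 0"
    and inv: "invariant_pmf I r act \<pi>\<^sub>1" "invariant_pmf I r act \<pi>\<^sub>2"
    and sub: "set_pmf \<pi>\<^sub>1 \<subseteq> V" "set_pmf \<pi>\<^sub>2 \<subseteq> V"
    and reach: "\<And>A x. x \<in> A \<inter> V \<Longrightarrow> (\<And>e x. e \<in> I \<Longrightarrow> x \<in> A \<Longrightarrow> act e x \<in> A) \<Longrightarrow> x\<^sub>0 \<in> A"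
  shows "\<pi>\<^sub>1 = \<pi>\<^sub>2"
proof (rule ccontr)
  have *: "pmf \<pi>' x\<^sub>0 < pmf \<pi> x\<^sub>0"
    if "invariant_pmf I r act \<pi>" "invariant_pmf I r act \<pi>'" "pmf \<pi>' x < pmf \<pi> x" "set_pmf \<pi> \<subseteq> V" for \<pi> \<pi>' x
  proof -
    have "x \<in> set_pmf \<pi>" using that(3) pmf_nonneg[of \<pi>' x] by (auto simp: set_pmf_iff)
    thus ?thesis
      using reach[of x "{x. pmf \<pi>' x < pmf \<pi> x}"] that invariant_pmf_excess_closed[OF fin r that(1,2)] by auto
  qed
  assume "\<pi>\<^sub>1 \<noteq> \<pi>\<^sub>2"
  then obtain x where x: "pmf \<pi>\<^sub>1 x \<noteq> pmf \<pi>\<^sub>2 x" by (metis pmf_eqI)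
  have one: "(pmf \<pi> has_sum 1) UNIV" for \<pi> :: "'b pmf"
    using pmf_has_sum[of \<pi> UNIV] measure_pmf.prob_space[of \<pi>] by (metis space_measure_pmf)
  have **: False if le: "\<And>x. pmf \<pi> x \<le> pmf \<pi>' x" and lt: "pmf \<pi> y < pmf \<pi>' y" for \<pi> \<pi>' :: "'b pmf" and y
    using has_sum_strict_mono[OF one one le UNIV_I lt] by simp
  obtain y where "pmf \<pi>\<^sub>2 y < pmf \<pi>\<^sub>1 y" using **[of \<pi>\<^sub>1 \<pi>\<^sub>2 x] x by (meson not_le order_le_imp_less_or_eq)
  moreover obtain z where "pmf \<pi>\<^sub>1 z < pmf \<pi>\<^sub>2 z" using **[of \<pi>\<^sub>2 \<pi>\<^sub>1 x] x by (metis not_le order_le_imp_less_or_eq)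
  ultimately show False using *[OF inv _ sub(1)] *[OF inv(2,1) _ sub(2)] by (meson less_asym)
qed

text \<open>The balance equations omit the diagonal; adding \<open>pmf \<pi> x * q x x\<close> to
  both sides brings back the events that fix \<open>x\<close>. For \<open>x\<close> outside
  \<open>E\<close> both sides are zero, because \<open>\<pi>\<close> lives on \<open>E\<close> and
  events do not leave \<open>E\<close>.\<close>

lemma stationary_distribution_imp_invariant:
  fixes q :: "'s \<Rightarrow> 's \<Rightarrow> real"
  assumes st: "stationary_distribution E q \<pi>"
    and fin: "finite I"
    and q: "\<And>x y. q x y = (\<Sum>e | e \<in> I \<and> act e x = y. r e)"
    and cl: "\<And>e x. e \<in> I \<Longrightarrow> x \<in> E \<Longrightarrow> act e x \<in> E"
  shows "invariant_pmf I r act \<pi>"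
proof (rule invariant_pmf_pointwise)
  fix x
  let ?m = "measure (measure_pmf \<pi>)"
  have q': "q x y = (\<Sum>e\<in>I. if act e x = y then r e else 0)" for x y
    unfolding q by (rule sum.mono_neutral_cong_left) (use fin in auto)
  have sub: "set_pmf \<pi> \<subseteq> E" using st by (simp add: stationary_distribution_def)
  \<comment> \<open>Extension by zero, so that sums over the preimages under different events can be
    added as sums over the common set \<open>E\<close>.\<close>
  have point: "((\<lambda>y. if y \<in> B then g y else 0) has_sum c) E" if "(g has_sum c) (B \<inter> E)" for B c and g :: "'s \<Rightarrow> real"
    using that by (subst has_sum_cong_neutral[where T = "B \<inter> E" and g = g]) auto
  have vim: "((\<lambda>y. pmf \<pi> y * q y x) has_sum (\<Sum>e\<in>I. r e * ?m (act e -` {x}))) E"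
  proof -
    have "(pmf \<pi> has_sum ?m (act e -` {x})) (act e -` {x} \<inter> E)" for e
      using pmf_has_sum[of \<pi> "act e -` {x}"] sub
      by (subst has_sum_cong_neutral[where T = "act e -` {x}" and g = "pmf \<pi>"]) (auto simp: set_pmf_iff)
    from point[OF this]
    have "((\<lambda>y. \<Sum>e\<in>I. r e * (if y \<in> act e -` {x} then pmf \<pi> y else 0)) has_sum (\<Sum>e\<in>I. r e * ?m (act e -` {x}))) E"
      by (intro has_sum_finite_sum has_sum_cmult_right)
    moreover have "(\<Sum>e\<in>I. r e * (if y \<in> act e -` {x} then pmf \<pi> y else 0)) = pmf \<pi> y * q y x" for y
      unfolding q' sum_distrib_left by (intro sum.cong) auto
    ultimately show ?thesis by simp
  qed
  show "pmf \<pi> x * sum r I = (\<Sum>e\<in>I. r e * ?m (act e -` {x}))"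
  proof (cases "x \<in> E")
    case True
    have "((\<lambda>y. q x y) has_sum sum r I) E"
    proof -
      have "((\<lambda>y. if y \<in> {act e x} then r e else 0) has_sum r e) E" if "e \<in> I" for e
        by (rule point) (use True that cl in \<open>auto intro!: has_sum_finiteI\<close>)
      from has_sum_finite_sum[OF this] show ?thesis unfolding q' by (simp add: eq_commute)
    qed
    hence 1: "((\<lambda>y. q x y) has_sum (sum r I - q x x)) (E - {x})"
      using True by (intro has_sum_Diff) (auto intro: has_sum_finiteI)
    have 2: "((\<lambda>y. pmf \<pi> y * q y x) has_sum ((\<Sum>e\<in>I. r e * ?m (act e -` {x})) - pmf \<pi> x * q x x)) (E - {x})"
      using True vim by (intro has_sum_Diff) (auto intro: has_sum_finiteI)
    have "pmf \<pi> x * (sum r I - q x x) = (\<Sum>e\<in>I. r e * ?m (act e -` {x})) - pmf \<pi> x * q x x"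
      using st True infsumI[OF 1] infsumI[OF 2] by (auto simp: stationary_distribution_def)
    thus ?thesis by (simp add: algebra_simps)
  next
    case False
    have "?m (act e -` {x}) = 0" if "e \<in> I" for e
      using sub cl[OF that] False by (auto simp: measure_pmf_zero_iff)
    thus ?thesis using False sub by (auto simp: set_pmf_iff)
  qed
qed

section \<open>Product weights on lists\<close>

text \<open>Both products in the stationary laws have this shape: waiting jobs with \<open>a\<close>
  the arrival rates and \<open>m\<close> the service rate of a set of types, idle servers with
  \<open>a\<close> the service rates and \<open>m\<close> the rate of compatible arrivals. A prefix
  enters \<open>m\<close> only through its set of entries, which is the order independence.\<close>

definition prefix_weight :: "('b \<Rightarrow> real) \<Rightarrow> ('b set \<Rightarrow> real) \<Rightarrow> 'b list \<Rightarrow> real" where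
  "prefix_weight a m xs = (\<Prod>i<length xs. a (xs ! i) / m (set (take (Suc i) xs)))"

lemma prefix_weight_Nil [simp]: "prefix_weight a m [] = 1"
  by (simp add: prefix_weight_def)

lemma prefix_weight_snoc [simp]:
  "prefix_weight a m (xs @ [y]) = prefix_weight a m xs * (a y / m (insert y (set xs)))"
  by (simp add: prefix_weight_def nth_append)

lemma prefix_weight_pos:
  assumes "\<And>x. x \<in> set xs \<Longrightarrow> a x > 0" "\<And>U. U \<subseteq> set xs \<Longrightarrow> U \<noteq> {} \<Longrightarrow> m U > 0"
  shows "prefix_weight a m xs > 0"
  unfolding prefix_weight_def
proof (intro prod_pos ballI divide_pos_pos)
  fix i assume "i \<in> {..<length xs}"
  moreover from this have "set (take (Suc i) xs) \<noteq> {}" by auto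
  ultimately show "a (xs ! i) > 0" "m (set (take (Suc i) xs)) > 0"
    using assms by (auto simp: set_take_subset)
qed

text \<open>A tilt by the numbers of occurrences only changes the letter weights, so Laplace
  transforms are again sums of product weights.\<close>

lemma prefix_weight_exp:
  fixes \<theta> :: "'b::finite \<Rightarrow> real"
  shows "prefix_weight (\<lambda>x. a x * exp (\<theta> x)) m xs = prefix_weight a m xs * exp (\<Sum>x\<in>UNIV. \<theta> x * count_list xs x)"
proof (induction xs rule: rev_induct)
  case (snoc y xs)
  have "(\<Sum>x\<in>UNIV. \<theta> x * count_list (xs @ [y]) x) = (\<Sum>x\<in>UNIV. \<theta> x * count_list xs x + (if x = y then \<theta> x else 0))"
    by (intro sum.cong) (auto simp: algebra_simps)
  also have "\<dots> = (\<Sum>x\<in>UNIV. \<theta> x * count_list xs x) + \<theta> y"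
    by (simp add: sum.distrib)
  finally show ?case using snoc by (simp add: exp_add)
qed simp

section \<open>Insertion of an entry as the inverse of removing the first compatible one\<close>

definition insert_at :: "nat \<Rightarrow> 'b \<Rightarrow> 'b list \<Rightarrow> 'b list" where
  "insert_at i s xs = take i xs @ s # drop i xs"

lemma set_insert_at [simp]: "set (insert_at i s xs) = insert s (set xs)"
proof -
  have "set xs = set (take i xs) \<union> set (drop i xs)" by (metis append_take_drop_id set_append)
  thus ?thesis by (auto simp: insert_at_def)
qed

text \<open>This is the identity behind quasi-reversibility of order-independent queues.\<close>

lemma prefix_weight_insert_at:
  assumes m0: "m {} = 0" and pos: "\<And>U. U \<subseteq> insert s (set xs) \<Longrightarrow> U \<noteq> {} \<Longrightarrow> m U \<noteq> 0"
  shows "(\<Sum>i\<le>length xs. prefix_weight a m (insert_at i s xs) *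
            (m (insert s (set (take i xs))) - m (set (take i xs)))) = prefix_weight a m xs * a s"
  using pos
proof (induction xs rule: rev_induct)
  case Nil
  have "prefix_weight a m [s] = a s / m {s}" using prefix_weight_snoc[of a m "[]" s] by simp
  thus ?case using Nil m0 by (simp add: insert_at_def)
next
  case (snoc y xs)
  let ?X = "set xs"
  let ?d = "\<lambda>i xs. m (insert s (set (take i xs))) - m (set (take i xs))"
  have IH: "(\<Sum>i\<le>length xs. prefix_weight a m (insert_at i s xs) * ?d i xs) = prefix_weight a m xs * a s"
    by (rule snoc.IH) (use snoc.prems in auto)
  have nz: "m (insert y ?X) \<noteq> 0" "m (insert s (insert y ?X)) \<noteq> 0"
    using snoc.prems by auto
  \<comment> \<open>At these positions the new entry lies before \<open>y\<close>, so all terms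
    share the last factor and the induction hypothesis applies to their sum.\<close>
  have "insert_at i s (xs @ [y]) = insert_at i s xs @ [y]" if "i \<le> length xs" for i
    using that by (simp add: insert_at_def)
  hence "(\<Sum>i\<le>length xs. prefix_weight a m (insert_at i s (xs @ [y])) * ?d i (xs @ [y])) =
      (\<Sum>i\<le>length xs. prefix_weight a m (insert_at i s xs) * ?d i xs * (a y / m (insert s (insert y ?X))))"
    by (intro sum.cong) (auto simp: insert_commute)
  also have "\<dots> = prefix_weight a m xs * a s * (a y / m (insert s (insert y ?X)))"
    by (simp only: IH sum_distrib_right[symmetric])
  finally have 1: "(\<Sum>i\<le>length xs. prefix_weight a m (insert_at i s (xs @ [y])) * ?d i (xs @ [y])) = \<dots>" .
  \<comment> \<open>Only the position behind \<open>y\<close> is new. Added to the other terms, its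
    increment \<open>m (insert s (insert y ?X)) - m (insert y ?X)\<close> cancels the denominator
    \<open>m (insert s (insert y ?X))\<close> and leaves
    \<open>a y / m (insert y ?X)\<close>.\<close>
  have "insert_at (Suc (length xs)) s (xs @ [y]) = (xs @ [y]) @ [s]" by (simp add: insert_at_def)
  hence 2: "prefix_weight a m (insert_at (Suc (length xs)) s (xs @ [y])) =
      prefix_weight a m xs * (a y / m (insert y ?X)) * (a s / m (insert s (insert y ?X)))"
    by (metis prefix_weight_snoc set_append Un_insert_right list.simps(15) list.set(1) sup_bot.right_neutral)
  show ?case
    unfolding length_append_singleton sum.atMost_Suc 1 2 using nz
    by (simp add: field_simps insert_commute)
qed

text \<open>The deletion hits the first entry satisfying \<open>P\<close>, so undoing it puts
  \<open>s\<close> behind a prefix in which nothing satisfies \<open>P\<close>.\<close>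

lemma find_remove1_iff:
  "find P y = Some s \<and> remove1 s y = xs \<longleftrightarrow>
     (\<exists>i\<le>length xs. y = insert_at i s xs \<and> P s \<and> (\<forall>x\<in>set (take i xs). \<not> P x))"
proof
  assume "find P y = Some s \<and> remove1 s y = xs"
  hence f: "find P y = Some s" and r: "remove1 s y = xs" by auto
  from f obtain us vs where y: "y = us @ s # vs" "\<forall>x\<in>set us. \<not> P x" "P s"
  proof (induction y arbitrary: thesis)
    case (Cons z y)
    show ?case
    proof (cases "P z")
      case True
      thus ?thesis using Cons.prems(2) Cons.prems(1)[of "[]" y] by simp
    next
      case False
      hence "find P y = Some s" using Cons.prems(2) by simp
      then obtain us vs where "y = us @ s # vs" "\<forall>x\<in>set us. \<not> P x" "P s" using Cons.IH by blast
      thus ?thesis using Cons.prems(1)[of "z # us" vs] False by simp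
    qed
  qed simp
  \<comment> \<open>\<open>P\<close> holds for \<open>s\<close> and fails on \<open>us\<close>, so
    the copy that \<open>remove1\<close> deletes is the one that was found.\<close>
  hence "s \<notin> set us" by auto
  hence "xs = us @ vs" using r y by (simp add: remove1_append)
  thus "\<exists>i\<le>length xs. y = insert_at i s xs \<and> P s \<and> (\<forall>x\<in>set (take i xs). \<not> P x)"
    using y by (intro exI[of _ "length us"]) (auto simp: insert_at_def)
next
  assume "\<exists>i\<le>length xs. y = insert_at i s xs \<and> P s \<and> (\<forall>x\<in>set (take i xs). \<not> P x)"
  then obtain i where i: "i \<le> length xs" "y = insert_at i s xs" "P s" "\<forall>x\<in>set (take i xs). \<not> P x" by auto
  have "find P (us @ s # vs) = Some s" if "\<forall>x\<in>set us. \<not> P x" for us vs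
    using that i(3) by (induction us) auto
  moreover have "s \<notin> set (take i xs)" using i by auto
  ultimately show "find P y = Some s \<and> remove1 s y = xs"
    using i by (simp add: insert_at_def remove1_append)
qed

lemma finite_find_remove1: "finite {y. find P y = Some s \<and> remove1 s y = xs}"
proof (rule finite_subset)
  show "{y. find P y = Some s \<and> remove1 s y = xs} \<subseteq> (\<lambda>i. insert_at i s xs) ` {..length xs}"
    unfolding find_remove1_iff by blast
qed simp

lemma sum_find_remove1:
  fixes w :: "'b list \<Rightarrow> real"
  shows "(\<Sum>y | find P y = Some s \<and> remove1 s y = xs. w y) =
     (\<Sum>i\<le>length xs. if P s \<and> (\<forall>x\<in>set (take i xs). \<not> P x) then w (insert_at i s xs) else 0)"
proof -
  let ?J = "{i. i \<le> length xs \<and> P s \<and> (\<forall>x\<in>set (take i xs). \<not> P x)}"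
  \<comment> \<open>With repeated entries, different positions can produce the same list. On
    \<open>?J\<close> they cannot, because the position is the length of the longest initial segment
    avoiding \<open>P\<close>.\<close>
  have len: "length (takeWhile (\<lambda>x. \<not> P x) (insert_at i s xs)) = i" if "i \<in> ?J" for i
    using that by (simp add: insert_at_def takeWhile_append2)
  have "inj_on (\<lambda>i. insert_at i s xs) ?J"
    by (rule inj_on_inverseI[of _ "\<lambda>y. length (takeWhile (\<lambda>x. \<not> P x) y)"]) (rule len)
  moreover have "{y. find P y = Some s \<and> remove1 s y = xs} = (\<lambda>i. insert_at i s xs) ` ?J"
    by (auto simp: find_remove1_iff)
  ultimately have "(\<Sum>y | find P y = Some s \<and> remove1 s y = xs. w y) = (\<Sum>i\<in>?J. w (insert_at i s xs))"
    by (simp add: sum.reindex)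
  also have "\<dots> = (\<Sum>i\<le>length xs. if P s \<and> (\<forall>x\<in>set (take i xs). \<not> P x) then w (insert_at i s xs) else 0)"
    by (rule sum.mono_neutral_cong_left) auto
  finally show ?thesis .
qed

text \<open>Fixing the set of entries exactly, and not just bounding it by \<open>T\<close>, makes
  the denominator of the last factor the constant \<open>m T\<close>.\<close>

definition prefix_gf :: "('b \<Rightarrow> real) \<Rightarrow> ('b set \<Rightarrow> real) \<Rightarrow> 'b set \<Rightarrow> real" where
  "prefix_gf a m T = infsum (prefix_weight a m) {xs. set xs = T}"

text \<open>What remains after deleting the last entry \<open>S\<close> has entries \<open>T\<close>
  or \<open>T - {S}\<close>, according to whether \<open>S\<close> occurs earlier. \<open>Q\<close>
  is a length bound in the finite version of the recursion and trivial in the infinite one.\<close>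

lemma bij_betw_snoc:
  "bij_betw (\<lambda>(S, xs). xs @ [S]) (Sigma T (\<lambda>S. {xs. (set xs = T \<or> set xs = T - {S}) \<and> Q xs}))
     {xs. xs \<noteq> [] \<and> set xs = T \<and> Q (butlast xs)}"
proof (rule bij_betw_imageI)
  show "inj_on (\<lambda>(S, xs). xs @ [S]) (Sigma T (\<lambda>S. {xs. (set xs = T \<or> set xs = T - {S}) \<and> Q xs}))"
    by (auto simp: inj_on_def)
  show "(\<lambda>(S, xs). xs @ [S]) ` (Sigma T (\<lambda>S. {xs. (set xs = T \<or> set xs = T - {S}) \<and> Q xs})) =
     {xs. xs \<noteq> [] \<and> set xs = T \<and> Q (butlast xs)}" (is "?f ` ?A = ?B")
  proof (intro equalityI subsetI)
    fix xs assume xs: "xs \<in> ?B"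
    then obtain ys y where ys: "xs = ys @ [y]" by (cases xs rule: rev_cases) auto
    hence "T = insert y (set ys)" "Q ys" using xs by auto
    hence "(y, ys) \<in> ?A" by blast
    thus "xs \<in> ?f ` ?A" using ys by (intro image_eqI[of _ _ "(y, ys)"]) simp_all
  next
    fix xs assume "xs \<in> ?f ` ?A"
    then obtain z where "z \<in> ?A" "xs = ?f z" by (rule imageE)
    then obtain y ys where "xs = ys @ [y]" "y \<in> T" "set ys = T \<or> set ys = T - {y}" "Q ys"
      by (cases z) simp
    moreover from this have "insert y (set ys) = T" by blast
    ultimately show "xs \<in> ?B" by simp
  qed
qed

lemma prefix_gf_empty [simp]: "prefix_gf a m {} = 1"
proof -
  have "{xs :: 'a list. set xs = {}} = {[]}" by auto
  thus ?thesis unfolding prefix_gf_def by (simp only:) simp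
qed

text \<open>Splitting off the last entry gives the linear equation \<open>G = r * G + K\<close> for
  the sum \<open>G\<close> over lists with entries \<open>T\<close>, where \<open>r < 1\<close> is
  the load and \<open>K\<close> collects the lists whose last entry is new. The equation may be
  solved only once \<open>G\<close> is known to be finite, so the same split is first carried out
  for lists of bounded length.\<close>

lemma prefix_weight_summable_and_rec:
  assumes fin: "finite T" and a: "\<And>x. x \<in> T \<Longrightarrow> a x \<ge> 0"
    and m: "\<And>U. U \<subseteq> T \<Longrightarrow> U \<noteq> {} \<Longrightarrow> sum a U < m U"
  shows "prefix_weight a m summable_on {xs. set xs = T} \<and>
    (T \<noteq> {} \<longrightarrow> prefix_gf a m T = (\<Sum>S\<in>T. a S * prefix_gf a m (T - {S})) / (m T - sum a T))"
  using assms
proof (induction T rule: finite_psubset_induct)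
  case (psubset T)
  show ?case
  proof (cases "T = {}")
    case True
    thus ?thesis by simp
  next
    case False
    let ?w = "prefix_weight a m" and ?G = "prefix_gf a m"
    let ?A = "\<lambda>T. {xs. set xs = T}"
    have finT: "finite T" by (rule psubset.hyps)
    have mpos: "m U > 0" if "U \<subseteq> T" "U \<noteq> {}" for U
      using psubset.prems(2)[OF that] sum_nonneg[of U a] psubset.prems(1) that(1) by (meson in_mono le_less_trans)
    have wnn: "?w xs \<ge> 0" if "set xs \<subseteq> T" for xs
      unfolding prefix_weight_def
    proof (intro prod_nonneg ballI divide_nonneg_nonneg less_imp_le[OF mpos])
      fix i assume i: "i \<in> {..<length xs}"
      show "a (xs ! i) \<ge> 0" using psubset.prems(1) that i nth_mem by blast
      show "set (take (Suc i) xs) \<subseteq> T" using that set_take_subset by fast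
      show "set (take (Suc i) xs) \<noteq> {}" using i by auto
    qed
    have sub: "?w summable_on ?A (T - {S})" if "S \<in> T" for S
      using psubset.IH[of "T - {S}"] psubset.prems that by auto
    have Gnn: "?G U \<ge> 0" if "U \<subseteq> T" for U
      unfolding prefix_gf_def using that wnn by (intro infsum_nonneg) auto
    define r where "r = sum a T / m T"
    define K where "K = (\<Sum>S\<in>T. a S * ?G (T - {S})) / m T"
    have r: "0 \<le> r" "r < 1"
      using mpos[of T] False psubset.prems(1) psubset.prems(2)[of T] unfolding r_def
      by (auto intro!: divide_nonneg_nonneg sum_nonneg)
    have K: "K \<ge> 0"
      unfolding K_def using mpos[of T] False psubset.prems(1) Gnn
      by (intro divide_nonneg_nonneg sum_nonneg mult_nonneg_nonneg) auto
    \<comment> \<open>Applied twice: with \<open>c\<close> the bound on the partial sums, and with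
      \<open>c\<close> the full sum.\<close>
    have avg: "(\<Sum>S\<in>T. (c + ?G (T - {S})) * (a S / m T)) = r * c + K" for c
    proof -
      have "(\<Sum>S\<in>T. (c + ?G (T - {S})) * (a S / m T)) = (\<Sum>S\<in>T. a S * (c / m T) + a S * ?G (T - {S}) / m T)"
        by (intro sum.cong refl) (simp add: add_divide_distrib algebra_simps)
      also have "\<dots> = r * c + K"
        unfolding r_def K_def sum.distrib sum_divide_distrib[symmetric] sum_distrib_right[symmetric] by simp
      finally show ?thesis .
    qed
    have fin_len: "finite {xs. set xs = U \<and> length xs \<le> n}" if "U \<subseteq> T" for U n
      by (rule finite_subset[OF _ finite_lists_length_le[OF finT, of n]]) (use that in blast)
    have last: "?w (xs @ [S]) = ?w xs * (a S / m T)" if "S \<in> T" "set xs = T \<or> set xs = T - {S}" for S xs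
    proof -
      have "insert S (set xs) = T" using that by blast
      thus ?thesis by simp
    qed
    \<comment> \<open>\<open>K / (1 - r)\<close> is the fixed point of the map
      \<open>c \<mapsto> r * c + K\<close>, so raising the length by one preserves the
      bound.\<close>
    have bound: "sum ?w {xs. set xs = T \<and> length xs \<le> n} \<le> K / (1 - r)" for n
    proof (induction n)
      case 0
      have "\<not> (set xs = T \<and> length xs \<le> 0)" for xs using False by (cases xs) auto
      hence "sum ?w {xs. set xs = T \<and> length xs \<le> 0} = 0" by (intro sum.neutral) blast
      moreover have "0 \<le> K / (1 - r)" using K r by simp
      ultimately show ?case by linarith
    next
      case (Suc n)
      let ?B = "\<lambda>S. {xs. (set xs = T \<or> set xs = T - {S}) \<and> length xs \<le> n}"
      have bij: "bij_betw (\<lambda>(S, xs). xs @ [S]) (Sigma T ?B) {xs. set xs = T \<and> length xs \<le> Suc n}"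
      proof -
        have "{xs. xs \<noteq> [] \<and> set xs = T \<and> length (butlast xs) \<le> n} = {xs. set xs = T \<and> length xs \<le> Suc n}"
        proof (rule Collect_cong)
          fix xs show "(xs \<noteq> [] \<and> set xs = T \<and> length (butlast xs) \<le> n) = (set xs = T \<and> length xs \<le> Suc n)"
            using False by (cases xs rule: rev_cases) auto
        qed
        with bij_betw_snoc[of T "\<lambda>xs. length xs \<le> n"] show ?thesis by metis
      qed
      have "sum ?w {xs. set xs = T \<and> length xs \<le> Suc n} = (\<Sum>(S, xs)\<in>Sigma T ?B. ?w (xs @ [S]))"
        by (subst sum.reindex_bij_betw[OF bij, symmetric]) (auto intro: sum.cong)
      also have "\<dots> = (\<Sum>S\<in>T. \<Sum>xs\<in>?B S. ?w (xs @ [S]))"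
      proof (rule sum.Sigma[symmetric])
        show "\<forall>S\<in>T. finite (?B S)"
          by (intro ballI finite_subset[OF _ finite_lists_length_le[OF finT, of n]]) blast
      qed (rule finT)
      also have "\<dots> \<le> (\<Sum>S\<in>T. (K / (1 - r) + ?G (T - {S})) * (a S / m T))"
      proof (rule sum_mono)
        fix S assume S: "S \<in> T"
        have B: "?B S = {xs. set xs = T \<and> length xs \<le> n} \<union> {xs. set xs = T - {S} \<and> length xs \<le> n}" by auto
        have "(\<Sum>xs\<in>?B S. ?w (xs @ [S])) = sum ?w (?B S) * (a S / m T)"
          unfolding sum_distrib_right by (intro sum.cong last) (use S in auto)
        also have "sum ?w (?B S) = sum ?w {xs. set xs = T \<and> length xs \<le> n} + sum ?w {xs. set xs = T - {S} \<and> length xs \<le> n}"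
          unfolding B by (rule sum.union_disjoint) (use fin_len S in auto)
        finally have eq: "(\<Sum>xs\<in>?B S. ?w (xs @ [S])) =
            (sum ?w {xs. set xs = T \<and> length xs \<le> n} + sum ?w {xs. set xs = T - {S} \<and> length xs \<le> n}) * (a S / m T)" .
        have "sum ?w {xs. set xs = T - {S} \<and> length xs \<le> n} \<le> ?G (T - {S})"
          unfolding prefix_gf_def by (rule finite_sum_le_infsum) (use sub[OF S] fin_len wnn in auto)
        moreover have "0 \<le> a S / m T"
          using psubset.prems(1)[OF S] mpos[of T] False by simp
        ultimately show "(\<Sum>xs\<in>?B S. ?w (xs @ [S])) \<le> (K / (1 - r) + ?G (T - {S})) * (a S / m T)"
          unfolding eq using Suc by (intro mult_right_mono add_mono)
      qed
      also have "\<dots> = r * (K / (1 - r)) + K" by (rule avg)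
      also have "\<dots> = K / (1 - r)" using r by (simp add: field_simps)
      finally show ?case .
    qed
    have sumT: "?w summable_on ?A T"
    proof (rule nonneg_bdd_above_summable_on)
      show "bdd_above (sum ?w ` {F. F \<subseteq> ?A T \<and> finite F})"
      proof (rule bdd_aboveI2[where M = "K / (1 - r)"])
        fix F assume F: "F \<in> {F. F \<subseteq> ?A T \<and> finite F}"
        define n where "n = Max (insert 0 (length ` F))"
        have "sum ?w F \<le> sum ?w {xs. set xs = T \<and> length xs \<le> n}"
          by (rule sum_mono2) (use F fin_len wnn in \<open>auto simp: n_def\<close>)
        thus "sum ?w F \<le> K / (1 - r)" using bound[of n] by simp
      qed
    qed (use wnn in auto)
    have "?G T = r * ?G T + K"
    proof -
      have hs: "(?w has_sum ?G U) (?A U)" if "U = T \<or> (\<exists>S\<in>T. U = T - {S})" for U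
        unfolding prefix_gf_def using that sumT sub by (intro has_sum_infsum) auto
      let ?B = "\<lambda>S. {xs. set xs = T \<or> set xs = T - {S}}"
      have inner: "((\<lambda>xs. ?w (xs @ [S])) has_sum ((?G T + ?G (T - {S})) * (a S / m T))) (?B S)" if S: "S \<in> T" for S
      proof -
        have "(?w has_sum (?G T + ?G (T - {S}))) (?A T \<union> ?A (T - {S}))"
          by (rule has_sum_Un_disjoint) (use hs S in auto)
        also have "?A T \<union> ?A (T - {S}) = ?B S" by auto
        finally have *: "((\<lambda>xs. ?w xs * (a S / m T)) has_sum ((?G T + ?G (T - {S})) * (a S / m T))) (?B S)"
          by (rule has_sum_cmult_left)
        have "((\<lambda>xs. ?w (xs @ [S])) has_sum c) (?B S) = ((\<lambda>xs. ?w xs * (a S / m T)) has_sum c) (?B S)" for c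
          by (rule has_sum_cong) (rule last[OF S], blast)
        thus ?thesis using * by (rule iffD2)
      qed
      have "((\<lambda>(S, xs). ?w (xs @ [S])) has_sum ?G T) (Sigma T ?B)"
      proof -
        have "{xs. xs \<noteq> [] \<and> set xs = T} = ?A T" using False by (intro Collect_cong) force
        thus ?thesis
          using has_sum_reindex_bij_betw[OF bij_betw_snoc[of T "\<lambda>_. True"], of ?w "?G T"] hs[of T]
          by (simp add: case_prod_unfold)
      qed
      hence "((\<lambda>S. (?G T + ?G (T - {S})) * (a S / m T)) has_sum ?G T) T"
        by (rule has_sum_SigmaD) (use inner in simp)
      hence "?G T = (\<Sum>S\<in>T. (?G T + ?G (T - {S})) * (a S / m T))"
        using finT by (simp add: has_sum_finite_iff)
      also have "\<dots> = r * ?G T + K" by (rule avg)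
      finally show ?thesis .
    qed
    hence "?G T * (m T - sum a T) = (\<Sum>S\<in>T. a S * ?G (T - {S}))"
      using mpos[of T] False by (simp add: r_def K_def field_simps)
    thus ?thesis
      using sumT psubset.prems(2)[of T] False by (simp add: field_simps)
  qed
qed

section \<open>Product form for cancel-on-completion\<close>

text \<open>Because each event has finitely many preimages of a state, invariance becomes an
  identity between finite sums of unnormalized weights.\<close>

lemma invariant_pmf_of_weight:
  fixes \<nu> :: "'s pmf"
  assumes \<nu>: "\<And>x. pmf \<nu> x = (if x \<in> V then w x / Z else 0)"
    and closed: "\<And>e x. e \<in> I \<Longrightarrow> x \<in> V \<Longrightarrow> act e x \<in> V"
    and fin: "\<And>e x. e \<in> I \<Longrightarrow> x \<in> V \<Longrightarrow> finite {y \<in> V. act e y = x}"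
    and bal: "\<And>x. x \<in> V \<Longrightarrow> w x * sum r I = (\<Sum>e\<in>I. r e * (\<Sum>y | y \<in> V \<and> act e y = x. w y))"
  shows "invariant_pmf I r act \<nu>"
proof (rule invariant_pmf_pointwise)
  fix x
  have sub: "set_pmf \<nu> \<subseteq> V" by (auto simp: set_pmf_iff \<nu> split: if_splits)
  have meas: "measure (measure_pmf \<nu>) (act e -` {x}) = (\<Sum>y | y \<in> V \<and> act e y = x. w y) / Z"
    if e: "e \<in> I" and x: "x \<in> V" for e
  proof -
    have "measure (measure_pmf \<nu>) (act e -` {x}) = measure (measure_pmf \<nu>) {y \<in> V. act e y = x}"
      by (rule measure_pmf.finite_measure_eq_AE) (use sub in \<open>auto simp: AE_measure_pmf_iff\<close>)
    also have "\<dots> = (\<Sum>y | y \<in> V \<and> act e y = x. w y / Z)"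
      using fin[OF e x] by (subst measure_measure_pmf_finite) (auto simp: \<nu> intro!: sum.cong)
    finally show ?thesis by (simp add: sum_divide_distrib)
  qed
  show "pmf \<nu> x * sum r I = (\<Sum>e\<in>I. r e * measure (measure_pmf \<nu>) (act e -` {x}))"
  proof (cases "x \<in> V")
    case True
    have "(\<Sum>e\<in>I. r e * measure (measure_pmf \<nu>) (act e -` {x})) =
        (\<Sum>e\<in>I. r e * (\<Sum>y | y \<in> V \<and> act e y = x. w y)) / Z"
      unfolding sum_divide_distrib by (intro sum.cong refl) (use True meas in simp)
    thus ?thesis using bal[OF True] True by (simp add: \<nu>)
  next
    case False
    have "measure (measure_pmf \<nu>) (act e -` {x}) = 0" if "e \<in> I" for e
      using sub closed[OF that] False by (auto simp: measure_pmf_zero_iff)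
    thus ?thesis using False by (simp add: \<nu>)
  qed
qed

lemma expectation_of_weight:
  fixes \<nu> :: "'s pmf" and f :: "'s \<Rightarrow> real"
  assumes \<nu>: "\<And>x. pmf \<nu> x = (if x \<in> V then w x / Z else 0)"
    and f: "((\<lambda>x. w x * f x) has_sum Y) V" "\<And>x. x \<in> V \<Longrightarrow> \<bar>f x\<bar> \<le> B"
  shows "measure_pmf.expectation \<nu> f = Y / Z"
proof -
  have "((\<lambda>x. w x * f x / Z) has_sum (Y / Z)) V"
    by (intro has_sum_divide_const f(1))
  hence "((\<lambda>x. pmf \<nu> x * f x) has_sum (Y / Z)) UNIV"
    by (subst has_sum_cong_neutral[where T = V and g = "\<lambda>x. w x * f x / Z"]) (auto simp: \<nu>)
  moreover have "measure_pmf.expectation \<nu> f = infsum (\<lambda>x. pmf \<nu> x * f x) UNIV"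
    by (rule expectation_eq_infsum[of _ _ B]) (use f(2) in \<open>auto simp: set_pmf_iff \<nu> split: if_splits\<close>)
  ultimately show ?thesis by (simp add: infsumI)
qed

text \<open>Only the letter that ends \<open>zs\<close> contributes, and cancelling the last factor
  of its weight leaves \<open>m (set zs)\<close>. For the empty list both sides vanish by
  \<open>m {} = 0\<close>. In queueing terms, appending into a state balances the total rate of
  removals out of it.\<close>

lemma snoc_balance:
  assumes Y: "finite Y" "set zs \<subseteq> Y" and m: "m {} = 0" "zs \<noteq> [] \<Longrightarrow> m (set zs) \<noteq> 0"
  shows "(\<Sum>y\<in>Y. b y * (\<Sum>xs | xs @ [y] = zs. prefix_weight b m xs)) = prefix_weight b m zs * m (set zs)"
proof (cases zs rule: rev_cases)
  case Nil
  thus ?thesis using m by simp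
next
  case (snoc xs x)
  have "(\<Sum>y\<in>Y. b y * (\<Sum>ys | ys @ [y] = zs. prefix_weight b m ys)) =
      (\<Sum>y\<in>Y. if y = x then b x * prefix_weight b m xs else 0)"
  proof (intro sum.cong refl)
    fix y
    have "{ys. ys @ [y] = zs} = (if y = x then {xs} else {})" using snoc by auto
    thus "b y * (\<Sum>ys | ys @ [y] = zs. prefix_weight b m ys) = (if y = x then b x * prefix_weight b m xs else 0)"
      by simp
  qed
  also have "\<dots> = b x * prefix_weight b m xs" using Y snoc by simp
  also have "\<dots> = prefix_weight b m zs * m (set zs)" using m snoc by simp
  finally show ?thesis .
qed

text \<open>The counterpart for removals; \<open>R e x\<close> means that event \<open>e\<close> can
  take entry \<open>x\<close>. An entry \<open>s\<close> behind the prefix \<open>U\<close> is taken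
  by the events that can take \<open>s\<close> but nothing in \<open>U\<close>, and hypothesis
  \<open>m\<close> says that their total rate is an increment of \<open>m\<close>. For waiting jobs
  the events are servers, for idle servers they are arrivals.\<close>

lemma insertion_balance:
  fixes b :: "'b \<Rightarrow> real" and r :: "'e \<Rightarrow> real"
  assumes E: "finite E"
    and m0: "m {} = 0" and pos: "\<And>U. U \<subseteq> insert s (set xs) \<Longrightarrow> U \<noteq> {} \<Longrightarrow> m U \<noteq> 0"
    and m: "\<And>U. U \<subseteq> set xs \<Longrightarrow> m (insert s U) - m U = (\<Sum>e | e \<in> E \<and> R e s \<and> (\<forall>x\<in>U. \<not> R e x). r e)"
  shows "(\<Sum>e\<in>E. r e * (\<Sum>ys | find (R e) ys = Some s \<and> remove1 s ys = xs. prefix_weight b m ys)) =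
      prefix_weight b m xs * b s"
proof -
  let ?c = "\<lambda>e i. R e s \<and> (\<forall>x\<in>set (take i xs). \<not> R e x)"
  let ?W = "\<lambda>i. prefix_weight b m (insert_at i s xs)"
  have "(\<Sum>e\<in>E. r e * (\<Sum>ys | find (R e) ys = Some s \<and> remove1 s ys = xs. prefix_weight b m ys)) =
      (\<Sum>e\<in>E. \<Sum>i\<le>length xs. ?W i * (if ?c e i then r e else 0))"
    unfolding sum_find_remove1 sum_distrib_left by (intro sum.cong refl) simp
  \<comment> \<open>Exchanging the sums collects, for each position, the rates of all events that
    would remove the entry there.\<close>
  also have "\<dots> = (\<Sum>i\<le>length xs. ?W i * (\<Sum>e\<in>E. if ?c e i then r e else 0))"
    unfolding sum_distrib_left by (rule sum.swap)
  also have "\<dots> = (\<Sum>i\<le>length xs. ?W i * (m (insert s (set (take i xs))) - m (set (take i xs))))"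
  proof (intro sum.cong refl arg_cong2[where f = "(*)"])
    fix i
    have "(\<Sum>e\<in>E. if ?c e i then r e else 0) = (\<Sum>e | e \<in> E \<and> ?c e i. r e)"
      by (rule sum.mono_neutral_cong_right) (use E in auto)
    thus "(\<Sum>e\<in>E. if ?c e i then r e else 0) = m (insert s (set (take i xs))) - m (set (take i xs))"
      using m[of "set (take i xs)"] set_take_subset[of i xs] by simp
  qed
  also have "\<dots> = prefix_weight b m xs * b s"
    by (rule prefix_weight_insert_at[where m = m and s = s and xs = xs, OF m0 pos])
  finally show ?thesis .
qed

lemma sum_find_remove1_Union:
  fixes w :: "'b list \<Rightarrow> real"
  assumes "finite A"
  shows "(\<Sum>y\<in>(\<Union>s\<in>A. {y. find P y = Some s \<and> remove1 s y = xs}). w y) =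
    (\<Sum>s\<in>A. \<Sum>y | find P y = Some s \<and> remove1 s y = xs. w y)"
  using assms by (intro sum.UNION_disjoint) (auto simp: finite_find_remove1)

lemma mu_of_positive:
  fixes \<mu> :: "'n::finite \<Rightarrow> real"
  assumes \<mu>: "\<And>n. \<mu> n > 0" and T: "{} \<notin> T" "T \<noteq> {}"
  shows "mu_of \<mu> T > 0"
proof -
  obtain S where "S \<in> T" using T by blast
  moreover from this have "S \<noteq> {}" using T by blast
  ultimately have "\<Union>T \<noteq> {}" by blast
  thus ?thesis unfolding mu_of_def by (intro sum_pos \<mu>) auto
qed

locale replication_system =
  fixes \<mu> :: "'n::finite \<Rightarrow> real" and \<S> :: "'n set set" and p :: "'n set \<Rightarrow> real" and l :: real
  assumes mu_pos: "\<And>n. \<mu> n > 0" and empty_notin: "{} \<notin> \<S>" and cover: "\<Union>\<S> = UNIV"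
    and p_pos: "\<And>S. S \<in> \<S> \<Longrightarrow> p S > 0" and l_pos: "l > 0"
    and stable: "\<And>T. T \<subseteq> \<S> \<Longrightarrow> T \<noteq> {} \<Longrightarrow> real CARD('n) * l * p_of p T < mu_of \<mu> T"
begin

section \<open>Generating functions at a fixed stable arrival rate\<close>

definition arr :: "'n set \<Rightarrow> real" where "arr S = real CARD('n) * l * p S"

definition type_gf :: "('n set \<Rightarrow> real) \<Rightarrow> 'n set set \<Rightarrow> real" where
  "type_gf \<theta> T = prefix_gf (\<lambda>S. arr S * exp (- \<theta> S)) (mu_of \<mu>) T"

definition events :: "('n set + 'n) set" where "events = \<S> <+> UNIV"

definition rate :: "'n set + 'n \<Rightarrow> real" where "rate = case_sum arr \<mu>"

lemma arr_pos: "S \<in> \<S> \<Longrightarrow> arr S > 0"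
  using p_pos l_pos by (simp add: arr_def)

lemma mu_of_pos: "T \<subseteq> \<S> \<Longrightarrow> T \<noteq> {} \<Longrightarrow> mu_of \<mu> T > 0"
  by (rule mu_of_positive[OF mu_pos]) (use empty_notin in auto)

lemma mu_of_empty [simp]: "mu_of \<mu> {} = 0" by (simp add: mu_of_def)

lemma sum_events: "(\<Sum>e\<in>events. f e) = (\<Sum>S\<in>\<S>. f (Inl S)) + (\<Sum>n\<in>UNIV. f (Inr n))"
  for f :: "_ \<Rightarrow> real"
  unfolding events_def by (subst sum.Plus) auto

lemma rate_pos: "e \<in> events \<Longrightarrow> rate e > 0"
  by (auto simp: events_def rate_def arr_pos mu_pos)

lemma event_rate_eq:
  "event_rate a d \<S> \<mu> p l x y = (\<Sum>e | e \<in> events \<and> case_sum a d e x = y. rate e)"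
proof -
  have "{e. e \<in> events \<and> case_sum a d e x = y} = {S. S \<in> \<S> \<and> a S x = y} <+> {n. d n x = y}"
    by (auto simp: events_def)
  thus ?thesis by (simp add: event_rate_def sum.Plus rate_def arr_def)
qed

text \<open>A nonnegative \<theta> only lowers the arrival weights, so stability keeps every
  denominator of the recursion positive.\<close>

lemma type_gf_has_sum:
  fixes \<theta> :: "'n set \<Rightarrow> real"
  assumes "\<And>S. \<theta> S \<ge> 0" "T \<subseteq> \<S>"
  shows "((\<lambda>c. prefix_weight arr (mu_of \<mu>) c * exp (- (\<Sum>S\<in>UNIV. \<theta> S * count_list c S))) has_sum type_gf \<theta> T) {c. set c = T}"
    and "T \<noteq> {} \<Longrightarrow> type_gf \<theta> T = (\<Sum>S\<in>T. arr S * exp (- \<theta> S) * type_gf \<theta> (T - {S})) / (mu_of \<mu> T - (\<Sum>S\<in>T. arr S * exp (- \<theta> S)))"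
proof -
  let ?a = "\<lambda>S. arr S * exp (- \<theta> S)"
  have "sum ?a U < mu_of \<mu> U" if "U \<subseteq> T" "U \<noteq> {}" for U
  proof -
    have "sum ?a U \<le> sum arr U"
    proof (rule sum_mono)
      fix S assume "S \<in> U"
      hence "arr S \<ge> 0" using arr_pos[of S] that assms by (auto intro: less_imp_le)
      thus "?a S \<le> arr S" using assms(1)[of S] by (intro mult_left_le) auto
    qed
    also have "\<dots> < mu_of \<mu> U"
      using stable[of U] that assms by (simp add: arr_def p_of_def sum_distrib_left)
    finally show ?thesis .
  qed
  moreover have "?a S \<ge> 0" if "S \<in> T" for S using arr_pos[of S] that assms by (auto intro: less_imp_le)
  ultimately have *: "prefix_weight ?a (mu_of \<mu>) summable_on {c. set c = T} \<and>
    (T \<noteq> {} \<longrightarrow> type_gf \<theta> T = (\<Sum>S\<in>T. ?a S * type_gf \<theta> (T - {S})) / (mu_of \<mu> T - sum ?a T))"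
    unfolding type_gf_def by (intro prefix_weight_summable_and_rec) auto
  have "prefix_weight arr (mu_of \<mu>) c * exp (- (\<Sum>S\<in>UNIV. \<theta> S * count_list c S)) = prefix_weight ?a (mu_of \<mu>) c" for c
    using prefix_weight_exp[of arr "\<lambda>S. - \<theta> S" "mu_of \<mu>" c] by (simp add: sum_negf)
  moreover have "(prefix_weight ?a (mu_of \<mu>) has_sum type_gf \<theta> T) {c. set c = T}"
    using * by (simp add: type_gf_def prefix_gf_def)
  ultimately show "((\<lambda>c. prefix_weight arr (mu_of \<mu>) c * exp (- (\<Sum>S\<in>UNIV. \<theta> S * count_list c S))) has_sum type_gf \<theta> T) {c. set c = T}"
    by simp
  show "T \<noteq> {} \<Longrightarrow> type_gf \<theta> T = (\<Sum>S\<in>T. ?a S * type_gf \<theta> (T - {S})) / (mu_of \<mu> T - sum ?a T)"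
    using * by blast
qed

lemma prefix_weight_arr_pos: "c \<in> lists \<S> \<Longrightarrow> prefix_weight arr (mu_of \<mu>) c > 0"
  by (intro prefix_weight_pos arr_pos mu_of_pos) (auto simp: in_lists_conv_set)

lemma type_gf_nonneg:
  fixes \<theta> :: "'n set \<Rightarrow> real"
  assumes "\<And>S. \<theta> S \<ge> 0" "T \<subseteq> \<S>"
  shows "type_gf \<theta> T \<ge> 0"
  by (rule has_sum_nonneg[OF type_gf_has_sum(1)[OF assms]])
    (use assms(2) in \<open>auto intro!: mult_nonneg_nonneg less_imp_le[OF prefix_weight_arr_pos]\<close>)

lemma type_gf_empty [simp]: "type_gf \<theta> {} = 1"
  by (simp add: type_gf_def)

text \<open>Partition of the lists by their set of entries. Proper subsets \<open>\<U>\<close> arise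
  because idle servers restrict the types that may wait.\<close>

lemma type_gf_lists_has_sum:
  fixes \<theta> :: "'n set \<Rightarrow> real"
  assumes "\<And>S. \<theta> S \<ge> 0" "\<U> \<subseteq> \<S>"
  shows "((\<lambda>c. prefix_weight arr (mu_of \<mu>) c * exp (- (\<Sum>S\<in>UNIV. \<theta> S * count_list c S))) has_sum (\<Sum>T\<in>Pow \<U>. type_gf \<theta> T)) (lists \<U>)"
proof -
  have "lists \<U> = (\<Union>T\<in>Pow \<U>. {c. set c = T})" by (auto simp: in_lists_conv_set)
  moreover have "((\<lambda>c. prefix_weight arr (mu_of \<mu>) c * exp (- (\<Sum>S\<in>UNIV. \<theta> S * count_list c S))) has_sum (\<Sum>T\<in>Pow \<U>. type_gf \<theta> T)) (\<Union>T\<in>Pow \<U>. {c. set c = T})"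
    by (rule sum_has_sum) (use assms type_gf_has_sum(1) in auto)
  ultimately show ?thesis by simp
qed

text \<open>Adding \<open>S\<close> to \<open>U\<close> raises \<open>mu_of \<mu>\<close> by the
  speeds of the servers in \<open>S\<close> outside \<open>\<Union>U\<close>, which are exactly the
  servers that would pass over the jobs in \<open>U\<close> and take \<open>S\<close>.\<close>

lemma completion_balance:
  assumes "c \<in> lists \<S>" "S \<in> \<S>"
  shows "(\<Sum>n\<in>UNIV. \<mu> n * (\<Sum>y | find (\<lambda>S. n \<in> S) y = Some S \<and> remove1 S y = c. prefix_weight arr (mu_of \<mu>) y)) =
     prefix_weight arr (mu_of \<mu>) c * arr S"
proof (rule insertion_balance[where R = "\<lambda>n S. n \<in> S"])
  show "mu_of \<mu> U \<noteq> 0" if "U \<subseteq> insert S (set c)" "U \<noteq> {}" for U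
  proof -
    have "U \<subseteq> \<S>" using that(1) assms unfolding lists_eq_set by blast
    thus ?thesis using mu_of_pos[of U] that(2) by simp
  qed
  show "mu_of \<mu> (insert S U) - mu_of \<mu> U = (\<Sum>n | n \<in> UNIV \<and> n \<in> S \<and> (\<forall>x\<in>U. n \<notin> x). \<mu> n)" for U
  proof -
    have "\<Union>(insert S U) = {n. n \<in> S \<and> (\<forall>x\<in>U. n \<notin> x)} \<union> \<Union>U" by auto
    moreover have "sum \<mu> ({n. n \<in> S \<and> (\<forall>x\<in>U. n \<notin> x)} \<union> \<Union>U) = sum \<mu> {n. n \<in> S \<and> (\<forall>x\<in>U. n \<notin> x)} + sum \<mu> (\<Union>U)"
      by (rule sum.union_disjoint) auto
    ultimately show ?thesis by (simp add: mu_of_def)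
  qed
qed simp_all

text \<open>\<open>c\<close> is its own predecessor exactly when server \<open>n\<close> has no
  compatible job in it; every other predecessor has one more job.\<close>

lemma coc_complete_vimage:
  assumes "c \<in> lists \<S>"
  shows "{y. y \<in> lists \<S> \<and> coc_complete n y = c} =
     (if n \<in> \<Union>(set c) then {} else {c}) \<union> (\<Union>S\<in>\<S>. {y. find (\<lambda>S. n \<in> S) y = Some S \<and> remove1 S y = c})"
    (is "?L = ?R")
proof (intro equalityI subsetI)
  fix y assume y: "y \<in> ?L"
  show "y \<in> ?R"
  proof (cases "find (\<lambda>S. n \<in> S) y")
    case None
    have "c = y" using y None by (simp add: coc_complete_def)
    moreover have "n \<notin> \<Union>(set y)" using None unfolding find_None_iff by blast
    ultimately show ?thesis by auto
  next
    case (Some S)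
    hence "S \<in> \<S>" using y by (auto simp: find_Some_iff in_lists_conv_set)
    thus ?thesis using y Some by (auto simp: coc_complete_def)
  qed
next
  fix y assume "y \<in> ?R"
  then consider "n \<notin> \<Union>(set c)" "y = c"
    | S where "S \<in> \<S>" "find (\<lambda>S. n \<in> S) y = Some S \<and> remove1 S y = c" by (auto split: if_splits)
  thus "y \<in> ?L"
  proof cases
    case 1
    hence "find (\<lambda>S. n \<in> S) c = None" by (auto simp: find_None_iff)
    thus ?thesis using 1 assms by (simp add: coc_complete_def)
  next
    case 2
    then obtain i where "y = insert_at i S c" unfolding find_remove1_iff by blast
    thus ?thesis using 2 assms by (simp add: coc_complete_def in_lists_conv_set)
  qed
qed

text \<open>Two local balances are added: arrivals into \<open>c\<close> match completions out of
  it, and completions into \<open>c\<close> match arrivals out of it. Servers without a compatible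
  job contribute equal self-loops to both sides.\<close>

lemma coc_balance:
  assumes c: "c \<in> lists \<S>"
  shows "prefix_weight arr (mu_of \<mu>) c * sum rate events =
    (\<Sum>e\<in>events. rate e * (\<Sum>y | y \<in> lists \<S> \<and> case_sum coc_arrive coc_complete e y = c. prefix_weight arr (mu_of \<mu>) y))"
proof -
  let ?w = "prefix_weight arr (mu_of \<mu>)"
  let ?F = "\<lambda>n S. {y. find (\<lambda>S. n \<in> S) y = Some S \<and> remove1 S y = c}"
  have "(\<Sum>S\<in>\<S>. arr S * (\<Sum>y | y \<in> lists \<S> \<and> coc_arrive S y = c. ?w y)) = (\<Sum>S\<in>\<S>. arr S * (\<Sum>y | y @ [S] = c. ?w y))"
    using c by (intro sum.cong refl arg_cong2[where f = "(*)"]) (auto simp: coc_arrive_def)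
  also have "\<dots> = ?w c * mu_of \<mu> (set c)"
  proof (rule snoc_balance)
    show "set c \<subseteq> \<S>" using c by (simp add: lists_eq_set)
    thus "c \<noteq> [] \<Longrightarrow> mu_of \<mu> (set c) \<noteq> 0" using mu_of_pos[of "set c"] by simp
  qed simp_all
  finally have 1: "(\<Sum>S\<in>\<S>. arr S * (\<Sum>y | y \<in> lists \<S> \<and> coc_arrive S y = c. ?w y)) = ?w c * mu_of \<mu> (set c)" .
  have "(\<Sum>n\<in>UNIV. \<mu> n * (\<Sum>y | y \<in> lists \<S> \<and> coc_complete n y = c. ?w y)) =
      (\<Sum>n\<in>UNIV. (if n \<in> \<Union>(set c) then 0 else ?w c * \<mu> n) + (\<Sum>S\<in>\<S>. \<mu> n * sum ?w (?F n S)))"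
  proof (intro sum.cong refl)
    fix n
    have "(\<Sum>y | y \<in> lists \<S> \<and> coc_complete n y = c. ?w y) =
        sum ?w (if n \<in> \<Union>(set c) then {} else {c}) + sum ?w (\<Union>S\<in>\<S>. ?F n S)"
      unfolding coc_complete_vimage[OF c]
    proof (rule sum.union_disjoint)
      show "(if n \<in> \<Union>(set c) then {} else {c}) \<inter> (\<Union>S\<in>\<S>. ?F n S) = {}"
        by (auto simp: find_Some_iff)
    qed (simp_all add: finite_find_remove1)
    thus "\<mu> n * (\<Sum>y | y \<in> lists \<S> \<and> coc_complete n y = c. ?w y) =
        (if n \<in> \<Union>(set c) then 0 else ?w c * \<mu> n) + (\<Sum>S\<in>\<S>. \<mu> n * sum ?w (?F n S))"
      by (simp add: sum_find_remove1_Union sum_distrib_left distrib_left)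
  qed
  also have "\<dots> = ?w c * (\<Sum>n\<in>- \<Union>(set c). \<mu> n) + (\<Sum>S\<in>\<S>. \<Sum>n\<in>UNIV. \<mu> n * sum ?w (?F n S))"
  proof -
    have "(\<Sum>n\<in>UNIV. if n \<in> \<Union>(set c) then 0 else ?w c * \<mu> n) = (\<Sum>n\<in>- \<Union>(set c). ?w c * \<mu> n)"
      by (rule sum.mono_neutral_cong_right) auto
    thus ?thesis unfolding sum.distrib sum_distrib_left by (simp add: sum.swap[of _ UNIV])
  qed
  also have "\<dots> = ?w c * (\<Sum>n\<in>- \<Union>(set c). \<mu> n) + ?w c * sum arr \<S>"
    using completion_balance[OF c] by (simp add: sum_distrib_left)
  finally have 2: "(\<Sum>n\<in>UNIV. \<mu> n * (\<Sum>y | y \<in> lists \<S> \<and> coc_complete n y = c. ?w y)) = \<dots>" .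
  have "sum \<mu> (- \<Union>(set c)) + sum \<mu> (\<Union>(set c)) = sum \<mu> (- \<Union>(set c) \<union> \<Union>(set c))"
    by (rule sum.union_disjoint[symmetric]) auto
  hence "sum \<mu> UNIV = sum \<mu> (- \<Union>(set c)) + mu_of \<mu> (set c)"
    by (simp add: mu_of_def)
  thus ?thesis using 1 2
    by (simp add: sum_events rate_def algebra_simps)
qed

lemma coc_closed: "e \<in> events \<Longrightarrow> c \<in> lists \<S> \<Longrightarrow> case_sum coc_arrive coc_complete e c \<in> lists \<S>"
proof (cases e)
  case (Inr n)
  assume c: "c \<in> lists \<S>"
  show ?thesis
  proof (cases "find (\<lambda>S. n \<in> S) c")
    case (Some S)
    thus ?thesis using Inr c set_remove1_subset[of S c] by (simp add: coc_complete_def lists_eq_set)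
  qed (use Inr c in \<open>simp add: coc_complete_def\<close>)
qed (auto simp: events_def coc_arrive_def)

lemma coc_finite_vimage:
  assumes "e \<in> events" "c \<in> lists \<S>"
  shows "finite {y \<in> lists \<S>. case_sum coc_arrive coc_complete e y = c}"
proof (cases e)
  case (Inl S)
  have "{y \<in> lists \<S>. coc_arrive S y = c} \<subseteq> {butlast c}" by (auto simp: coc_arrive_def)
  hence "finite {y \<in> lists \<S>. coc_arrive S y = c}" by (rule finite_subset) simp
  thus ?thesis using Inl by simp
next
  case (Inr n)
  have "finite {y. y \<in> lists \<S> \<and> coc_complete n y = c}"
    unfolding coc_complete_vimage[OF assms(2)] by (simp add: finite_find_remove1)
  thus ?thesis using Inr by simp
qed

text \<open>The oldest job is served by every server compatible with it, and there is such a server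
  because types are non-empty; so jobs can be removed from the head one at a time.\<close>

lemma coc_reach_empty:
  assumes closed: "\<And>e c. e \<in> events \<Longrightarrow> c \<in> A \<Longrightarrow> case_sum coc_arrive coc_complete e c \<in> A"
    and c: "c \<in> A" "c \<in> lists \<S>"
  shows "[] \<in> A"
  using c
proof (induction "length c" arbitrary: c)
  case (Suc k)
  then obtain S c' where c: "c = S # c'" by (cases c) auto
  obtain n where n: "n \<in> S" using Suc.prems c empty_notin by fastforce
  have "coc_complete n c = c'" using c n by (simp add: coc_complete_def)
  hence "c' \<in> A" using closed[of "Inr n" c] Suc.prems by (auto simp: events_def)
  thus ?case using Suc c by auto
qed simp

lemma coc_Laplace:
  fixes \<theta> :: "'n set \<Rightarrow> real"
  assumes st: "stationary_distribution (coc_states \<S>) (coc_rate \<S> \<mu> p l) \<pi>"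
    and \<theta>: "\<And>S. \<theta> S \<ge> 0"
  shows "measure_pmf.expectation \<pi> (\<lambda>c. exp (- (\<Sum>S\<in>UNIV. \<theta> S * coc_jobs c $ S))) =
     (\<Sum>T\<in>Pow \<S>. type_gf \<theta> T) / (\<Sum>T\<in>Pow \<S>. type_gf (\<lambda>_. 0) T)"
proof -
  let ?w = "prefix_weight arr (mu_of \<mu>)"
  let ?Z = "\<Sum>T\<in>Pow \<S>. type_gf (\<lambda>_. 0) T"
  let ?act = "case_sum coc_arrive coc_complete"
  \<comment> \<open>The empty system alone contributes weight 1, hence the normalization is
    positive.\<close>
  have "type_gf (\<lambda>_. 0) {} \<le> ?Z"
    by (rule member_le_sum) (auto intro: type_gf_nonneg)
  hence Z: "?Z > 0" by simp
  have hs: "(?w has_sum ?Z) (lists \<S>)" using type_gf_lists_has_sum[of "\<lambda>_. 0" \<S>] by simp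
  obtain \<nu> where \<nu>: "pmf \<nu> c = (if c \<in> lists \<S> then ?w c / ?Z else 0)" for c
    using pmf_from_has_sum[OF _ hs Z] prefix_weight_arr_pos by (metis less_imp_le)
  have inv\<nu>: "invariant_pmf events rate ?act \<nu>"
    by (rule invariant_pmf_of_weight[OF \<nu> coc_closed coc_finite_vimage coc_balance])
  have inv\<pi>: "invariant_pmf events rate ?act \<pi>"
  proof (rule stationary_distribution_imp_invariant[OF st])
    show "finite events" by (simp add: events_def)
    show "coc_rate \<S> \<mu> p l x y = (\<Sum>e | e \<in> events \<and> ?act e x = y. rate e)" for x y
      unfolding coc_rate_def by (rule event_rate_eq)
    show "?act e c \<in> coc_states \<S>" if "e \<in> events" "c \<in> coc_states \<S>" for e c
      using that coc_closed unfolding coc_states_def by blast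
  qed
  have "\<pi> = \<nu>"
  proof (rule invariant_pmf_unique[OF _ rate_pos inv\<pi> inv\<nu>])
    show "finite events" by (simp add: events_def)
    show "set_pmf \<pi> \<subseteq> lists \<S>" using st by (simp add: stationary_distribution_def coc_states_def)
    show "set_pmf \<nu> \<subseteq> lists \<S>" by (auto simp: set_pmf_iff \<nu> split: if_splits)
    show "[] \<in> A" if "c \<in> A \<inter> lists \<S>" "\<And>e c. e \<in> events \<Longrightarrow> c \<in> A \<Longrightarrow> ?act e c \<in> A" for A c
      using coc_reach_empty[of A c] that by blast
  qed
  moreover have "measure_pmf.expectation \<nu> (\<lambda>c. exp (- (\<Sum>S\<in>UNIV. \<theta> S * coc_jobs c $ S))) = (\<Sum>T\<in>Pow \<S>. type_gf \<theta> T) / ?Z"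
  proof (rule expectation_of_weight[OF \<nu>, where B = 1])
    show "((\<lambda>c. ?w c * exp (- (\<Sum>S\<in>UNIV. \<theta> S * coc_jobs c $ S))) has_sum (\<Sum>T\<in>Pow \<S>. type_gf \<theta> T)) (lists \<S>)"
      using type_gf_lists_has_sum[OF \<theta>, of \<S>] by (simp add: coc_jobs_def)
    show "\<bar>exp (- (\<Sum>S\<in>UNIV. \<theta> S * coc_jobs c $ S))\<bar> \<le> 1" for c
      using \<theta> by (auto simp: coc_jobs_def intro!: sum_nonneg)
  qed
  ultimately show ?thesis by simp
qed

end

section \<open>Product form for cancel-on-start\<close>

text \<open>
  Only the waiting jobs and the idle servers have a product form. The types of the jobs in service are dropped
  here; there are at most as many of them as servers, so they disappear in the scaling limit.
\<close>

definition cos_red_arrive :: "'n set \<Rightarrow> 'n set list \<times> 'n list \<Rightarrow> 'n set list \<times> 'n list" where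
  "cos_red_arrive S = (\<lambda>(c, u).
     case find (\<lambda>n. n \<in> S) u of None \<Rightarrow> (c @ [S], u) | Some n \<Rightarrow> (c, remove1 n u))"

definition cos_red_complete :: "'n \<Rightarrow> 'n set list \<times> 'n list \<Rightarrow> 'n set list \<times> 'n list" where
  "cos_red_complete n = (\<lambda>(c, u).
     if n \<in> set u then (c, u)
     else case find (\<lambda>S. n \<in> S) c of None \<Rightarrow> (c, u @ [n]) | Some S \<Rightarrow> (remove1 S c, u))"

context replication_system
begin

section \<open>Invariance of the product form for waiting jobs and idle servers\<close>

definition cos_red_states :: "('n set list \<times> 'n list) set" where
  "cos_red_states = {(c, u). c \<in> lists \<S> \<and> distinct u \<and> (\<forall>S\<in>set c. S \<inter> set u = {})}"

text \<open>This is \<open>\<lambda>\<^sub>C\<close> of the known stationary law: the rate of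
  arrivals that find a compatible server in \<open>U\<close>.\<close>

definition arr_compatible :: "'n set \<Rightarrow> real" where
  "arr_compatible U = (\<Sum>S | S \<in> \<S> \<and> S \<inter> U \<noteq> {}. arr S)"

definition idle_weight :: "'n list \<Rightarrow> real" where
  "idle_weight = prefix_weight \<mu> arr_compatible"

definition cos_weight :: "'n set list \<times> 'n list \<Rightarrow> real" where
  "cos_weight = (\<lambda>(c, u). prefix_weight arr (mu_of \<mu>) c * idle_weight u)"

lemma arr_compatible_empty [simp]: "arr_compatible {} = 0"
  by (simp add: arr_compatible_def)

lemma arr_compatible_pos: "U \<noteq> {} \<Longrightarrow> arr_compatible U > 0"
proof -
  assume "U \<noteq> {}"
  then obtain n where "n \<in> U" by blast
  moreover obtain S where "S \<in> \<S>" "n \<in> S" using cover by blast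
  ultimately have "{S. S \<in> \<S> \<and> S \<inter> U \<noteq> {}} \<noteq> {}" by blast
  thus ?thesis unfolding arr_compatible_def by (intro sum_pos) (auto intro: arr_pos)
qed

lemma idle_weight_pos: "idle_weight u > 0"
  unfolding idle_weight_def by (intro prefix_weight_pos mu_pos arr_compatible_pos)

text \<open>Dual to \<open>completion_balance\<close>: an arrival takes the longest idle compatible
  server just as a server takes the oldest compatible job. Adding \<open>n\<close> to
  \<open>U\<close> raises \<open>arr_compatible\<close> by the arrivals that can use
  \<open>n\<close> but no server in \<open>U\<close>.\<close>

lemma assignment_balance:
  "(\<Sum>S\<in>\<S>. arr S * (\<Sum>v | find (\<lambda>n. n \<in> S) v = Some n \<and> remove1 n v = u. idle_weight v)) =
     idle_weight u * \<mu> n"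
  unfolding idle_weight_def
proof (rule insertion_balance[where R = "\<lambda>S n. n \<in> S"])
  show "arr_compatible U \<noteq> 0" if "U \<noteq> {}" for U
    using arr_compatible_pos[OF that] by simp
  show "arr_compatible (insert n U) - arr_compatible U = (\<Sum>S | S \<in> \<S> \<and> n \<in> S \<and> (\<forall>x\<in>U. x \<notin> S). arr S)" for U
  proof -
    have "{S. S \<in> \<S> \<and> S \<inter> insert n U \<noteq> {}} = {S. S \<in> \<S> \<and> n \<in> S \<and> (\<forall>x\<in>U. x \<notin> S)} \<union> {S. S \<in> \<S> \<and> S \<inter> U \<noteq> {}}"
      by auto
    moreover have "sum arr ({S. S \<in> \<S> \<and> n \<in> S \<and> (\<forall>x\<in>U. x \<notin> S)} \<union> {S. S \<in> \<S> \<and> S \<inter> U \<noteq> {}}) =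
        sum arr {S. S \<in> \<S> \<and> n \<in> S \<and> (\<forall>x\<in>U. x \<notin> S)} + sum arr {S. S \<in> \<S> \<and> S \<inter> U \<noteq> {}}"
      by (rule sum.union_disjoint) auto
    ultimately show ?thesis by (simp add: arr_compatible_def)
  qed
qed simp_all

text \<open>The arrival either joined the queue or took an idle server \<open>n\<close>. In the
  second case \<open>n\<close> was idle just before, so it is absent from \<open>u\<close> by
  distinctness and incompatible with every waiting job.\<close>

lemma cos_red_arrive_vimage:
  assumes x: "(c, u) \<in> cos_red_states" and S: "S \<in> \<S>"
  shows "{y. y \<in> cos_red_states \<and> cos_red_arrive S y = (c, u)} =
    (\<lambda>c'. (c', u)) ` {c'. c' @ [S] = c} \<union>
    Pair c ` (\<Union>n\<in>{n. n \<notin> set u \<and> n \<notin> \<Union>(set c)}. {v. find (\<lambda>n. n \<in> S) v = Some n \<and> remove1 n v = u})"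
    (is "?L = ?R1 \<union> ?R2")
proof (intro equalityI subsetI)
  fix y assume y: "y \<in> ?L"
  obtain c' v where y': "y = (c', v)" by (cases y)
  show "y \<in> ?R1 \<union> ?R2"
  proof (cases "find (\<lambda>n. n \<in> S) v")
    case None
    hence "c' @ [S] = c" "v = u" using y y' by (auto simp: cos_red_arrive_def)
    thus ?thesis using y' by auto
  next
    case (Some n)
    hence eq: "c' = c" "remove1 n v = u" using y y' by (auto simp: cos_red_arrive_def)
    have "n \<in> set v" using Some by (auto simp: find_Some_iff)
    hence "n \<notin> set u" "n \<notin> \<Union>(set c)"
      using y y' eq by (auto simp: cos_red_states_def)
    thus ?thesis using y' eq Some by blast
  qed
next
  fix y assume "y \<in> ?R1 \<union> ?R2"
  thus "y \<in> ?L"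
  proof
    assume "y \<in> ?R1"
    then obtain c' where c': "y = (c', u)" "c' @ [S] = c" by auto
    hence "S \<inter> set u = {}" "(c', u) \<in> cos_red_states" using x by (auto simp: cos_red_states_def)
    moreover from this have "find (\<lambda>n. n \<in> S) u = None" unfolding find_None_iff by blast
    ultimately show ?thesis using c' by (simp add: cos_red_arrive_def)
  next
    assume "y \<in> ?R2"
    then obtain n v where v: "y = (c, v)" "n \<notin> set u" "n \<notin> \<Union>(set c)"
      "find (\<lambda>n. n \<in> S) v = Some n \<and> remove1 n v = u" by auto
    then obtain i where i: "i \<le> length u" "v = insert_at i n u" unfolding find_remove1_iff by blast
    have "distinct (take i u @ drop i u)" using x by (simp add: cos_red_states_def)
    hence "distinct v" using i v(2) set_take_subset[of i u] set_drop_subset[of i u]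
      unfolding distinct_append by (auto simp: insert_at_def)
    hence "(c, v) \<in> cos_red_states" using x i v(3) by (auto simp: cos_red_states_def)
    thus ?thesis using v by (simp add: cos_red_arrive_def)
  qed
qed

text \<open>Three origins: server \<open>n\<close> was already idle, it has just become the most
  recently idle one, or it took a waiting job, whose type must be incompatible with all idle
  servers.\<close>

lemma cos_red_complete_vimage:
  assumes x: "(c, u) \<in> cos_red_states"
  shows "{y. y \<in> cos_red_states \<and> cos_red_complete n y = (c, u)} =
    ((if n \<in> set u then {(c, u)} else {}) \<union> Pair c ` {v. v @ [n] = u}) \<union>
    (\<lambda>c'. (c', u)) ` (\<Union>S\<in>{S \<in> \<S>. S \<inter> set u = {}}. {c'. find (\<lambda>S. n \<in> S) c' = Some S \<and> remove1 S c' = c})"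
    (is "?L = (?R1 \<union> ?R2) \<union> ?R3")
proof (intro equalityI subsetI)
  fix y assume y: "y \<in> ?L"
  obtain c' v where y': "y = (c', v)" by (cases y)
  show "y \<in> (?R1 \<union> ?R2) \<union> ?R3"
  proof (cases "n \<in> set v")
    case True
    thus ?thesis using y y' by (auto simp: cos_red_complete_def)
  next
    case nv: False
    show ?thesis
    proof (cases "find (\<lambda>S. n \<in> S) c'")
      case None
      thus ?thesis using y y' nv by (auto simp: cos_red_complete_def)
    next
      case (Some S)
      hence eq: "v = u" "remove1 S c' = c" using y y' nv by (auto simp: cos_red_complete_def)
      have "S \<in> set c'" using Some by (auto simp: find_Some_iff)
      hence "S \<in> \<S>" "S \<inter> set u = {}" using y y' eq by (auto simp: cos_red_states_def)
      thus ?thesis using y' eq Some by blast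
    qed
  qed
next
  fix y assume "y \<in> (?R1 \<union> ?R2) \<union> ?R3"
  then consider "y \<in> ?R1" | "y \<in> ?R2" | "y \<in> ?R3" by blast
  thus "y \<in> ?L"
  proof cases
    case 1
    thus ?thesis using x by (auto simp: cos_red_complete_def split: if_splits)
  next
    case 2
    then obtain v where v: "y = (c, v)" "v @ [n] = u" by auto
    have "S \<inter> set (v @ [n]) = {}" if "S \<in> set c" for S
      using x that unfolding v(2) by (simp add: cos_red_states_def)
    hence d: "\<forall>S\<in>set c. n \<notin> S" "\<forall>S\<in>set c. S \<inter> set v = {}" by auto
    have st: "y \<in> cos_red_states" "n \<notin> set v" using x v d by (auto simp: cos_red_states_def)
    from d have "find (\<lambda>S. n \<in> S) c = None" unfolding find_None_iff by blast
    thus ?thesis using st v by (simp add: cos_red_complete_def)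
  next
    case 3
    then obtain S c' where c': "y = (c', u)" "S \<in> \<S>" "S \<inter> set u = {}"
      "find (\<lambda>S. n \<in> S) c' = Some S \<and> remove1 S c' = c" by auto
    then obtain i where i: "i \<le> length c" "c' = insert_at i S c" "n \<in> S" unfolding find_remove1_iff by blast
    have "n \<notin> set u" using i(3) c'(3) by blast
    moreover have "y \<in> cos_red_states" using x c' i by (auto simp: cos_red_states_def)
    ultimately show ?thesis using c' by (simp add: cos_red_complete_def)
  qed
qed

lemma finite_snoc_vimage: "finite {xs. xs @ [y] = zs}"
  by (rule finite_subset[of _ "{butlast zs}"]) auto

text \<open>The servers split into those with a compatible waiting job, the busy ones without
  (\<open>?N\<close>), and the idle ones. Arrivals that queue balance completions of the first
  group, and arrivals that take an idle server balance completions in \<open>?N\<close>. Conversely,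
  servers turning idle balance arrivals compatible with \<open>u\<close>, and servers taking waiting
  jobs balance the arrivals in \<open>?D\<close>. Idle servers give self-loops.\<close>

lemma cos_red_balance:
  assumes x: "x \<in> cos_red_states"
  shows "cos_weight x * sum rate events =
    (\<Sum>e\<in>events. rate e * (\<Sum>y | y \<in> cos_red_states \<and> case_sum cos_red_arrive cos_red_complete e y = x. cos_weight y))"
proof -
  obtain c u where xcu: "x = (c, u)" by (cases x)
  let ?w = "prefix_weight arr (mu_of \<mu>)"
  have c: "c \<in> lists \<S>" and cu: "\<Union>(set c) \<inter> set u = {}" using x xcu by (auto simp: cos_red_states_def)
  have cS: "set c \<subseteq> \<S>" using c by (simp add: lists_eq_set)
  let ?N = "{n. n \<notin> set u \<and> n \<notin> \<Union>(set c)}"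
  let ?D = "{S \<in> \<S>. S \<inter> set u = {}}"
  let ?G = "\<lambda>S n. {v. find (\<lambda>n. n \<in> S) v = Some n \<and> remove1 n v = u}"
  let ?F = "\<lambda>n S. {c'. find (\<lambda>S. n \<in> S) c' = Some S \<and> remove1 S c' = c}"
  have sum1: "(\<Sum>y\<in>(\<lambda>c'. (c', u)) ` C. cos_weight y) = sum ?w C * idle_weight u" for C
    by (subst sum.reindex) (auto simp: inj_on_def cos_weight_def sum_distrib_right)
  have sum2: "(\<Sum>y\<in>Pair c ` C. cos_weight y) = ?w c * sum idle_weight C" for C
    by (subst sum.reindex) (auto simp: inj_on_def cos_weight_def sum_distrib_left)
  have disj: "((if b then {(c, u)} else {}) \<union> Pair c ` V) \<inter> (\<lambda>c'. (c', u)) ` C = {}"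
    if "c \<notin> C" for b V C
    using that by (cases b) auto
  have arrivals: "(\<Sum>S\<in>\<S>. arr S * (\<Sum>y | y \<in> cos_red_states \<and> cos_red_arrive S y = x. cos_weight y)) =
      cos_weight x * (mu_of \<mu> (set c) + sum \<mu> ?N)"
  proof -
    have "(\<Sum>S\<in>\<S>. arr S * (\<Sum>y | y \<in> cos_red_states \<and> cos_red_arrive S y = x. cos_weight y)) =
        (\<Sum>S\<in>\<S>. (arr S * (\<Sum>c' | c' @ [S] = c. ?w c')) * idle_weight u + (\<Sum>n\<in>?N. ?w c * (arr S * sum idle_weight (?G S n))))"
    proof (intro sum.cong refl)
      fix S assume S: "S \<in> \<S>"
      have "(\<Sum>y | y \<in> cos_red_states \<and> cos_red_arrive S y = x. cos_weight y) =
          (\<Sum>y\<in>(\<lambda>c'. (c', u)) ` {c'. c' @ [S] = c}. cos_weight y) + (\<Sum>y\<in>Pair c ` (\<Union>n\<in>?N. ?G S n). cos_weight y)"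
        unfolding xcu cos_red_arrive_vimage[OF x[unfolded xcu] S]
      proof (rule sum.union_disjoint)
        show "(\<lambda>c'. (c', u)) ` {c'. c' @ [S] = c} \<inter> Pair c ` (\<Union>n\<in>?N. ?G S n) = {}" by auto
      qed (simp_all add: finite_find_remove1 finite_snoc_vimage)
      also have "\<dots> = (\<Sum>c' | c' @ [S] = c. ?w c') * idle_weight u + ?w c * (\<Sum>n\<in>?N. sum idle_weight (?G S n))"
        unfolding sum1 sum2 by (subst sum_find_remove1_Union) simp_all
      finally have eq: "(\<Sum>y | y \<in> cos_red_states \<and> cos_red_arrive S y = x. cos_weight y) =
          (\<Sum>c' | c' @ [S] = c. ?w c') * idle_weight u + ?w c * (\<Sum>n\<in>?N. sum idle_weight (?G S n))" .
      show "arr S * (\<Sum>y | y \<in> cos_red_states \<and> cos_red_arrive S y = x. cos_weight y) =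
          (arr S * (\<Sum>c' | c' @ [S] = c. ?w c')) * idle_weight u + (\<Sum>n\<in>?N. ?w c * (arr S * sum idle_weight (?G S n)))"
        unfolding eq sum_distrib_left[symmetric] by (simp only: algebra_simps)
    qed
    also have "\<dots> = (\<Sum>S\<in>\<S>. arr S * (\<Sum>c' | c' @ [S] = c. ?w c')) * idle_weight u +
        (\<Sum>n\<in>?N. ?w c * (\<Sum>S\<in>\<S>. arr S * sum idle_weight (?G S n)))"
      unfolding sum.distrib sum_distrib_right[symmetric]
      by (subst sum.swap) (simp only: sum_distrib_left)
    also have "(\<Sum>S\<in>\<S>. arr S * (\<Sum>c' | c' @ [S] = c. ?w c')) = ?w c * mu_of \<mu> (set c)"
    proof (rule snoc_balance)
      show "c \<noteq> [] \<Longrightarrow> mu_of \<mu> (set c) \<noteq> 0" using mu_of_pos[OF cS] by simp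
    qed (use cS in simp_all)
    also have "(\<Sum>n\<in>?N. ?w c * (\<Sum>S\<in>\<S>. arr S * sum idle_weight (?G S n))) = ?w c * idle_weight u * sum \<mu> ?N"
      by (simp only: assignment_balance) (simp only: sum_distrib_left mult.assoc)
    finally show ?thesis by (simp add: xcu cos_weight_def algebra_simps)
  qed
  have completions: "(\<Sum>n\<in>UNIV. \<mu> n * (\<Sum>y | y \<in> cos_red_states \<and> cos_red_complete n y = x. cos_weight y)) =
      cos_weight x * (sum \<mu> (set u) + arr_compatible (set u) + sum arr ?D)"
  proof -
    have "(\<Sum>n\<in>UNIV. \<mu> n * (\<Sum>y | y \<in> cos_red_states \<and> cos_red_complete n y = x. cos_weight y)) =
        (\<Sum>n\<in>UNIV. (if n \<in> set u then cos_weight x * \<mu> n else 0) + ?w c * (\<mu> n * (\<Sum>v | v @ [n] = u. idle_weight v)) +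
          (\<Sum>S\<in>?D. idle_weight u * (\<mu> n * sum ?w (?F n S))))"
    proof (intro sum.cong refl)
      fix n
      have "(\<Sum>y | y \<in> cos_red_states \<and> cos_red_complete n y = x. cos_weight y) =
          (\<Sum>y\<in>(if n \<in> set u then {(c, u)} else {}) \<union> Pair c ` {v. v @ [n] = u}. cos_weight y) +
          (\<Sum>y\<in>(\<lambda>c'. (c', u)) ` (\<Union>S\<in>?D. ?F n S). cos_weight y)"
        unfolding xcu cos_red_complete_vimage[OF x[unfolded xcu]]
      proof (rule sum.union_disjoint)
        \<comment> \<open>A completion that starts a waiting job shortens the queue by one, which
          separates these predecessors from those with queue \<open>c\<close> itself.\<close>
        have len: "length c' = Suc (length c)" if "c' \<in> (\<Union>S\<in>?D. ?F n S)" for c'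
          using that unfolding find_remove1_iff by (auto simp: insert_at_def)
        have nc: "c \<notin> (\<Union>S\<in>?D. ?F n S)"
        proof
          assume "c \<in> (\<Union>S\<in>?D. ?F n S)"
          from len[OF this] show False by simp
        qed
        show "((if n \<in> set u then {(c, u)} else {}) \<union> Pair c ` {v. v @ [n] = u}) \<inter>
            (\<lambda>c'. (c', u)) ` (\<Union>S\<in>?D. ?F n S) = {}"
          by (rule disj[OF nc])
      qed (simp_all add: finite_find_remove1 finite_snoc_vimage)
      also have "(\<Sum>y\<in>(if n \<in> set u then {(c, u)} else {}) \<union> Pair c ` {v. v @ [n] = u}. cos_weight y) =
          (\<Sum>y\<in>(if n \<in> set u then {(c, u)} else {}). cos_weight y) + (\<Sum>y\<in>Pair c ` {v. v @ [n] = u}. cos_weight y)"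
        by (rule sum.union_disjoint) (auto simp: finite_snoc_vimage)
      also have "(\<Sum>y\<in>(\<lambda>c'. (c', u)) ` (\<Union>S\<in>?D. ?F n S). cos_weight y) = (\<Sum>S\<in>?D. sum ?w (?F n S)) * idle_weight u"
        unfolding sum1 by (subst sum_find_remove1_Union) simp_all
      finally have "\<mu> n * (\<Sum>y | y \<in> cos_red_states \<and> cos_red_complete n y = x. cos_weight y) =
          \<mu> n * ((\<Sum>y\<in>(if n \<in> set u then {(c, u)} else {}). cos_weight y) + ?w c * (\<Sum>v | v @ [n] = u. idle_weight v) +
            (\<Sum>S\<in>?D. sum ?w (?F n S)) * idle_weight u)"
        by (simp only: sum2)
      also have "\<dots> = (if n \<in> set u then cos_weight x * \<mu> n else 0) + ?w c * (\<mu> n * (\<Sum>v | v @ [n] = u. idle_weight v)) +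
          idle_weight u * (\<mu> n * (\<Sum>S\<in>?D. sum ?w (?F n S)))"
        by (simp add: xcu algebra_simps)
      also have "idle_weight u * (\<mu> n * (\<Sum>S\<in>?D. sum ?w (?F n S))) = (\<Sum>S\<in>?D. idle_weight u * (\<mu> n * sum ?w (?F n S)))"
        by (simp only: sum_distrib_left)
      finally show "\<mu> n * (\<Sum>y | y \<in> cos_red_states \<and> cos_red_complete n y = x. cos_weight y) =
          (if n \<in> set u then cos_weight x * \<mu> n else 0) + ?w c * (\<mu> n * (\<Sum>v | v @ [n] = u. idle_weight v)) +
          (\<Sum>S\<in>?D. idle_weight u * (\<mu> n * sum ?w (?F n S)))" .
    qed
    also have "\<dots> = (\<Sum>n\<in>UNIV. if n \<in> set u then cos_weight x * \<mu> n else 0) +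
        ?w c * (\<Sum>n\<in>UNIV. \<mu> n * (\<Sum>v | v @ [n] = u. idle_weight v)) +
        (\<Sum>S\<in>?D. idle_weight u * (\<Sum>n\<in>UNIV. \<mu> n * sum ?w (?F n S)))"
      unfolding sum.distrib sum.swap[of _ ?D] by (simp only: sum_distrib_left)
    also have "(\<Sum>n\<in>UNIV. if n \<in> set u then cos_weight x * \<mu> n else 0) = cos_weight x * sum \<mu> (set u)"
      unfolding sum_distrib_left by (rule sum.mono_neutral_cong_right) auto
    also have "(\<Sum>n\<in>UNIV. \<mu> n * (\<Sum>v | v @ [n] = u. idle_weight v)) = idle_weight u * arr_compatible (set u)"
      unfolding idle_weight_def
    proof (rule snoc_balance)
      show "u \<noteq> [] \<Longrightarrow> arr_compatible (set u) \<noteq> 0" using arr_compatible_pos[of "set u"] by simp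
    qed simp_all
    also have "(\<Sum>S\<in>?D. idle_weight u * (\<Sum>n\<in>UNIV. \<mu> n * sum ?w (?F n S))) = (\<Sum>S\<in>?D. idle_weight u * (?w c * arr S))"
      by (intro sum.cong refl) (use completion_balance[OF c] in simp)
    also have "\<dots> = cos_weight x * sum arr ?D"
      unfolding sum_distrib_left by (simp add: xcu cos_weight_def mult_ac)
    finally show ?thesis by (simp add: xcu cos_weight_def algebra_simps)
  qed
  have \<mu>: "sum \<mu> UNIV = mu_of \<mu> (set c) + sum \<mu> ?N + sum \<mu> (set u)"
  proof -
    have "UNIV = \<Union>(set c) \<union> (?N \<union> set u)" by auto
    hence "sum \<mu> UNIV = sum \<mu> (\<Union>(set c) \<union> (?N \<union> set u))" by simp
    also have "\<dots> = sum \<mu> (\<Union>(set c)) + sum \<mu> (?N \<union> set u)"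
      by (rule sum.union_disjoint) (use cu in auto)
    also have "sum \<mu> (?N \<union> set u) = sum \<mu> ?N + sum \<mu> (set u)"
      by (rule sum.union_disjoint) auto
    finally show ?thesis by (simp add: mu_of_def)
  qed
  have arr: "sum arr \<S> = arr_compatible (set u) + sum arr ?D"
  proof -
    have "\<S> = {S. S \<in> \<S> \<and> S \<inter> set u \<noteq> {}} \<union> ?D" by auto
    hence "sum arr \<S> = sum arr ({S. S \<in> \<S> \<and> S \<inter> set u \<noteq> {}} \<union> ?D)" by simp
    also have "\<dots> = sum arr {S. S \<in> \<S> \<and> S \<inter> set u \<noteq> {}} + sum arr ?D"
      by (rule sum.union_disjoint) auto
    finally show ?thesis by (simp add: arr_compatible_def)
  qed
  show ?thesis
    using arrivals completions by (simp add: sum_events rate_def \<mu> arr algebra_simps)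
qed

lemma cos_red_closed:
  assumes "e \<in> events" "x \<in> cos_red_states"
  shows "case_sum cos_red_arrive cos_red_complete e x \<in> cos_red_states"
proof -
  obtain c u where x: "x = (c, u)" by (cases x)
  show ?thesis
  proof (cases e)
    case (Inl S)
    hence S: "S \<in> \<S>" using assms by (auto simp: events_def)
    show ?thesis
    proof (cases "find (\<lambda>n. n \<in> S) u")
      case None
      hence "S \<inter> set u = {}" unfolding find_None_iff by blast
      thus ?thesis using None Inl S assms x by (auto simp: cos_red_arrive_def cos_red_states_def)
    next
      case (Some n)
      thus ?thesis using Inl assms x set_remove1_subset[of n u]
        by (fastforce simp: cos_red_arrive_def cos_red_states_def distinct_remove1)
    qed
  next
    case (Inr n)
    show ?thesis
    proof (cases "find (\<lambda>S. n \<in> S) c")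
      case None
      hence "\<forall>S\<in>set c. n \<notin> S" unfolding find_None_iff by blast
      thus ?thesis using None Inr assms x by (auto simp: cos_red_complete_def cos_red_states_def)
    next
      case (Some S)
      thus ?thesis using Inr assms x set_remove1_subset[of S c]
        by (fastforce simp: cos_red_complete_def cos_red_states_def lists_eq_set)
    qed
  qed
qed

lemma cos_red_finite_vimage:
  assumes "e \<in> events" "x \<in> cos_red_states"
  shows "finite {y \<in> cos_red_states. case_sum cos_red_arrive cos_red_complete e y = x}"
proof -
  obtain c u where x: "x = (c, u)" by (cases x)
  show ?thesis
  proof (cases e)
    case (Inl S)
    thus ?thesis using cos_red_arrive_vimage[of c u S] assms x
      by (auto simp: events_def finite_find_remove1 finite_snoc_vimage)
  next
    case (Inr n)
    thus ?thesis using cos_red_complete_vimage[of c u n] assms x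
      by (simp add: finite_find_remove1 finite_snoc_vimage)
  qed
qed

text \<open>
  All servers can be made busy by arrivals, and then the queue can be emptied by completions.
\<close>

lemma cos_red_reach_busy:
  assumes closed: "\<And>e x. e \<in> events \<Longrightarrow> x \<in> A \<Longrightarrow> case_sum cos_red_arrive cos_red_complete e x \<in> A"
    and x: "(c, u) \<in> A" "(c, u) \<in> cos_red_states"
  shows "([], []) \<in> A"
  using x
proof (induction "length u + length c" arbitrary: c u rule: less_induct)
  case less
  consider "u \<noteq> []" | "u = []" "c \<noteq> []" | "u = []" "c = []" by blast
  thus ?case
  proof cases
    case 1
    then obtain n u' where u: "u = n # u'" by (cases u) auto
    obtain S where S: "S \<in> \<S>" "n \<in> S" using cover by blast
    hence e: "Inl S \<in> events" by (auto simp: events_def)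
    have "case_sum cos_red_arrive cos_red_complete (Inl S) (c, u) = (c, u')"
      using u S by (simp add: cos_red_arrive_def)
    hence "(c, u') \<in> A" "(c, u') \<in> cos_red_states"
      using closed[OF e] cos_red_closed[OF e] less.prems by metis+
    thus ?thesis using less.hyps[of u' c] u by simp
  next
    case 2
    then obtain S c' where c: "c = S # c'" by (cases c) auto
    have "S \<in> \<S>" using less.prems c by (simp add: cos_red_states_def)
    then obtain n where n: "n \<in> S" using empty_notin by fastforce
    have e: "Inr n \<in> events" by (auto simp: events_def)
    have "case_sum cos_red_arrive cos_red_complete (Inr n) (c, u) = (c', u)"
      using c n 2 by (simp add: cos_red_complete_def)
    hence "(c', u) \<in> A" "(c', u) \<in> cos_red_states"
      using closed[OF e] cos_red_closed[OF e] less.prems by metis+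
    thus ?thesis using less.hyps[of u c'] c by simp
  qed (use less.prems in simp)
qed

text \<open>For a given idle list \<open>u\<close> the queue carries the cancel-on-completion
  weights, restricted to the types that avoid \<open>u\<close>.\<close>

definition cos_gf :: "('n set \<Rightarrow> real) \<Rightarrow> real" where
  "cos_gf \<theta> = (\<Sum>u | distinct u. idle_weight u * (\<Sum>T\<in>Pow {S \<in> \<S>. S \<inter> set u = {}}. type_gf \<theta> T))"

lemma finite_distinct: "finite {u :: 'n list. distinct u}"
proof (rule finite_subset[OF _ finite_lists_length_le[of "UNIV :: 'n set" "CARD('n)"]])
  show "{u :: 'n list. distinct u} \<subseteq> {u. set u \<subseteq> UNIV \<and> length u \<le> CARD('n)}"
    using card_mono[of "UNIV :: 'n set"] by (auto simp: distinct_card[symmetric])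
qed simp

lemma cos_gf_has_sum:
  fixes \<theta> :: "'n set \<Rightarrow> real"
  assumes "\<And>S. \<theta> S \<ge> 0"
  shows "((\<lambda>x. cos_weight x * exp (- (\<Sum>S\<in>UNIV. \<theta> S * count_list (fst x) S))) has_sum cos_gf \<theta>) cos_red_states"
proof -
  let ?D = "\<lambda>u. {S \<in> \<S>. S \<inter> set u = {}}"
  let ?f = "\<lambda>x. cos_weight x * exp (- (\<Sum>S\<in>UNIV. \<theta> S * count_list (fst x) S))"
  have "cos_red_states = (\<Union>u\<in>{u. distinct u}. (\<lambda>c. (c, u)) ` lists (?D u))"
  proof (intro equalityI subsetI)
    fix x assume "x \<in> cos_red_states"
    then obtain c u where "x = (c, u)" "c \<in> lists (?D u)" "distinct u"
      by (cases x) (auto simp: cos_red_states_def lists_eq_set)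
    thus "x \<in> (\<Union>u\<in>{u. distinct u}. (\<lambda>c. (c, u)) ` lists (?D u))" by blast
  qed (auto simp: cos_red_states_def lists_eq_set)
  moreover have "(?f has_sum cos_gf \<theta>) (\<Union>u\<in>{u. distinct u}. (\<lambda>c. (c, u)) ` lists (?D u))"
    unfolding cos_gf_def
  proof (rule sum_has_sum[OF finite_distinct])
    fix u :: "'n list"
    have "((\<lambda>c. idle_weight u * (prefix_weight arr (mu_of \<mu>) c * exp (- (\<Sum>S\<in>UNIV. \<theta> S * count_list c S))))
        has_sum (idle_weight u * (\<Sum>T\<in>Pow (?D u). type_gf \<theta> T))) (lists (?D u))"
      by (intro has_sum_cmult_right type_gf_lists_has_sum assms) auto
    hence "((?f \<circ> (\<lambda>c. (c, u))) has_sum (idle_weight u * (\<Sum>T\<in>Pow (?D u). type_gf \<theta> T))) (lists (?D u))"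
      by (simp add: o_def cos_weight_def mult_ac)
    thus "(?f has_sum (idle_weight u * (\<Sum>T\<in>Pow (?D u). type_gf \<theta> T))) ((\<lambda>c. (c, u)) ` lists (?D u))"
      by (subst has_sum_reindex) (auto simp: inj_on_def)
  qed auto
  ultimately show ?thesis by simp
qed

section \<open>Projection of the full cancel-on-start chain\<close>

lemma cos_project_arrive: "S \<in> \<S> \<Longrightarrow> x \<in> cos_states \<S> \<Longrightarrow>
    (\<lambda>(c, u, s). (c, u)) (cos_arrive S x) = cos_red_arrive S ((\<lambda>(c, u, s). (c, u)) x)"
  by (cases x) (auto simp: cos_arrive_def cos_red_arrive_def split: option.splits)

text \<open>The full chain tests idleness by \<open>s n = None\<close> and the reduced one by
  membership in \<open>u\<close>; the two tests agree on \<open>cos_states\<close>.\<close>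

lemma cos_project_complete: "x \<in> cos_states \<S> \<Longrightarrow>
    (\<lambda>(c, u, s). (c, u)) (cos_complete n x) = cos_red_complete n ((\<lambda>(c, u, s). (c, u)) x)"
  by (cases x) (auto simp: cos_complete_def cos_red_complete_def cos_states_def split: option.splits)

lemma cos_closed:
  assumes "e \<in> events" "x \<in> cos_states \<S>"
  shows "case_sum cos_arrive cos_complete e x \<in> cos_states \<S>"
proof -
  obtain c u s where x: "x = (c, u, s)" by (cases x)
  have st: "set c \<subseteq> \<S>" "distinct u" "set u = {n. s n = None}"
    "\<And>n S. s n = Some S \<Longrightarrow> S \<in> \<S> \<and> n \<in> S" "\<And>S. S \<in> set c \<Longrightarrow> S \<inter> set u = {}"
    using assms(2) x by (auto simp: cos_states_def lists_eq_set disjoint_iff)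
  show ?thesis
  proof (cases e)
    case (Inl S)
    hence S: "S \<in> \<S>" using assms by (auto simp: events_def)
    show ?thesis
    proof (cases "find (\<lambda>n. n \<in> S) u")
      case None
      hence "S \<inter> set u = {}" unfolding find_None_iff by blast
      thus ?thesis using None Inl S x st by (auto simp: cos_arrive_def cos_states_def lists_eq_set disjoint_iff)
    next
      case (Some n)
      hence "n \<in> S" by (auto simp: find_Some_iff)
      moreover have "set (remove1 n u) = set u - {n}" using st(2) by simp
      ultimately show ?thesis using Some Inl S x st
        by (auto simp: cos_arrive_def cos_states_def lists_eq_set disjoint_iff)
    qed
  next
    case (Inr n)
    show ?thesis
    proof (cases "s n = None")
      case True
      thus ?thesis using Inr x assms by (simp add: cos_complete_def)
    next
      case busy: False
      show ?thesis
      proof (cases "find (\<lambda>S. n \<in> S) c")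
        case None
        hence "\<forall>S\<in>set c. n \<notin> S" unfolding find_None_iff by blast
        thus ?thesis using None Inr x st busy by (auto simp: cos_complete_def cos_states_def lists_eq_set disjoint_iff)
      next
        case (Some S)
        hence S: "S \<in> set c" "n \<in> S" by (auto simp: find_Some_iff)
        have sub: "set (remove1 S c) \<subseteq> set c" by (rule set_remove1_subset)
        have "set u = {m. (s(n := Some S)) m = None}" using st(3) busy by auto
        moreover have "S' \<in> \<S> \<and> m \<in> S'" if "(s(n := Some S)) m = Some S'" for m S'
          using that st(1,4) S by (auto split: if_splits)
        moreover have "\<forall>S'\<in>set (remove1 S c). S' \<inter> set u = {}" using st(5) sub by blast
        ultimately have "(remove1 S c, u, s(n := Some S)) \<in> cos_states \<S>"
          using st(1,2) sub unfolding cos_states_def lists_eq_set mem_Collect_eq prod.case by blast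
        thus ?thesis using Some Inr x busy by (auto simp: cos_complete_def)
      qed
    qed
  qed
qed

text \<open>Only waiting jobs are counted, since their number is a function of the projected state;
  jobs in service are added in \<open>cos_Laplace_limit\<close>.\<close>

lemma cos_Laplace:
  fixes \<theta> :: "'n set \<Rightarrow> real"
  assumes st: "stationary_distribution (cos_states \<S>) (cos_rate \<S> \<mu> p l) \<pi>"
    and \<theta>: "\<And>S. \<theta> S \<ge> 0"
  shows "measure_pmf.expectation \<pi> (\<lambda>(c, u, s). exp (- (\<Sum>S\<in>UNIV. \<theta> S * count_list c S))) =
     cos_gf \<theta> / cos_gf (\<lambda>_. 0)"
proof -
  let ?Z = "cos_gf (\<lambda>_. 0)"
  let ?act = "case_sum cos_red_arrive cos_red_complete"
  let ?proj = "\<lambda>(c, u, s). (c, u)"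
  have hs: "(cos_weight has_sum ?Z) cos_red_states" using cos_gf_has_sum[of "\<lambda>_. 0"] by simp
  have nn: "cos_weight x > 0" if "x \<in> cos_red_states" for x
    using that by (auto simp: cos_weight_def cos_red_states_def intro!: mult_pos_pos prefix_weight_arr_pos idle_weight_pos)
  have "([], []) \<in> cos_red_states" by (simp add: cos_red_states_def)
  hence Z: "?Z > 0"
    using has_sum_strict_mono[OF has_sum_0 hs, of "\<lambda>_. 0" "([], [])"] nn by (auto intro: less_imp_le)
  obtain \<nu> where \<nu>: "pmf \<nu> x = (if x \<in> cos_red_states then cos_weight x / ?Z else 0)" for x
    using pmf_from_has_sum[OF _ hs Z] nn by (metis less_imp_le)
  have inv\<nu>: "invariant_pmf events rate ?act \<nu>"
    by (rule invariant_pmf_of_weight[OF \<nu> cos_red_closed cos_red_finite_vimage cos_red_balance])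
  have sub: "set_pmf \<pi> \<subseteq> cos_states \<S>" using st by (simp add: stationary_distribution_def)
  have "invariant_pmf events rate (case_sum cos_arrive cos_complete) \<pi>"
  proof (rule stationary_distribution_imp_invariant[OF st])
    show "finite events" by (simp add: events_def)
    show "cos_rate \<S> \<mu> p l x y = (\<Sum>e | e \<in> events \<and> case_sum cos_arrive cos_complete e x = y. rate e)" for x y
      unfolding cos_rate_def by (rule event_rate_eq)
  qed (rule cos_closed)
  hence inv\<pi>: "invariant_pmf events rate ?act (map_pmf ?proj \<pi>)"
  proof (rule invariant_pmf_map)
    fix e x assume "e \<in> events" "x \<in> set_pmf \<pi>"
    hence "x \<in> cos_states \<S>" "e \<in> events" using sub by auto
    thus "?proj (case_sum cos_arrive cos_complete e x) = ?act e (?proj x)"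
      using cos_project_arrive[of _ x] cos_project_complete[of x] by (cases e) (auto simp: events_def)
  qed
  have "map_pmf ?proj \<pi> = \<nu>"
  proof (rule invariant_pmf_unique[OF _ rate_pos inv\<pi> inv\<nu>])
    show "finite events" by (simp add: events_def)
    show "set_pmf (map_pmf ?proj \<pi>) \<subseteq> cos_red_states"
      using sub by (fastforce simp: cos_states_def cos_red_states_def)
    show "set_pmf \<nu> \<subseteq> cos_red_states" by (auto simp: set_pmf_iff \<nu> split: if_splits)
    show "([], []) \<in> A" if "x \<in> A \<inter> cos_red_states" "\<And>e c. e \<in> events \<Longrightarrow> c \<in> A \<Longrightarrow> ?act e c \<in> A" for A x
      using cos_red_reach_busy[of A "fst x" "snd x"] that by simp
  qed
  moreover have "measure_pmf.expectation \<nu> (\<lambda>x. exp (- (\<Sum>S\<in>UNIV. \<theta> S * count_list (fst x) S))) = cos_gf \<theta> / ?Z"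
  proof (rule expectation_of_weight[OF \<nu> cos_gf_has_sum, where B = 1])
    show "\<bar>exp (- (\<Sum>S\<in>UNIV. \<theta> S * count_list (fst x) S))\<bar> \<le> 1" for x :: "'n set list \<times> 'n list"
      using \<theta> by (auto intro!: sum_nonneg)
  qed (use \<theta> in simp)
  ultimately have "measure_pmf.expectation (map_pmf ?proj \<pi>) (\<lambda>x. exp (- (\<Sum>S\<in>UNIV. \<theta> S * count_list (fst x) S))) = cos_gf \<theta> / ?Z"
    by simp
  thus ?thesis by (simp add: case_prod_unfold)
qed

end

section \<open>Convergence of Laplace transforms\<close>

text \<open>The polynomials, presented so that convergence of their integrals follows by induction
  from the case of one monomial.\<close>

inductive monomial_span :: "(real ^ 'd::finite \<Rightarrow> real) \<Rightarrow> bool" where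
  monomial: "monomial_span (\<lambda>y. c * (\<Prod>d\<in>UNIV. (y $ d) ^ k d))"
| add: "monomial_span f \<Longrightarrow> monomial_span g \<Longrightarrow> monomial_span (\<lambda>y. f y + g y)"

lemma monomial_span_mult:
  assumes "monomial_span f" "monomial_span g"
  shows "monomial_span (\<lambda>y. f y * g y)"
  using assms
proof (induction rule: monomial_span.induct)
  case (monomial c k)
  from monomial show ?case
  proof (induction rule: monomial_span.induct)
    case (monomial c' k')
    have "(c * (\<Prod>d\<in>UNIV. (y $ d) ^ k d)) * (c' * (\<Prod>d\<in>UNIV. (y $ d) ^ k' d)) =
        (c * c') * (\<Prod>d\<in>UNIV. (y $ d) ^ (k d + k' d))" for y :: "real ^ 'a"
      by (simp add: power_add prod.distrib)
    thus ?case using monomial_span.monomial[of "c * c'" "\<lambda>d. k d + k' d"] by (simp only:)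
  next
    case (add f g)
    from monomial_span.add[OF add.IH] show ?case by (simp add: distrib_left)
  qed
next
  case (add f f')
  from monomial_span.add[OF add.IH[OF add.prems]] show ?case by (simp add: distrib_right)
qed

lemma monomial_span_continuous: "monomial_span f \<Longrightarrow> continuous_on A f"
  by (induction rule: monomial_span.induct) (intro continuous_intros; assumption?)+

lemma monomial_span_dense:
  fixes K :: "(real ^ 'd::finite) set"
  assumes "compact K" "continuous_on K g" "e > 0"
  shows "\<exists>h. monomial_span h \<and> (\<forall>y\<in>K. \<bar>g y - h y\<bar> < e)"
proof (rule Stone_Weierstrass_HOL[OF assms(1) _ _ _ _ _ assms(2,3)])
  show "monomial_span (\<lambda>y. c :: real)" for c
    using monomial_span.monomial[of c "\<lambda>_. 0"] by simp
  fix x y :: "real ^ 'd" assume "x \<in> K \<and> y \<in> K \<and> x \<noteq> y"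
  then obtain d where "x $ d \<noteq> y $ d" by (auto simp: vec_eq_iff)
  moreover have "(\<Prod>d'\<in>UNIV. (z $ d') ^ (if d' = d then 1 else 0)) = z $ d" for z :: "real ^ 'd"
    by (simp add: if_distrib[of "\<lambda>k. _ ^ k"] cong: if_cong)
  hence "monomial_span (\<lambda>z. z $ d)"
    using monomial_span.monomial[of 1 "\<lambda>d'. if d' = d then 1 else 0"] by simp
  ultimately show "\<exists>f. monomial_span f \<and> f x \<noteq> f y" by blast
qed (auto intro: monomial_span_mult monomial_span_continuous monomial_span.add)

lemma integrable_bounded_continuous:
  fixes h :: "'a::metric_space \<Rightarrow> real"
  assumes "prob_space M" "sets M = sets borel" "continuous_on UNIV h" "\<And>x. \<bar>h x\<bar> \<le> B"
  shows "integrable M h"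
proof -
  interpret prob_space M by fact
  have "h \<in> borel_measurable M"
    using borel_measurable_continuous_onI[OF assms(3)] assms(2) by (simp cong: measurable_cong_sets)
  thus ?thesis using assms(4) by (intro integrable_const_bound[where B = B]) auto
qed

text \<open>
  Under \<^term>\<open>\<lambda>x d. exp (- x $ d)\<close> the orthant becomes the unit cube and Laplace transforms become moments,
  so Stone-Weierstrass gives the convergence of the integrals of functions with bounded support;
  no mass escapes because the limit is a probability measure.
\<close>

lemma converges_in_distribution_Laplace:
  fixes M :: "'i \<Rightarrow> (real ^ 'd::finite) measure"
  assumes M: "\<And>i. prob_space (M i)" "\<And>i. sets (M i) = sets borel"
    and L: "prob_space L" "sets L = sets borel"
    and M_pos: "\<forall>\<^sub>F i in F. AE x in M i. \<forall>d. 0 \<le> x $ d"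
    and L_pos: "AE x in L. \<forall>d. 0 \<le> x $ d"
    and Laplace: "\<And>k :: 'd \<Rightarrow> nat. ((\<lambda>i. \<integral>x. exp (- (\<Sum>d\<in>UNIV. k d * x $ d)) \<partial>M i)
        \<longlongrightarrow> (\<integral>x. exp (- (\<Sum>d\<in>UNIV. k d * x $ d)) \<partial>L)) F"
  shows "converges_in_distribution M L F"
proof -
  \<comment> \<open>The truncation at 0 keeps \<open>Y\<close> continuous with values in the cube on
    the whole space; on the orthant, where the measures live, it changes nothing.\<close>
  define Y :: "real ^ 'd \<Rightarrow> real ^ 'd" where "Y = (\<lambda>x. \<chi> d. exp (- max 0 (x $ d)))"
  define K :: "(real ^ 'd) set" where "K = {y. \<forall>d. y $ d \<in> {0..1}}"
  have Y_cont: "continuous_on A Y" for A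
    unfolding Y_def by (intro continuous_intros)
  have YK: "Y x \<in> K" for x by (simp add: Y_def K_def)
  have K: "compact K"
  proof -
    have "K = cbox 0 (\<chi> d. 1)" by (auto simp: K_def mem_box_cart)
    thus ?thesis by simp
  qed
  have meas: "h \<in> borel_measurable N" if "continuous_on UNIV h" "sets N = sets borel"
    for h :: "real ^ 'd \<Rightarrow> real" and N
    using borel_measurable_continuous_onI[OF that(1)] that(2) by (simp cong: measurable_cong_sets)
  have gY_cont: "continuous_on UNIV (\<lambda>x. g (Y x))" if "continuous_on K g" for g :: "real ^ 'd \<Rightarrow> real"
    by (rule continuous_on_compose2[OF that Y_cont]) (use YK in auto)
  have gY_int: "integrable N (\<lambda>x. g (Y x))"
    if g: "continuous_on K g" and N: "prob_space N" "sets N = sets borel" for g :: "real ^ 'd \<Rightarrow> real" and N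
  proof -
    obtain B where "\<And>y. y \<in> K \<Longrightarrow> \<bar>g y\<bar> \<le> B"
      using compact_imp_bounded[OF compact_continuous_image[OF g K]] by (auto simp: bounded_iff)
    thus ?thesis
      by (intro integrable_bounded_continuous[OF N gY_cont[OF g], of B]) (use YK in auto)
  qed
  have cong: "(\<integral>x. h x \<partial>N) = (\<integral>x. h' x \<partial>N)"
    if "AE x in N. \<forall>d. 0 \<le> x $ d" "\<And>x. (\<And>d. 0 \<le> x $ d) \<Longrightarrow> h x = h' x"
      "continuous_on UNIV h" "continuous_on UNIV h'" "sets N = sets borel" for h h' :: "real ^ 'd \<Rightarrow> real" and N
    by (rule integral_cong_AE) (use that meas in auto)

  have conv_monomial: "((\<lambda>i. \<integral>x. g (Y x) \<partial>M i) \<longlongrightarrow> (\<integral>x. g (Y x) \<partial>L)) F" if "monomial_span g" for g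
    using that
  proof (induction rule: monomial_span.induct)
    case (monomial c k)
    let ?g = "\<lambda>y :: real ^ 'd. c * (\<Prod>d\<in>UNIV. (y $ d) ^ k d)"
    let ?e = "\<lambda>x :: real ^ 'd. exp (- (\<Sum>d\<in>UNIV. k d * x $ d))"
    \<comment> \<open>A monomial in \<open>Y x\<close> is an exponential with integer exponents,
      which is why the transform is required only at vectors of naturals.\<close>
    have gY: "?g (Y x) = c * ?e x" if "\<And>d. 0 \<le> x $ d" for x
      using that by (simp add: Y_def exp_of_nat_mult[symmetric] exp_sum[symmetric] sum_negf)
    have cont: "continuous_on UNIV (\<lambda>x. ?g (Y x))" "continuous_on UNIV (\<lambda>x. c * ?e x)"
      by (intro gY_cont monomial_span_continuous monomial_span.monomial) (intro continuous_intros)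
    have eq: "(\<integral>x. ?g (Y x) \<partial>N) = c * (\<integral>x. ?e x \<partial>N)"
      if "AE x in N. \<forall>d. 0 \<le> x $ d" "sets N = sets borel" for N
      using cong[OF that(1) gY cont that(2)] by simp
    have "((\<lambda>i. c * (\<integral>x. ?e x \<partial>M i)) \<longlongrightarrow> c * (\<integral>x. ?e x \<partial>L)) F"
      by (intro tendsto_mult_left Laplace)
    moreover have "\<forall>\<^sub>F i in F. c * (\<integral>x. ?e x \<partial>M i) = (\<integral>x. ?g (Y x) \<partial>M i)"
      using M_pos by (rule eventually_mono) (rule eq[symmetric, OF _ M(2)])
    ultimately show ?case unfolding eq[OF L_pos L(2)] by (rule Lim_transform_eventually)
  next
    case (add f g)
    have "(\<integral>x. f (Y x) + g (Y x) \<partial>N) = (\<integral>x. f (Y x) \<partial>N) + (\<integral>x. g (Y x) \<partial>N)"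
      if "prob_space N" "sets N = sets borel" for N
      by (intro Bochner_Integration.integral_add gY_int that monomial_span_continuous add.hyps)
    thus ?case using tendsto_add[OF add.IH] M L by simp
  qed

  have conv_cube: "((\<lambda>i. \<integral>x. g (Y x) \<partial>M i) \<longlongrightarrow> (\<integral>x. g (Y x) \<partial>L)) F"
    if g: "continuous_on K g" for g :: "real ^ 'd \<Rightarrow> real"
  proof (rule tendstoI)
    fix e :: real assume e: "e > 0"
    obtain h where h: "monomial_span h" "\<And>y. y \<in> K \<Longrightarrow> \<bar>g y - h y\<bar> < e / 3"
      using monomial_span_dense[OF K g, of "e / 3"] e by auto
    have near: "\<bar>(\<integral>x. g (Y x) \<partial>N) - (\<integral>x. h (Y x) \<partial>N)\<bar> \<le> e / 3"
      if N: "prob_space N" "sets N = sets borel" for N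
    proof -
      interpret N: prob_space N by fact
      have int: "integrable N (\<lambda>x. g (Y x))" "integrable N (\<lambda>x. h (Y x))"
        by (intro gY_int N g monomial_span_continuous h(1))+
      have "\<bar>(\<integral>x. g (Y x) - h (Y x) \<partial>N)\<bar> \<le> (\<integral>x. \<bar>g (Y x) - h (Y x)\<bar> \<partial>N)"
        by (rule integral_abs_bound)
      also have "\<dots> \<le> (\<integral>x. e / 3 \<partial>N)"
        by (rule integral_mono) (use int h(2) YK in \<open>auto intro: less_imp_le\<close>)
      also have "\<dots> = e / 3" by (simp add: N.prob_space)
      finally show ?thesis using int by simp
    qed
    have "\<forall>\<^sub>F i in F. dist (\<integral>x. h (Y x) \<partial>M i) (\<integral>x. h (Y x) \<partial>L) < e / 3"
      using conv_monomial[OF h(1)] e by (intro tendstoD) auto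
    thus "\<forall>\<^sub>F i in F. dist (\<integral>x. g (Y x) \<partial>M i) (\<integral>x. g (Y x) \<partial>L) < e"
    proof (rule eventually_mono)
      fix i assume "dist (\<integral>x. h (Y x) \<partial>M i) (\<integral>x. h (Y x) \<partial>L) < e / 3"
      thus "dist (\<integral>x. g (Y x) \<partial>M i) (\<integral>x. g (Y x) \<partial>L) < e"
        using near[OF M, of i] near[OF L] unfolding dist_real_def by linarith
    qed
  qed

  have conv_cutoff: "((\<lambda>i. \<integral>x. h x \<partial>M i) \<longlongrightarrow> (\<integral>x. h x \<partial>L)) F"
    if h: "continuous_on UNIV h" and h0: "\<And>x. R \<le> (\<Sum>d\<in>UNIV. x $ d) \<Longrightarrow> h x = 0" and R: "R > 0"
    for h :: "real ^ 'd \<Rightarrow> real" and R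
  proof -
    \<comment> \<open>The logarithm undoes \<open>Y\<close>. Truncation at \<open>exp (- R)\<close>
      makes \<open>g\<close> continuous also on the faces of the cube that stand for
      infinity.\<close>
    define g where "g = (\<lambda>y :: real ^ 'd. h (\<chi> d. - ln (max (y $ d) (exp (- R)))))"
    have nz: "max t (exp (- R)) \<noteq> 0" for t :: real
      using exp_gt_zero[of "- R"] max.cobounded2[of "exp (- R)" t] by linarith
    have g: "continuous_on A g" for A unfolding g_def
      by (rule continuous_on_compose2[OF h]) (auto intro!: continuous_intros simp: nz)
    have gY: "g (Y x) = h x" if x: "\<And>d. 0 \<le> x $ d" for x
    proof -
      have min: "- ln (max (Y x $ d) (exp (- R))) = min (x $ d) R" for d
        using x[of d] by (cases "x $ d \<le> R") (auto simp: Y_def max_def min_def)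
      show ?thesis
      proof (cases "\<forall>d. x $ d \<le> R")
        case True
        hence "(\<chi> d. min (x $ d) R) = x" by (auto simp: vec_eq_iff)
        thus ?thesis by (simp add: g_def min)
      next
        \<comment> \<open>If a coordinate exceeds \<open>R\<close>, the coordinate sum is at least
          \<open>R\<close> for \<open>x\<close> and also for its truncation, so \<open>h\<close>
          vanishes at both.\<close>
        case False
        then obtain d where d: "x $ d > R" by (auto simp: not_le)
        have "x $ d \<le> (\<Sum>d\<in>UNIV. x $ d)" by (rule member_le_sum) (use x in auto)
        moreover have "min (x $ d) R \<le> (\<Sum>d\<in>UNIV. min (x $ d) R)"
          by (rule member_le_sum) (use x R in \<open>auto simp: min_def less_imp_le\<close>)
        ultimately have "h x = 0" "h (\<chi> d. min (x $ d) R) = 0" using d by (auto intro!: h0)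
        thus ?thesis by (simp add: g_def min)
      qed
    qed
    have eq: "(\<integral>x. g (Y x) \<partial>N) = (\<integral>x. h x \<partial>N)"
      if "AE x in N. \<forall>d. 0 \<le> x $ d" "sets N = sets borel" for N
      by (rule cong[OF that(1) gY gY_cont[OF g] h that(2)])
    have "\<forall>\<^sub>F i in F. (\<integral>x. g (Y x) \<partial>M i) = (\<integral>x. h x \<partial>M i)"
      using M_pos by (rule eventually_mono) (rule eq[OF _ M(2)])
    with conv_cube[OF g] show ?thesis unfolding eq[OF L_pos L(2)] by (rule Lim_transform_eventually)
  qed

  \<comment> \<open>A continuous cutoff: both \<open>\<psi> k\<close> and
    \<open>f * \<psi> k\<close> fall under \<open>conv_cutoff\<close>, and the mass lost by cutting
    is controlled by the integral of \<open>\<psi> k\<close>.\<close>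
  define \<psi> where "\<psi> = (\<lambda>(k::nat) (x :: real ^ 'd). max 0 (min 1 (k + 1 - (\<Sum>d\<in>UNIV. x $ d))))"
  have \<psi>_cont: "continuous_on UNIV (\<psi> k)" for k unfolding \<psi>_def by (intro continuous_intros)
  have \<psi>01: "0 \<le> \<psi> k x" "\<psi> k x \<le> 1" for k x by (auto simp: \<psi>_def)
  have \<psi>0: "\<psi> k x = 0" if "real k + 1 \<le> (\<Sum>d\<in>UNIV. x $ d)" for k x using that by (simp add: \<psi>_def)
  have \<psi>_int: "integrable N (\<psi> k)" if "prob_space N" "sets N = sets borel" for N k
    by (rule integrable_bounded_continuous[OF that \<psi>_cont, of _ 1]) (use \<psi>01 in auto)
  have \<psi>_lim: "(\<lambda>k. \<integral>x. \<psi> k x \<partial>L) \<longlonglongrightarrow> 1"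
  proof -
    interpret L: prob_space L by fact
    have "(\<lambda>k. \<integral>x. \<psi> k x \<partial>L) \<longlonglongrightarrow> (\<integral>x. 1 \<partial>L)"
    proof (rule integral_dominated_convergence[where w = "\<lambda>_. 1"])
      show "AE x in L. (\<lambda>k. \<psi> k x) \<longlonglongrightarrow> 1"
      proof (rule AE_I2)
        fix x
        have "\<forall>\<^sub>F k in sequentially. \<psi> k x = 1"
          using eventually_ge_at_top[of "nat \<lceil>\<Sum>d\<in>UNIV. x $ d\<rceil>"]
        proof eventually_elim
          case (elim k)
          hence "(\<Sum>d\<in>UNIV. x $ d) \<le> real k" by linarith
          thus ?case by (simp add: \<psi>_def)
        qed
        thus "(\<lambda>k. \<psi> k x) \<longlonglongrightarrow> 1" by (rule tendsto_eventually)
      qed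
    qed (use \<psi>01 \<psi>_cont L meas in auto)
    thus ?thesis by (simp add: L.prob_space)
  qed
  show ?thesis
    unfolding converges_in_distribution_def
  proof (intro allI impI tendstoI)
    fix f :: "real ^ 'd \<Rightarrow> real" and e :: real
    assume f: "continuous_on UNIV f" "bounded (range f)" and e: "e > 0"
    obtain B where B: "B > 0" "\<And>x. \<bar>f x\<bar> \<le> B"
      using f(2) by (auto simp: bounded_pos)
    have f_int: "integrable N f" if "prob_space N" "sets N = sets borel" for N
      by (rule integrable_bounded_continuous[OF that f(1) B(2)])
    have tail: "\<bar>(\<integral>x. f x \<partial>N) - (\<integral>x. f x * \<psi> k x \<partial>N)\<bar> \<le> B * (1 - (\<integral>x. \<psi> k x \<partial>N))"
      if N: "prob_space N" "sets N = sets borel" for N k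
    proof -
      interpret N: prob_space N by fact
      have int: "integrable N (\<lambda>x. f x * \<psi> k x)"
      proof (rule integrable_bounded_continuous[OF N])
        show "continuous_on UNIV (\<lambda>x. f x * \<psi> k x)" by (intro continuous_intros f \<psi>_cont)
        show "\<bar>f x * \<psi> k x\<bar> \<le> B * 1" for x
          unfolding abs_mult by (intro mult_mono) (use B \<psi>01 in \<open>auto simp: less_imp_le\<close>)
      qed
      have int': "integrable N (\<lambda>x. B * (1 - \<psi> k x))" by (intro integrable_mult_right Bochner_Integration.integrable_diff \<psi>_int N) simp
      have "\<bar>\<integral>x. f x - f x * \<psi> k x \<partial>N\<bar> \<le> (\<integral>x. \<bar>f x - f x * \<psi> k x\<bar> \<partial>N)"
        by (rule integral_abs_bound)
      also have "\<dots> \<le> (\<integral>x. B * (1 - \<psi> k x) \<partial>N)"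
      proof (rule integral_mono)
        show "\<bar>f x - f x * \<psi> k x\<bar> \<le> B * (1 - \<psi> k x)" for x
        proof -
          have "\<bar>f x - f x * \<psi> k x\<bar> = \<bar>f x\<bar> * \<bar>1 - \<psi> k x\<bar>" unfolding abs_mult[symmetric] by (simp add: algebra_simps)
          also have "\<dots> \<le> B * (1 - \<psi> k x)" using \<psi>01[of k x] B by (intro mult_mono) auto
          finally show ?thesis .
        qed
      qed (use int int' f_int[OF N] in auto)
      also have "\<dots> = B * (1 - (\<integral>x. \<psi> k x \<partial>N))"
        using \<psi>_int[OF N, of k] by (simp add: N.prob_space)
      finally show ?thesis using int f_int[OF N] by simp
    qed
    \<comment> \<open>The two tails, of \<open>M i\<close> and of \<open>L\<close>, then cost less
      than \<open>e / 4\<close> each, which leaves \<open>e / 2\<close> for the cut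
      integrals.\<close>
    define e' where "e' = e / (4 * B)"
    have e': "e' > 0" using e B by (simp add: e'_def)
    have "\<forall>\<^sub>F k in sequentially. dist (\<integral>x. \<psi> k x \<partial>L) 1 < e'" by (rule tendstoD[OF \<psi>_lim e'])
    then obtain k where k: "1 - (\<integral>x. \<psi> k x \<partial>L) < e'"
      unfolding eventually_sequentially dist_real_def by (metis abs_minus_commute abs_less_iff order_refl)
    \<comment> \<open>Tightness: the mass missed by the cutoff converges to that of
      \<open>L\<close>, which is small by the choice of \<open>k\<close>.\<close>
    have "((\<lambda>i. 1 - (\<integral>x. \<psi> k x \<partial>M i)) \<longlongrightarrow> 1 - (\<integral>x. \<psi> k x \<partial>L)) F"
      by (intro tendsto_diff tendsto_const conv_cutoff[of _ "real k + 1"] \<psi>_cont \<psi>0) auto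
    hence 1: "\<forall>\<^sub>F i in F. 1 - (\<integral>x. \<psi> k x \<partial>M i) < e'" using k by (rule order_tendstoD)
    have "((\<lambda>i. \<integral>x. f x * \<psi> k x \<partial>M i) \<longlongrightarrow> (\<integral>x. f x * \<psi> k x \<partial>L)) F"
      by (intro conv_cutoff[of _ "real k + 1"] continuous_intros f \<psi>_cont) (auto simp: \<psi>0)
    hence 2: "\<forall>\<^sub>F i in F. dist (\<integral>x. f x * \<psi> k x \<partial>M i) (\<integral>x. f x * \<psi> k x \<partial>L) < e / 2"
      using e by (intro tendstoD) auto
    from 1 2 show "\<forall>\<^sub>F i in F. dist (\<integral>x. f x \<partial>M i) (\<integral>x. f x \<partial>L) < e"
    proof eventually_elim
      case (elim i)
      have "B * (1 - (\<integral>x. \<psi> k x \<partial>M i)) < e / 4" "B * (1 - (\<integral>x. \<psi> k x \<partial>L)) < e / 4"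
        using elim(1) k B(1) by (auto simp: e'_def field_simps)
      thus ?case
        using tail[OF M, of i k] tail[OF L, of k] elim(2) unfolding dist_real_def by linarith
    qed
  qed
qed

section \<open>Heavy-traffic limit\<close>

text \<open>Tilting turns the density of rate 1 into that of rate \<open>1 + c\<close> divided by
  \<open>1 + c\<close>, and the latter density has integral 1.\<close>

lemma exponential_Laplace:
  assumes "c \<ge> 0"
  shows "(\<integral>e. exp (- (c * e)) \<partial>density lborel (exponential_density 1)) = 1 / (1 + c)"
proof -
  interpret E: prob_space "density lborel (\<lambda>x. ennreal (exponential_density (1 + c) x))"
    by (rule prob_space_exponential_density) (use assms in simp)
  have dens_nn: "AE x in lborel. 0 \<le> exponential_density r x" if "r > 0" for r
    using that by (auto simp: exponential_density_def)
  have "(\<integral>e. exp (- (c * e)) \<partial>density lborel (exponential_density 1)) =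
      (\<integral>e. exponential_density 1 e * exp (- (c * e)) \<partial>lborel)"
    by (subst integral_density) (auto intro: dens_nn)
  also have "\<dots> = (\<integral>e. exponential_density (1 + c) e / (1 + c) \<partial>lborel)"
    using assms by (intro Bochner_Integration.integral_cong)
      (auto simp: exponential_density_def exp_add[symmetric] nonzero_eq_divide_eq algebra_simps)
  also have "\<dots> = (\<integral>e. exponential_density (1 + c) e \<partial>lborel) / (1 + c)"
    by simp
  also have "(\<integral>e. exponential_density (1 + c) e \<partial>lborel) =
      (\<integral>e. 1 \<partial>density lborel (\<lambda>x. ennreal (exponential_density (1 + c) x)))"
    by (subst integral_density) (use assms in \<open>auto intro: dens_nn\<close>)
  also have "\<dots> = 1" using E.prob_space by simp
  finally show ?thesis .
qed

locale critical_system =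
  fixes \<mu> :: "'n::finite \<Rightarrow> real" and \<S> :: "'n set set" and p :: "'n set \<Rightarrow> real"
    and Tstar :: "'n set set" and lstar :: real
  assumes mu_pos: "\<And>n. \<mu> n > 0" and empty_notin: "{} \<notin> \<S>" and cover: "\<Union>\<S> = UNIV"
    and p_pos: "\<And>S. S \<in> \<S> \<Longrightarrow> p S > 0"
    and arg_max: "is_arg_max (capacity_ratio \<mu> p) (\<lambda>T. T \<subseteq> \<S> \<and> T \<noteq> {}) Tstar"
    and unique: "\<And>T. is_arg_max (capacity_ratio \<mu> p) (\<lambda>T. T \<subseteq> \<S> \<and> T \<noteq> {}) T \<Longrightarrow> T = Tstar"
    and lstar: "lstar = mu_of \<mu> Tstar / (real CARD('n) * p_of p Tstar)"
begin

section \<open>Loads of the sets of types at the critical rate\<close>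

lemma Tstar: "Tstar \<subseteq> \<S>" "Tstar \<noteq> {}"
  using arg_max by (auto simp: is_arg_max_def)

lemma p_of_pos: "T \<subseteq> \<S> \<Longrightarrow> T \<noteq> {} \<Longrightarrow> p_of p T > 0"
  unfolding p_of_def by (intro sum_pos) (auto intro: p_pos)

lemma mu_of_pos: "T \<subseteq> \<S> \<Longrightarrow> T \<noteq> {} \<Longrightarrow> mu_of \<mu> T > 0"
  by (rule mu_of_positive[OF mu_pos]) (use empty_notin in auto)

lemma lstar_pos: "lstar > 0"
  using mu_of_pos[OF Tstar] p_of_pos[OF Tstar] by (simp add: lstar)

lemma critical_load: "real CARD('n) * lstar * p_of p Tstar = mu_of \<mu> Tstar"
  using p_of_pos[OF Tstar] by (simp add: lstar)

text \<open>A tie in the capacity ratio would make \<open>T\<close> a second maximizer, so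
  uniqueness yields strictness, and the denominator belonging to \<open>T\<close> stays positive at
  \<open>lstar\<close>.\<close>

lemma noncritical_load:
  assumes T: "T \<subseteq> \<S>" "T \<noteq> {}" "T \<noteq> Tstar"
  shows "real CARD('n) * lstar * p_of p T < mu_of \<mu> T"
proof -
  have "capacity_ratio \<mu> p T < capacity_ratio \<mu> p Tstar"
  proof (rule ccontr)
    assume "\<not> ?thesis"
    hence "is_arg_max (capacity_ratio \<mu> p) (\<lambda>T. T \<subseteq> \<S> \<and> T \<noteq> {}) T"
      using arg_max T unfolding is_arg_max_def by (meson le_less_trans not_less)
    thus False using unique T(3) by blast
  qed
  hence "mu_of \<mu> Tstar / p_of p Tstar * p_of p T < mu_of \<mu> T"
    using mu_of_pos[OF T(1,2)] mu_of_pos[OF Tstar] p_of_pos[OF Tstar] by (simp add: capacity_ratio_def field_simps)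
  thus ?thesis by (simp add: lstar)
qed

lemma subcritical: "0 < l \<Longrightarrow> l < lstar \<Longrightarrow> replication_system \<mu> \<S> p l"
proof
  fix T assume l: "0 < l" "l < lstar" and T: "T \<subseteq> \<S>" "T \<noteq> {}"
  have "real CARD('n) * l * p_of p T < real CARD('n) * lstar * p_of p T"
    using l p_of_pos[OF T] by simp
  also have "\<dots> \<le> mu_of \<mu> T"
    using noncritical_load[OF T] critical_load by (cases "T = Tstar") auto
  finally show "real CARD('n) * l * p_of p T < mu_of \<mu> T" .
qed (use mu_pos empty_notin cover p_pos in auto)

lemma eventually_subcritical: "\<forall>\<^sub>F l in at_left lstar. 0 < l \<and> l < lstar"
  using eventually_at_left_real[OF lstar_pos] by (rule eventually_mono) auto

section \<open>Scaled generating functions and their limits\<close>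

definition gap :: "real \<Rightarrow> real" where "gap l = 1 - l / lstar"

lemma gap_pos: "0 < l \<Longrightarrow> l < lstar \<Longrightarrow> gap l > 0"
  by (simp add: gap_def)

lemma gap_limit: "filterlim gap (at_right 0) (at_left lstar)"
  unfolding gap_def[abs_def] using lstar_pos by real_asymp

lemma gap_tendsto_0: "(gap \<longlongrightarrow> 0) (at_left lstar)"
  using gap_limit by (simp add: filterlim_at)

text \<open>The locale constant appears with explicit parameters because \<open>l\<close> now
  varies; the factor \<open>gap l\<close> in the argument is the scaling of the queue
  lengths.\<close>

definition gf :: "('n set \<Rightarrow> real) \<Rightarrow> 'n set set \<Rightarrow> real \<Rightarrow> real" where
  "gf \<theta> T l = replication_system.type_gf \<mu> p l (\<lambda>S. gap l * \<theta> S) T"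

definition tilted_rate :: "('n set \<Rightarrow> real) \<Rightarrow> 'n set \<Rightarrow> real \<Rightarrow> real" where
  "tilted_rate \<theta> S l = real CARD('n) * l * p S * exp (- (gap l * \<theta> S))"

definition limit_rate :: "'n set \<Rightarrow> real" where
  "limit_rate S = real CARD('n) * lstar * p S"

text \<open>The inner product of \<theta> with the limiting direction of the queue-length vector, so
  the target transform is \<open>1 / (1 + direction \<theta>)\<close>.\<close>

definition direction :: "('n set \<Rightarrow> real) \<Rightarrow> real" where
  "direction \<theta> = (\<Sum>S\<in>Tstar. p S / p_of p Tstar * \<theta> S)"

lemma limit_rate_pos: "S \<in> \<S> \<Longrightarrow> limit_rate S > 0"
  using p_pos lstar_pos by (simp add: limit_rate_def)

lemma sum_limit_rate: "sum limit_rate T = real CARD('n) * lstar * p_of p T"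
  by (simp add: limit_rate_def[abs_def] p_of_def sum_distrib_left)

lemma direction_nonneg: "(\<And>S. \<theta> S \<ge> 0) \<Longrightarrow> direction \<theta> \<ge> 0"
  unfolding direction_def using p_of_pos[OF Tstar] p_pos Tstar(1)
  by (intro sum_nonneg mult_nonneg_nonneg divide_nonneg_nonneg) (auto intro: less_imp_le)

lemma tilted_rate_limit: "(tilted_rate \<theta> S \<longlongrightarrow> limit_rate S) (at_left lstar)"
proof -
  have "((\<lambda>l. real CARD('n) * l * p S * exp (- (gap l * \<theta> S))) \<longlongrightarrow> real CARD('n) * lstar * p S * exp (- (0 * \<theta> S))) (at_left lstar)"
    by (intro tendsto_intros gap_tendsto_0)
  thus ?thesis by (simp add: tilted_rate_def[abs_def] limit_rate_def)
qed

lemma gf_empty [simp]: "0 < l \<Longrightarrow> l < lstar \<Longrightarrow> gf \<theta> {} l = 1"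
  using replication_system.type_gf_empty[OF subcritical] by (simp add: gf_def)

lemma gf_rec:
  assumes "\<And>S. \<theta> S \<ge> 0" "T \<subseteq> \<S>" "T \<noteq> {}"
  shows "\<forall>\<^sub>F l in at_left lstar. gf \<theta> T l =
    (\<Sum>S\<in>T. tilted_rate \<theta> S l * gf \<theta> (T - {S}) l) / (mu_of \<mu> T - (\<Sum>S\<in>T. tilted_rate \<theta> S l))"
  using eventually_subcritical
proof (rule eventually_mono)
  fix l assume l: "0 < l \<and> l < lstar"
  interpret replication_system \<mu> \<S> p l by (rule subcritical) (use l in auto)
  have nn: "gap l * \<theta> S \<ge> 0" for S using assms(1)[of S] gap_pos[of l] l by simp
  show "gf \<theta> T l = (\<Sum>S\<in>T. tilted_rate \<theta> S l * gf \<theta> (T - {S}) l) / (mu_of \<mu> T - (\<Sum>S\<in>T. tilted_rate \<theta> S l))"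
    using type_gf_has_sum(2)[of "\<lambda>S. gap l * \<theta> S" T] nn assms by (simp add: gf_def tilted_rate_def arr_def)
qed

text \<open>No subset of \<open>T\<close> is critical, so no denominator in the recursion vanishes.
  The tilt disappears with the gap, hence one limit \<open>H\<close> serves all \<theta>.\<close>

lemma gf_noncritical_limit:
  assumes "T \<subseteq> \<S>" "\<not> Tstar \<subseteq> T"
  shows "\<exists>H>0. \<forall>\<theta>. (\<forall>S. \<theta> S \<ge> 0) \<longrightarrow> (gf \<theta> T \<longlongrightarrow> H) (at_left lstar)"
proof -
  have "finite T" by simp
  thus ?thesis using assms
  proof (induction T rule: finite_psubset_induct)
    case (psubset T)
    show ?case
    proof (cases "T = {}")
      case True
      have "(gf \<theta> {} \<longlongrightarrow> 1) (at_left lstar)" for \<theta>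
        by (rule tendsto_eventually, rule eventually_mono[OF eventually_subcritical]) simp
      thus ?thesis using True by (intro exI[of _ 1]) auto
    next
      case False
      have "\<forall>S\<in>T. \<exists>H>0. \<forall>\<theta>. (\<forall>S. \<theta> S \<ge> 0) \<longrightarrow> (gf \<theta> (T - {S}) \<longlongrightarrow> H) (at_left lstar)"
        using psubset.IH psubset.prems by (metis Diff_subset psubsetI insert_Diff insertI1 Diff_iff dual_order.trans)
      then obtain H where H: "\<And>S. S \<in> T \<Longrightarrow> H S > 0"
        "\<And>S \<theta>. S \<in> T \<Longrightarrow> (\<forall>S. \<theta> S \<ge> 0) \<Longrightarrow> (gf \<theta> (T - {S}) \<longlongrightarrow> H S) (at_left lstar)"
        by metis
      have d: "mu_of \<mu> T - sum limit_rate T > 0"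
        using noncritical_load[of T] psubset.prems False by (auto simp: sum_limit_rate)
      define h where "h = (\<Sum>S\<in>T. limit_rate S * H S) / (mu_of \<mu> T - sum limit_rate T)"
      have "h > 0" unfolding h_def
        using d False psubset.prems(1) H(1) by (intro divide_pos_pos sum_pos mult_pos_pos limit_rate_pos) auto
      moreover have "(gf \<theta> T \<longlongrightarrow> h) (at_left lstar)" if \<theta>: "\<forall>S. \<theta> S \<ge> 0" for \<theta>
      proof (rule Lim_transform_eventually)
        show "((\<lambda>l. (\<Sum>S\<in>T. tilted_rate \<theta> S l * gf \<theta> (T - {S}) l) / (mu_of \<mu> T - (\<Sum>S\<in>T. tilted_rate \<theta> S l))) \<longlongrightarrow> h) (at_left lstar)"
          unfolding h_def by (intro tendsto_intros tilted_rate_limit H(2) \<theta>) (use d in auto)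
        show "\<forall>\<^sub>F l in at_left lstar. (\<Sum>S\<in>T. tilted_rate \<theta> S l * gf \<theta> (T - {S}) l) / (mu_of \<mu> T - (\<Sum>S\<in>T. tilted_rate \<theta> S l)) = gf \<theta> T l"
          by (rule eventually_mono[OF gf_rec[of \<theta> T]]) (use \<theta> psubset.prems False in auto)
      qed
      ultimately show ?thesis by blast
    qed
  qed
qed

text \<open>There is no constant term because the critical set is exactly saturated at
  \<open>lstar\<close>. To first order, the reduced arrival rate contributes 1 and the tilt
  contributes \<open>\<theta> S\<close>, averaged over the critical types with weights proportional
  to \<open>p S\<close>.\<close>

lemma critical_slack:
  assumes "\<And>S. \<theta> S \<ge> 0"
  shows "((\<lambda>l. (mu_of \<mu> Tstar - (\<Sum>S\<in>Tstar. tilted_rate \<theta> S l)) / gap l) \<longlongrightarrow> mu_of \<mu> Tstar * (1 + direction \<theta>)) (at_left lstar)"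
proof (rule Lim_transform_eventually)
  \<comment> \<open>With \<open>x = gap l\<close>, the arrival rate is \<open>1 - x\<close> times
    its critical value and the tilt multiplies it by \<open>exp (- (x * t))\<close>;
    \<open>?q\<close> is the resulting relative slack of one type per unit of gap.\<close>
  let ?q = "\<lambda>t x :: real. (1 - (1 - x) * exp (- (x * t))) / x"
  have q: "(?q t \<longlongrightarrow> 1 + t) (at_right 0)" for t by real_asymp
  show "((\<lambda>l. \<Sum>S\<in>Tstar. limit_rate S * ?q (\<theta> S) (gap l)) \<longlongrightarrow> mu_of \<mu> Tstar * (1 + direction \<theta>)) (at_left lstar)"
  proof -
    have "((\<lambda>l. \<Sum>S\<in>Tstar. limit_rate S * ?q (\<theta> S) (gap l)) \<longlongrightarrow> (\<Sum>S\<in>Tstar. limit_rate S * (1 + \<theta> S))) (at_left lstar)"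
      by (intro tendsto_sum tendsto_mult tendsto_const filterlim_compose[OF q gap_limit])
    also have "(\<Sum>S\<in>Tstar. limit_rate S * (1 + \<theta> S)) = mu_of \<mu> Tstar + (\<Sum>S\<in>Tstar. limit_rate S * \<theta> S)"
      by (simp add: distrib_left sum.distrib sum_limit_rate critical_load)
    also have "(\<Sum>S\<in>Tstar. limit_rate S * \<theta> S) = mu_of \<mu> Tstar * direction \<theta>"
      unfolding direction_def sum_distrib_left critical_load[symmetric]
      by (intro sum.cong refl) (use p_of_pos[OF Tstar] in \<open>simp add: limit_rate_def\<close>)
    finally show ?thesis by (simp add: distrib_left)
  qed
  show "\<forall>\<^sub>F l in at_left lstar. (\<Sum>S\<in>Tstar. limit_rate S * ?q (\<theta> S) (gap l)) = (mu_of \<mu> Tstar - (\<Sum>S\<in>Tstar. tilted_rate \<theta> S l)) / gap l"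
    using eventually_subcritical
  proof (rule eventually_mono)
    fix l assume l: "0 < l \<and> l < lstar"
    have "limit_rate S * ?q (\<theta> S) (gap l) = (limit_rate S - tilted_rate \<theta> S l) / gap l" for S
    proof -
      have "lstar * (1 - gap l) = l" using lstar_pos by (simp add: gap_def)
      hence "tilted_rate \<theta> S l = limit_rate S * ((1 - gap l) * exp (- (gap l * \<theta> S)))"
        by (simp add: tilted_rate_def limit_rate_def mult_ac)
      thus ?thesis by (simp add: right_diff_distrib)
    qed
    hence "(\<Sum>S\<in>Tstar. limit_rate S * ?q (\<theta> S) (gap l)) = (\<Sum>S\<in>Tstar. limit_rate S - tilted_rate \<theta> S l) / gap l"
      by (simp only: sum_divide_distrib)
    thus "(\<Sum>S\<in>Tstar. limit_rate S * ?q (\<theta> S) (gap l)) = (mu_of \<mu> Tstar - (\<Sum>S\<in>Tstar. tilted_rate \<theta> S l)) / gap l"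
      by (simp add: sum_subtractf sum_limit_rate critical_load)
  qed
qed

text \<open>Without \<open>Tstar\<close> inside \<open>T\<close> the generating function is bounded
  and its scaled limit is 0. At \<open>Tstar\<close> the gap cancels the vanishing denominator.
  Above \<open>Tstar\<close> the denominator stays positive and the recursion, linear in the smaller
  sets, carries the factor along. \<open>L\<close> is chosen before \<theta>, so that it cancels in
  ratios.\<close>

lemma gf_scaled_limit:
  assumes "T \<subseteq> \<S>"
  shows "\<exists>L\<ge>0. (T = Tstar \<longrightarrow> L > 0) \<and> (\<forall>\<theta>. (\<forall>S. \<theta> S \<ge> 0) \<longrightarrow>
     ((\<lambda>l. gap l * gf \<theta> T l) \<longlongrightarrow> L / (1 + direction \<theta>)) (at_left lstar))"
proof -
  have "finite T" by simp
  thus ?thesis using assms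
  proof (induction T rule: finite_psubset_induct)
    case (psubset T)
    consider "\<not> Tstar \<subseteq> T" | "T = Tstar" | "Tstar \<subset> T" by blast
    thus ?case
    proof cases
      case 1
      then obtain H where "\<And>\<theta>. (\<forall>S. \<theta> S \<ge> 0) \<Longrightarrow> (gf \<theta> T \<longlongrightarrow> H) (at_left lstar)"
        using gf_noncritical_limit[OF psubset.prems] by blast
      from tendsto_mult[OF gap_tendsto_0 this] show ?thesis using 1 by (intro exI[of _ 0]) auto
    next
      case 2
      have "\<forall>S\<in>T. \<exists>H>0. \<forall>\<theta>. (\<forall>S. \<theta> S \<ge> 0) \<longrightarrow> (gf \<theta> (T - {S}) \<longlongrightarrow> H) (at_left lstar)"
        using 2 psubset.prems by (intro ballI gf_noncritical_limit) auto
      then obtain H where H: "\<And>S. S \<in> T \<Longrightarrow> H S > 0"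
        "\<And>S \<theta>. S \<in> T \<Longrightarrow> (\<forall>S. \<theta> S \<ge> 0) \<Longrightarrow> (gf \<theta> (T - {S}) \<longlongrightarrow> H S) (at_left lstar)"
        by metis
      \<comment> \<open>The numerator of the recursion in the limit, over the part
        \<open>mu_of \<mu> T\<close> of the limiting slack that does not depend on \<theta>.\<close>
      define L where "L = (\<Sum>S\<in>T. limit_rate S * H S) / mu_of \<mu> T"
      have mu: "mu_of \<mu> T > 0" using 2 mu_of_pos[OF Tstar] by simp
      have "L > 0" unfolding L_def
        using mu 2 Tstar H(1) by (intro divide_pos_pos sum_pos mult_pos_pos limit_rate_pos) auto
      moreover have "((\<lambda>l. gap l * gf \<theta> T l) \<longlongrightarrow> L / (1 + direction \<theta>)) (at_left lstar)"
        if \<theta>: "\<forall>S. \<theta> S \<ge> 0" for \<theta>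
      proof (rule Lim_transform_eventually)
        have "mu_of \<mu> T * (1 + direction \<theta>) \<noteq> 0" using mu direction_nonneg[of \<theta>] \<theta> by simp
        hence "((\<lambda>l. (\<Sum>S\<in>T. tilted_rate \<theta> S l * gf \<theta> (T - {S}) l) / ((mu_of \<mu> T - (\<Sum>S\<in>T. tilted_rate \<theta> S l)) / gap l)) \<longlongrightarrow>
            (\<Sum>S\<in>T. limit_rate S * H S) / (mu_of \<mu> T * (1 + direction \<theta>))) (at_left lstar)"
          using critical_slack[of \<theta>] \<theta> unfolding 2[symmetric]
          by (intro tendsto_divide tendsto_sum tendsto_mult tilted_rate_limit H(2)) auto
        thus "((\<lambda>l. (\<Sum>S\<in>T. tilted_rate \<theta> S l * gf \<theta> (T - {S}) l) / ((mu_of \<mu> T - (\<Sum>S\<in>T. tilted_rate \<theta> S l)) / gap l)) \<longlongrightarrow>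
            L / (1 + direction \<theta>)) (at_left lstar)"
          by (simp add: L_def)
        show "\<forall>\<^sub>F l in at_left lstar. (\<Sum>S\<in>T. tilted_rate \<theta> S l * gf \<theta> (T - {S}) l) / ((mu_of \<mu> T - (\<Sum>S\<in>T. tilted_rate \<theta> S l)) / gap l) = gap l * gf \<theta> T l"
          by (rule eventually_mono[OF gf_rec[of \<theta> T]]) (use \<theta> 2 Tstar in auto)
      qed
      ultimately show ?thesis by (intro exI[of _ L]) auto
    next
      case 3
      have "\<forall>S\<in>T. \<exists>L\<ge>0. \<forall>\<theta>. (\<forall>S. \<theta> S \<ge> 0) \<longrightarrow>
          ((\<lambda>l. gap l * gf \<theta> (T - {S}) l) \<longlongrightarrow> L / (1 + direction \<theta>)) (at_left lstar)"
      proof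
        fix S assume "S \<in> T"
        thus "\<exists>L\<ge>0. \<forall>\<theta>. (\<forall>S. \<theta> S \<ge> 0) \<longrightarrow>
          ((\<lambda>l. gap l * gf \<theta> (T - {S}) l) \<longlongrightarrow> L / (1 + direction \<theta>)) (at_left lstar)"
          using psubset.IH[of "T - {S}"] psubset.prems by auto
      qed
      then obtain K where K: "\<And>S. S \<in> T \<Longrightarrow> K S \<ge> 0"
        "\<And>S \<theta>. S \<in> T \<Longrightarrow> (\<forall>S. \<theta> S \<ge> 0) \<Longrightarrow>
          ((\<lambda>l. gap l * gf \<theta> (T - {S}) l) \<longlongrightarrow> K S / (1 + direction \<theta>)) (at_left lstar)"
        by metis
      have d: "mu_of \<mu> T - sum limit_rate T > 0"
        using noncritical_load[of T] psubset.prems 3 by (auto simp: sum_limit_rate)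
      define L where "L = (\<Sum>S\<in>T. limit_rate S * K S) / (mu_of \<mu> T - sum limit_rate T)"
      have "L \<ge> 0" unfolding L_def
        using d psubset.prems(1) K(1) by (intro divide_nonneg_pos sum_nonneg mult_nonneg_nonneg) (auto intro: less_imp_le limit_rate_pos)
      moreover have "((\<lambda>l. gap l * gf \<theta> T l) \<longlongrightarrow> L / (1 + direction \<theta>)) (at_left lstar)"
        if \<theta>: "\<forall>S. \<theta> S \<ge> 0" for \<theta>
      proof (rule Lim_transform_eventually)
        have "((\<lambda>l. (\<Sum>S\<in>T. tilted_rate \<theta> S l * (gap l * gf \<theta> (T - {S}) l)) / (mu_of \<mu> T - (\<Sum>S\<in>T. tilted_rate \<theta> S l))) \<longlongrightarrow>
            (\<Sum>S\<in>T. limit_rate S * (K S / (1 + direction \<theta>))) / (mu_of \<mu> T - sum limit_rate T)) (at_left lstar)"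
          by (intro tendsto_divide tendsto_diff tendsto_const tendsto_sum tendsto_mult tilted_rate_limit K(2) \<theta>) (use d in auto)
        also have "(\<Sum>S\<in>T. limit_rate S * (K S / (1 + direction \<theta>))) / (mu_of \<mu> T - sum limit_rate T) = L / (1 + direction \<theta>)"
          by (simp add: L_def sum_divide_distrib[symmetric] mult_ac)
        finally show "((\<lambda>l. (\<Sum>S\<in>T. tilted_rate \<theta> S l * (gap l * gf \<theta> (T - {S}) l)) / (mu_of \<mu> T - (\<Sum>S\<in>T. tilted_rate \<theta> S l))) \<longlongrightarrow>
            L / (1 + direction \<theta>)) (at_left lstar)" .
        have eq: "(\<Sum>S\<in>T. tilted_rate \<theta> S l * (gap l * gf \<theta> (T - {S}) l)) = gap l * (\<Sum>S\<in>T. tilted_rate \<theta> S l * gf \<theta> (T - {S}) l)" for l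
          by (simp add: sum_distrib_left mult_ac)
        show "\<forall>\<^sub>F l in at_left lstar. (\<Sum>S\<in>T. tilted_rate \<theta> S l * (gap l * gf \<theta> (T - {S}) l)) / (mu_of \<mu> T - (\<Sum>S\<in>T. tilted_rate \<theta> S l)) = gap l * gf \<theta> T l"
          unfolding eq by (rule eventually_mono[OF gf_rec[of \<theta> T]]) (use \<theta> psubset.prems 3 in auto)
      qed
      ultimately show ?thesis using 3 by (intro exI[of _ L]) auto
    qed
  qed
qed

text \<open>
  The pole of the generating function at \<^term>\<open>lstar\<close> comes from the critical subset alone, hence the
  limit does not depend on the coefficients \<^term>\<open>W\<close>; they account for the idle servers in
  the cancel-on-start system.
\<close>

lemma Laplace_ratio_limit:
  fixes W :: "'u \<Rightarrow> real \<Rightarrow> real"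
  assumes U: "finite U" "u\<^sub>0 \<in> U" "D u\<^sub>0 = \<S>" "\<And>u. u \<in> U \<Longrightarrow> D u \<subseteq> \<S>"
    and W: "\<And>u. u \<in> U \<Longrightarrow> (W u \<longlongrightarrow> w u) (at_left lstar)" "\<And>u. u \<in> U \<Longrightarrow> w u > 0"
    and \<theta>: "\<And>S. \<theta> S \<ge> 0"
  shows "((\<lambda>l. (\<Sum>u\<in>U. W u l * (\<Sum>T\<in>Pow (D u). gf \<theta> T l)) / (\<Sum>u\<in>U. W u l * (\<Sum>T\<in>Pow (D u). gf (\<lambda>_. 0) T l)))
     \<longlongrightarrow> 1 / (1 + direction \<theta>)) (at_left lstar)"
proof -
  obtain L where L: "\<And>T. T \<subseteq> \<S> \<Longrightarrow> L T \<ge> 0" "L Tstar > 0"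
    "\<And>T \<theta>. T \<subseteq> \<S> \<Longrightarrow> (\<forall>S. \<theta> S \<ge> 0) \<Longrightarrow> ((\<lambda>l. gap l * gf \<theta> T l) \<longlongrightarrow> L T / (1 + direction \<theta>)) (at_left lstar)"
    using gf_scaled_limit Tstar(1) by metis
  define F where "F = (\<lambda>\<theta> l. \<Sum>u\<in>U. W u l * (\<Sum>T\<in>Pow (D u). gf \<theta> T l))"
  define K where "K = (\<Sum>u\<in>U. w u * (\<Sum>T\<in>Pow (D u). L T))"
  have F: "((\<lambda>l. gap l * F \<theta> l) \<longlongrightarrow> K / (1 + direction \<theta>)) (at_left lstar)" if \<theta>: "\<forall>S. \<theta> S \<ge> 0" for \<theta>
  proof -
    have "((\<lambda>l. \<Sum>u\<in>U. W u l * (\<Sum>T\<in>Pow (D u). gap l * gf \<theta> T l)) \<longlongrightarrow>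
        (\<Sum>u\<in>U. w u * (\<Sum>T\<in>Pow (D u). L T / (1 + direction \<theta>)))) (at_left lstar)"
      by (intro tendsto_sum tendsto_mult W(1) L(3) \<theta>) (use U(4) in auto)
    moreover have "(\<Sum>u\<in>U. W u l * (\<Sum>T\<in>Pow (D u). gap l * gf \<theta> T l)) = gap l * F \<theta> l" for l
      by (simp add: F_def sum_distrib_left mult_ac)
    moreover have "(\<Sum>u\<in>U. w u * (\<Sum>T\<in>Pow (D u). L T / (1 + direction \<theta>))) = K / (1 + direction \<theta>)"
      by (simp add: K_def sum_divide_distrib[symmetric])
    ultimately show ?thesis by simp
  qed
  have nn: "w u * (\<Sum>T\<in>Pow (D u). L T) \<ge> 0" if "u \<in> U" for u
    using W(2)[OF that] U(4)[OF that] L(1) by (intro mult_nonneg_nonneg sum_nonneg) auto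
  \<comment> \<open>All terms of \<open>K\<close> are nonnegative, so one positive term is enough:
    \<open>Tstar\<close> is among the subsets of \<open>D u\<^sub>0\<close>.\<close>
  have "0 < L Tstar" by (rule L)
  also have "L Tstar \<le> (\<Sum>T\<in>Pow (D u\<^sub>0). L T)"
    by (rule member_le_sum) (use L(1) Tstar(1) U(3) in auto)
  finally have "0 < w u\<^sub>0 * (\<Sum>T\<in>Pow (D u\<^sub>0). L T)" using W(2) U(2) by simp
  also have "\<dots> \<le> K"
    unfolding K_def by (rule member_le_sum) (use nn U in auto)
  finally have K: "K > 0" .
  \<comment> \<open>Numerator and normalization both grow like \<open>1 / gap l\<close>; after
    scaling both, the common constant \<open>K\<close> cancels.\<close>
  have "((\<lambda>l. (gap l * F \<theta> l) / (gap l * F (\<lambda>_. 0) l)) \<longlongrightarrow> (K / (1 + direction \<theta>)) / (K / (1 + direction (\<lambda>_. 0)))) (at_left lstar)"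
    by (intro tendsto_divide F) (use \<theta> K in \<open>auto simp: direction_def\<close>)
  also have "(K / (1 + direction \<theta>)) / (K / (1 + direction (\<lambda>_. 0))) = 1 / (1 + direction \<theta>)"
    using K by (simp add: direction_def)
  finally have "((\<lambda>l. (gap l * F \<theta> l) / (gap l * F (\<lambda>_. 0) l)) \<longlongrightarrow> 1 / (1 + direction \<theta>)) (at_left lstar)" .
  moreover have "\<forall>\<^sub>F l in at_left lstar. (gap l * F \<theta> l) / (gap l * F (\<lambda>_. 0) l) = F \<theta> l / F (\<lambda>_. 0) l"
    using eventually_subcritical by (rule eventually_mono) (use gap_pos in fastforce)
  ultimately show ?thesis unfolding F_def by (rule Lim_transform_eventually)
qed

section \<open>Laplace limits for the two mechanisms\<close>

lemma coc_Laplace_limit: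
  assumes st: "\<And>l. 0 < l \<Longrightarrow> l < lstar \<Longrightarrow> stationary_distribution (coc_states \<S>) (coc_rate \<S> \<mu> p l) (\<pi> l)"
    and \<theta>: "\<And>S. \<theta> S \<ge> 0"
  shows "((\<lambda>l. measure_pmf.expectation (\<pi> l) (\<lambda>c. exp (- (\<Sum>S\<in>UNIV. \<theta> S * (gap l *\<^sub>R coc_jobs c) $ S))))
    \<longlongrightarrow> 1 / (1 + direction \<theta>)) (at_left lstar)"
proof (rule Lim_transform_eventually)
  \<comment> \<open>The cancel-on-completion state has no list of idle servers, so the index set is
    a single point of weight 1.\<close>
  show "((\<lambda>l. (\<Sum>u\<in>{()}. 1 * (\<Sum>T\<in>Pow \<S>. gf \<theta> T l)) / (\<Sum>u\<in>{()}. 1 * (\<Sum>T\<in>Pow \<S>. gf (\<lambda>_. 0) T l))) \<longlongrightarrow> 1 / (1 + direction \<theta>)) (at_left lstar)"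
    by (rule Laplace_ratio_limit[where u\<^sub>0 = "()" and w = "\<lambda>_. 1"]) (use \<theta> in auto)
  show "\<forall>\<^sub>F l in at_left lstar. (\<Sum>u\<in>{()}. 1 * (\<Sum>T\<in>Pow \<S>. gf \<theta> T l)) / (\<Sum>u\<in>{()}. 1 * (\<Sum>T\<in>Pow \<S>. gf (\<lambda>_. 0) T l)) =
     measure_pmf.expectation (\<pi> l) (\<lambda>c. exp (- (\<Sum>S\<in>UNIV. \<theta> S * (gap l *\<^sub>R coc_jobs c) $ S)))"
    using eventually_subcritical
  proof (rule eventually_mono)
    fix l assume l: "0 < l \<and> l < lstar"
    interpret replication_system \<mu> \<S> p l by (rule subcritical) (use l in auto)
    have nn: "gap l * \<theta> S \<ge> 0" for S using \<theta>[of S] gap_pos[of l] l by simp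
    from coc_Laplace[OF st, of "\<lambda>S. gap l * \<theta> S"] l nn
    show "(\<Sum>u\<in>{()}. 1 * (\<Sum>T\<in>Pow \<S>. gf \<theta> T l)) / (\<Sum>u\<in>{()}. 1 * (\<Sum>T\<in>Pow \<S>. gf (\<lambda>_. 0) T l)) =
       measure_pmf.expectation (\<pi> l) (\<lambda>c. exp (- (\<Sum>S\<in>UNIV. \<theta> S * (gap l *\<^sub>R coc_jobs c) $ S)))"
      by (simp add: gf_def mult_ac)
  qed
qed

text \<open>The idle-server factors stay away from 0 and infinity, because every server is
  compatible with some type and all arrival rates have positive limits.\<close>

lemma idle_weight_limit:
  "((\<lambda>l. replication_system.idle_weight \<mu> \<S> p l u) \<longlongrightarrow> (\<Prod>i<length u. \<mu> (u ! i) / (\<Sum>S | S \<in> \<S> \<and> S \<inter> set (take (Suc i) u) \<noteq> {}. limit_rate S))) (at_left lstar)"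
  (is "(_ \<longlongrightarrow> ?w) _")
  and idle_weight_limit_pos: "(\<Prod>i<length u. \<mu> (u ! i) / (\<Sum>S | S \<in> \<S> \<and> S \<inter> set (take (Suc i) u) \<noteq> {}. limit_rate S)) > 0"
proof -
  let ?A = "\<lambda>i. {S. S \<in> \<S> \<and> S \<inter> set (take (Suc i) u) \<noteq> {}}"
  have pos: "sum limit_rate (?A i) > 0" if "i < length u" for i
  proof -
    have "u ! i \<in> set (take (Suc i) u)" using that by (simp add: take_Suc_conv_app_nth)
    moreover obtain S where "S \<in> \<S>" "u ! i \<in> S" using cover by blast
    ultimately have "?A i \<noteq> {}" by blast
    thus ?thesis by (intro sum_pos) (auto intro: limit_rate_pos)
  qed
  thus "?w > 0" by (intro prod_pos ballI divide_pos_pos mu_pos) auto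
  show "((\<lambda>l. replication_system.idle_weight \<mu> \<S> p l u) \<longlongrightarrow> ?w) (at_left lstar)"
  proof (rule Lim_transform_eventually)
    show "((\<lambda>l. \<Prod>i<length u. \<mu> (u ! i) / (\<Sum>S\<in>?A i. real CARD('n) * l * p S)) \<longlongrightarrow> ?w) (at_left lstar)"
      unfolding limit_rate_def
      by (intro tendsto_prod tendsto_divide tendsto_sum tendsto_intros) (use pos in \<open>auto simp: limit_rate_def dest!: pos\<close>)
    show "\<forall>\<^sub>F l in at_left lstar. (\<Prod>i<length u. \<mu> (u ! i) / (\<Sum>S\<in>?A i. real CARD('n) * l * p S)) = replication_system.idle_weight \<mu> \<S> p l u"
      using eventually_subcritical
    proof (rule eventually_mono)
      fix l assume l: "0 < l \<and> l < lstar"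
      interpret replication_system \<mu> \<S> p l by (rule subcritical) (use l in auto)
      show "(\<Prod>i<length u. \<mu> (u ! i) / (\<Sum>S\<in>?A i. real CARD('n) * l * p S)) = idle_weight u"
        by (simp add: idle_weight_def prefix_weight_def arr_compatible_def arr_def)
    qed
  qed
qed

lemma cos_Laplace_limit:
  assumes st: "\<And>l. 0 < l \<Longrightarrow> l < lstar \<Longrightarrow> stationary_distribution (cos_states \<S>) (cos_rate \<S> \<mu> p l) (\<pi> l)"
    and \<theta>: "\<And>S. \<theta> S \<ge> 0"
  shows "((\<lambda>l. measure_pmf.expectation (\<pi> l) (\<lambda>x. exp (- (\<Sum>S\<in>UNIV. \<theta> S * (gap l *\<^sub>R cos_jobs x) $ S))))
    \<longlongrightarrow> 1 / (1 + direction \<theta>)) (at_left lstar)"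
proof -
  let ?W = "\<lambda>u l. replication_system.idle_weight \<mu> \<S> p l u"
  let ?D = "\<lambda>u. {S \<in> \<S>. S \<inter> set u = {}}"
  let ?Z = "\<lambda>\<theta> l. \<Sum>u | distinct u. ?W u l * (\<Sum>T\<in>Pow (?D u). gf \<theta> T l)"
  let ?wait = "\<lambda>l (c, u, s). exp (- (\<Sum>S\<in>UNIV. (gap l * \<theta> S) * count_list c S))"
  let ?all = "\<lambda>l x. exp (- (\<Sum>S\<in>UNIV. \<theta> S * (gap l *\<^sub>R cos_jobs x) $ S))"
  let ?E = "\<lambda>l. measure_pmf.expectation (\<pi> l)"
  \<comment> \<open>A crude bound: each type has at most \<open>CARD('n)\<close> jobs in
    service.\<close>
  define C where "C = (\<Sum>S\<in>UNIV. \<theta> S * CARD('n))"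
  \<comment> \<open>The fact does not involve the arrival rate; \<open>lstar / 2\<close> is just
    some rate at which the locale can be entered.\<close>
  have fin: "finite {u :: 'n list. distinct u}"
    using replication_system.finite_distinct[OF subcritical[of "lstar / 2"]] lstar_pos by simp
  have "((\<lambda>l. ?Z \<theta> l / ?Z (\<lambda>_. 0) l) \<longlongrightarrow> 1 / (1 + direction \<theta>)) (at_left lstar)"
    \<comment> \<open>With no idle server, every type may wait, so the critical set is
      present.\<close>
    by (rule Laplace_ratio_limit[where u\<^sub>0 = "[]"]) (use fin \<theta> idle_weight_limit idle_weight_limit_pos in auto)
  moreover have "\<forall>\<^sub>F l in at_left lstar. ?Z \<theta> l / ?Z (\<lambda>_. 0) l = ?E l (?wait l)"
    using eventually_subcritical
  proof (rule eventually_mono)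
    fix l assume l: "0 < l \<and> l < lstar"
    interpret replication_system \<mu> \<S> p l by (rule subcritical) (use l in auto)
    have nn: "gap l * \<theta> S \<ge> 0" for S using \<theta>[of S] gap_pos[of l] l by simp
    have "?E l (?wait l) = cos_gf (\<lambda>S. gap l * \<theta> S) / cos_gf (\<lambda>_. 0)"
      by (rule cos_Laplace[OF st]) (use l nn in auto)
    thus "?Z \<theta> l / ?Z (\<lambda>_. 0) l = ?E l (?wait l)" by (simp add: gf_def cos_gf_def)
  qed
  ultimately have wait: "((\<lambda>l. ?E l (?wait l)) \<longlongrightarrow> 1 / (1 + direction \<theta>)) (at_left lstar)"
    by (rule Lim_transform_eventually)
  have "\<forall>\<^sub>F l in at_left lstar. norm (?E l (?all l) - ?E l (?wait l)) \<le> gap l * C"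
    using eventually_subcritical
  proof (rule eventually_mono)
    fix l assume l: "0 < l \<and> l < lstar"
    have g: "gap l > 0" using gap_pos l by simp
    have all_nn: "(\<Sum>S\<in>UNIV. \<theta> S * (gap l *\<^sub>R cos_jobs x) $ S) \<ge> 0" for x
      using \<theta> g by (auto simp: cos_jobs_def split: prod.splits intro!: sum_nonneg)
    have wait_nn: "(\<Sum>S\<in>UNIV. (gap l * \<theta> S) * count_list c S) \<ge> 0" for c
      using \<theta> g by (auto intro!: sum_nonneg)
    have one_minus_exp: "1 - exp (- d) \<le> d" for d :: real
      using exp_ge_add_one_self[of "- d"] by linarith
    have exp_Lipschitz: "\<bar>exp (- a) - exp (- b)\<bar> \<le> a - b" if "0 \<le> b" "b \<le> a" for a b :: real
    proof -
      have "exp (- b) - exp (- a) = exp (- b) * (1 - exp (- (a - b)))"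
        by (simp add: right_diff_distrib exp_add[symmetric])
      also have "\<dots> \<le> 1 * (1 - exp (- (a - b)))"
        using that by (intro mult_right_mono) auto
      also have "\<dots> \<le> a - b"
        using one_minus_exp[of "a - b"] by simp
      finally have "exp (- b) - exp (- a) \<le> a - b" .
      moreover have "exp (- a) \<le> exp (- b)" using that by simp
      ultimately show ?thesis by (simp add: abs_if)
    qed
    have bound: "\<bar>?all l x - ?wait l x\<bar> \<le> gap l * C" for x
    proof -
      obtain c u s where x: "x = (c, u, s)" by (cases x)
      have eq: "(\<Sum>S\<in>UNIV. \<theta> S * (gap l *\<^sub>R cos_jobs x) $ S) =
          (\<Sum>S\<in>UNIV. (gap l * \<theta> S) * count_list c S) + (\<Sum>S\<in>UNIV. gap l * \<theta> S * card {n. s n = Some S})"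
        by (simp add: x cos_jobs_def algebra_simps sum.distrib)
      have "(\<Sum>S\<in>UNIV. gap l * \<theta> S * card {n. s n = Some S}) \<le> (\<Sum>S\<in>UNIV. gap l * \<theta> S * CARD('n))"
        using g \<theta> by (intro sum_mono mult_left_mono) (auto intro: card_mono)
      also have "\<dots> = gap l * C" by (simp add: C_def sum_distrib_left mult_ac)
      finally have le: "(\<Sum>S\<in>UNIV. gap l * \<theta> S * card {n. s n = Some S}) \<le> gap l * C" .
      have "0 \<le> (\<Sum>S\<in>UNIV. gap l * \<theta> S * card {n. s n = Some S})"
        using g \<theta> by (intro sum_nonneg) auto
      thus ?thesis using exp_Lipschitz[OF wait_nn[of c], of "\<Sum>S\<in>UNIV. \<theta> S * (gap l *\<^sub>R cos_jobs x) $ S"] le eq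
        by (simp add: x)
    qed
    have int: "integrable (measure_pmf (\<pi> l)) (?all l)" "integrable (measure_pmf (\<pi> l)) (?wait l)"
      using all_nn wait_nn by (auto intro!: measure_pmf.integrable_const_bound[where B = 1] simp: case_prod_unfold)
    have "\<bar>?E l (\<lambda>x. ?all l x - ?wait l x)\<bar> \<le> ?E l (\<lambda>x. \<bar>?all l x - ?wait l x\<bar>)"
      by (rule integral_abs_bound)
    also have "\<dots> \<le> ?E l (\<lambda>x. gap l * C)"
      by (rule integral_mono) (use int bound in auto)
    finally show "norm (?E l (?all l) - ?E l (?wait l)) \<le> gap l * C" using int by simp
  qed
  moreover have "((\<lambda>l. gap l * C) \<longlongrightarrow> 0) (at_left lstar)"
    using tendsto_mult_right[OF gap_tendsto_0, of C] by simp
  ultimately have "((\<lambda>l. ?E l (?all l) - ?E l (?wait l)) \<longlongrightarrow> 0) (at_left lstar)"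
    by (rule Lim_null_comparison)
  from tendsto_add[OF this wait] show ?thesis by simp
qed

section \<open>The limit law, and the passage from transforms to convergence in distribution\<close>

lemma limit_law_props:
  shows "prob_space (limit_law p Tstar)" and "sets (limit_law p Tstar) = sets borel"
    and "AE x in limit_law p Tstar. \<forall>S. 0 \<le> x $ S"
    and "(\<And>S. \<theta> S \<ge> 0) \<Longrightarrow> (\<integral>x. exp (- (\<Sum>S\<in>UNIV. \<theta> S * x $ S)) \<partial>limit_law p Tstar) = 1 / (1 + direction \<theta>)"
proof -
  let ?D = "density lborel (\<lambda>x. ennreal (exponential_density 1 x))"
  let ?f = "\<lambda>e :: real. (\<chi> S. if S \<in> Tstar then e * (p S / p_of p Tstar) else 0) :: real ^ ('n set)"
  interpret D: prob_space ?D by (rule prob_space_exponential_density) simp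
  have "continuous_on UNIV (\<lambda>e :: real. if S \<in> Tstar then e * (p S / p_of p Tstar) else 0)" for S
    using p_of_pos[OF Tstar] by (cases "S \<in> Tstar") (auto intro!: continuous_intros)
  hence "continuous_on UNIV ?f" by (rule continuous_on_vec_lambda)
  hence f: "?f \<in> ?D \<rightarrow>\<^sub>M borel"
    using borel_measurable_continuous_onI[of ?f] by (simp cong: measurable_cong_sets)
  show "prob_space (limit_law p Tstar)"
    unfolding limit_law_def by (rule D.prob_space_distr[OF f])
  show "sets (limit_law p Tstar) = sets borel" by (simp add: limit_law_def)
  have pos: "p S / p_of p Tstar \<ge> 0" if "S \<in> Tstar" for S
    using p_pos[of S] p_of_pos[OF Tstar] that Tstar(1) by (auto intro: less_imp_le)
  have "AE e in ?D. 0 \<le> e"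
    by (subst AE_density) (auto simp: exponential_density_def)
  hence "AE e in ?D. \<forall>S. 0 \<le> ?f e $ S"
    by (rule AE_mp) (use pos in \<open>auto intro!: AE_I2 mult_nonneg_nonneg simp del: times_divide_eq_right\<close>)
  thus "AE x in limit_law p Tstar. \<forall>S. 0 \<le> x $ S"
    unfolding limit_law_def by (subst AE_distr_iff[OF f]) auto
  assume \<theta>: "\<And>S. \<theta> S \<ge> 0"
  have dir: "(\<Sum>S\<in>UNIV. \<theta> S * ?f e $ S) = direction \<theta> * e" for e
  proof -
    have "(\<Sum>S\<in>UNIV. \<theta> S * ?f e $ S) = (\<Sum>S\<in>Tstar. p S / p_of p Tstar * \<theta> S * e)"
      by (rule sum.mono_neutral_cong_right) auto
    thus ?thesis by (simp add: direction_def sum_distrib_right)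
  qed
  have "(\<lambda>x :: real ^ ('n set). exp (- (\<Sum>S\<in>UNIV. \<theta> S * x $ S))) \<in> borel_measurable borel"
    by (intro borel_measurable_continuous_onI continuous_intros)
  hence "(\<integral>x. exp (- (\<Sum>S\<in>UNIV. \<theta> S * x $ S)) \<partial>limit_law p Tstar) = (\<integral>e. exp (- (\<Sum>S\<in>UNIV. \<theta> S * ?f e $ S)) \<partial>?D)"
    unfolding limit_law_def by (rule integral_distr[OF f])
  also have "\<dots> = (\<integral>e. exp (- (direction \<theta> * e)) \<partial>?D)"
    by (simp only: dir)
  also have "\<dots> = 1 / (1 + direction \<theta>)"
    by (rule exponential_Laplace) (use \<theta> direction_nonneg in auto)
  finally show "(\<integral>x. exp (- (\<Sum>S\<in>UNIV. \<theta> S * x $ S)) \<partial>limit_law p Tstar) = 1 / (1 + direction \<theta>)" .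
qed

lemma convergence_from_Laplace:
  fixes X :: "'s \<Rightarrow> real ^ ('n set)"
  assumes X: "\<And>x S. 0 \<le> X x $ S"
    and Laplace: "\<And>\<theta>. (\<And>S. \<theta> S \<ge> 0) \<Longrightarrow> ((\<lambda>l. measure_pmf.expectation (\<pi> l) (\<lambda>x. exp (- (\<Sum>S\<in>UNIV. \<theta> S * (gap l *\<^sub>R X x) $ S))))
      \<longlongrightarrow> 1 / (1 + direction \<theta>)) (at_left lstar)"
  shows "converges_in_distribution (\<lambda>l. distr (measure_pmf (\<pi> l)) borel (\<lambda>x. (1 - l / lstar) *\<^sub>R X x))
     (limit_law p Tstar) (at_left lstar)"
proof (rule converges_in_distribution_Laplace)
  let ?M = "\<lambda>l. distr (measure_pmf (\<pi> l)) borel (\<lambda>x. (1 - l / lstar) *\<^sub>R X x)"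
  show "prob_space (?M l)" for l by (rule measure_pmf.prob_space_distr) simp
  show "\<forall>\<^sub>F l in at_left lstar. AE x in ?M l. \<forall>S. 0 \<le> x $ S"
    using eventually_subcritical
  proof (rule eventually_mono)
    fix l assume "0 < l \<and> l < lstar"
    hence "gap l \<ge> 0" using gap_pos by (simp add: less_imp_le)
    thus "AE x in ?M l. \<forall>S. 0 \<le> x $ S"
      using X by (subst AE_distr_iff) (auto simp: gap_def)
  qed
  fix k :: "'n set \<Rightarrow> nat"
  have "(\<lambda>x :: real ^ ('n set). exp (- (\<Sum>S\<in>UNIV. real (k S) * x $ S))) \<in> borel_measurable borel"
    by (intro borel_measurable_continuous_onI continuous_intros)
  hence "(\<integral>x. exp (- (\<Sum>S\<in>UNIV. real (k S) * x $ S)) \<partial>?M l) =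
      measure_pmf.expectation (\<pi> l) (\<lambda>x. exp (- (\<Sum>S\<in>UNIV. real (k S) * (gap l *\<^sub>R X x) $ S)))" for l
    unfolding gap_def by (intro integral_distr) auto
  thus "((\<lambda>l. \<integral>x. exp (- (\<Sum>S\<in>UNIV. real (k S) * x $ S)) \<partial>?M l) \<longlongrightarrow>
      (\<integral>x. exp (- (\<Sum>S\<in>UNIV. real (k S) * x $ S)) \<partial>limit_law p Tstar)) (at_left lstar)"
    using Laplace[of "\<lambda>S. real (k S)"] limit_law_props(4)[of "\<lambda>S. real (k S)"] by simp
qed (use limit_law_props in auto)

end

theorem theorem2:
  fixes \<mu> :: "'n::finite \<Rightarrow> real"
    and \<S> :: "'n set set"
    and p :: "'n set \<Rightarrow> real"
    and Tstar :: "'n set set"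
    and lstar :: real
    and \<pi>_coc :: "real \<Rightarrow> 'n coc_state pmf"
    and \<pi>_cos :: "real \<Rightarrow> 'n cos_state pmf"
  assumes "\<And>n. \<mu> n > 0"
    and "\<S> \<noteq> {}" and "{} \<notin> \<S>" and "\<Union>\<S> = UNIV"
    and "\<And>S. S \<in> \<S> \<Longrightarrow> p S > 0" and "(\<Sum>S\<in>\<S>. p S) = 1"
    and "is_arg_max (capacity_ratio \<mu> p) (\<lambda>T. T \<subseteq> \<S> \<and> T \<noteq> {}) Tstar"
    and "\<And>T. is_arg_max (capacity_ratio \<mu> p) (\<lambda>T. T \<subseteq> \<S> \<and> T \<noteq> {}) T \<Longrightarrow> T = Tstar"
    and "lstar = mu_of \<mu> Tstar / (real CARD('n) * p_of p Tstar)"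
    and "\<And>l. 0 < l \<Longrightarrow> l < lstar \<Longrightarrow>
           stationary_distribution (coc_states \<S>) (coc_rate \<S> \<mu> p l) (\<pi>_coc l)"
    and "\<And>l. 0 < l \<Longrightarrow> l < lstar \<Longrightarrow>
           stationary_distribution (cos_states \<S>) (cos_rate \<S> \<mu> p l) (\<pi>_cos l)"
  shows "converges_in_distribution
           (\<lambda>l. distr (measure_pmf (\<pi>_coc l)) borel (\<lambda>x. (1 - l / lstar) *\<^sub>R coc_jobs x))
           (limit_law p Tstar) (at_left lstar) \<and>
         converges_in_distribution
           (\<lambda>l. distr (measure_pmf (\<pi>_cos l)) borel (\<lambda>x. (1 - l / lstar) *\<^sub>R cos_jobs x))
           (limit_law p Tstar) (at_left lstar)"
proof -
  interpret critical_system \<mu> \<S> p Tstar lstar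
    by (rule critical_system.intro) (fact assms)+
  show ?thesis
  proof (intro conjI convergence_from_Laplace)
    show "0 \<le> coc_jobs c $ S" for c :: "'n coc_state" and S
      by (simp add: coc_jobs_def)
    show "0 \<le> cos_jobs x $ S" for x :: "'n cos_state" and S
      by (simp add: cos_jobs_def split: prod.splits)
  qed (intro coc_Laplace_limit cos_Laplace_limit assms; assumption)+
qed

end
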